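(* Let $\alpha_*=2\left(\frac{36}{37}\right)^2$. For any $\alpha>\alpha_*$ there exists $C>0$ such that, for $B=1$ or $B=\partial_s$, for all $L>0$, all $T\in\,]0,(\min\{\pi,L\})^2]$ and all $u_0\in L^2(0,L)$, there is a $g\in L^2(0,T)$ such that the solution $u\in C^0([0,\infty),L^2(0,L))$ of the heat equation on $[0,L]$ controlled by $g$ from one end, $$\partial_t u-\partial_s^2u=0\ \text{ in } ]0,T[\times]0,L[,\qquad (Bu)|_{s=0}=0,\qquad u|_{s=L}=g,\qquad u|_{t=0}=u_0,$$ satisfies $u=0$ at $t=T$ and $$\|g\|_{L^2(0,T)}\le C e^{\alpha L^2/T}\|u_0\|_{L^2(0,L)}.$$
   Context: Here $t$ is the time variable and $s\in[0,L]$ the space variable. $B=1$ corresponds to the zero Dirichlet condition $u|_{s=0}=0$ and $B=\partial_s$ to the zero Neumann condition $\partial_su|_{s=0}=0$. The constant $C$ depends only on $\alpha$. *)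

theory Defs
  imports "HOL-Analysis.Analysis"
begin

text \<open>
  Elements of \<open>L\<^sup>2(a,b)\<close> are represented by (complex-valued) functions; equality in \<open>L\<^sup>2(a,b)\<close> is
  equality almost everywhere.
\<close>

definition L2_on :: "real \<Rightarrow> real \<Rightarrow> (real \<Rightarrow> complex) \<Rightarrow> bool" where
  "L2_on a b f \<longleftrightarrow>
     f \<in> borel_measurable (lebesgue_on {a<..<b}) \<and>
     integrable (lebesgue_on {a<..<b}) (\<lambda>x. (cmod (f x))\<^sup>2)"

definition L2_norm_on :: "real \<Rightarrow> real \<Rightarrow> (real \<Rightarrow> complex) \<Rightarrow> real" where
  "L2_norm_on a b f = sqrt (integral\<^sup>L (lebesgue_on {a<..<b}) (\<lambda>x. (cmod (f x))\<^sup>2))"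

text \<open>\<open>u \<in> C\<^sup>0([0,\<infinity>), L\<^sup>2(0,L))\<close>, with time as the first argument of \<open>u\<close>.\<close>

definition C0_L2 :: "real \<Rightarrow> (real \<Rightarrow> real \<Rightarrow> complex) \<Rightarrow> bool" where
  "C0_L2 L u \<longleftrightarrow>
     (\<forall>t\<ge>0. L2_on 0 L (u t)) \<and>
     (\<forall>t\<ge>0. ((\<lambda>r. L2_norm_on 0 L (\<lambda>s. u r s - u t s)) \<longlongrightarrow> 0) (at t within {0..}))"

text \<open>
  The boundary operator \<open>B\<close> at \<open>s = 0\<close>: \<open>B = 1\<close> (Dirichlet) or \<open>B = \<partial>\<^sub>s\<close> (Neumann), as a function
  of the boundary value \<open>v\<close> and the boundary derivative \<open>dv\<close>.
\<close>

datatype boundary_op = Dirichlet | Neumann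

fun apply_boundary_op :: "boundary_op \<Rightarrow> real \<Rightarrow> real \<Rightarrow> real" where
  "apply_boundary_op Dirichlet v dv = v"
| "apply_boundary_op Neumann v dv = dv"

text \<open>
  Test functions for the transposition formula: \<open>C\<^sup>1\<close> in time and \<open>C\<^sup>2\<close> in space up to the boundary
  of \<open>[0,T] \<times> [0,L]\<close>, with \<open>(B\<phi>)|\<^sub>s\<^sub>=\<^sub>0 = 0\<close> and \<open>\<phi>|\<^sub>s\<^sub>=\<^sub>L = 0\<close>. The arguments \<open>\<phi>t\<close>, \<open>\<phi>s\<close>, \<open>\<phi>ss\<close> are
  \<open>\<partial>\<^sub>t\<phi>\<close>, \<open>\<partial>\<^sub>s\<phi>\<close>, \<open>\<partial>\<^sub>s\<^sup>2\<phi>\<close>.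
\<close>

definition test_function ::
  "boundary_op \<Rightarrow> real \<Rightarrow> real \<Rightarrow> (real \<Rightarrow> real \<Rightarrow> real) \<Rightarrow> (real \<Rightarrow> real \<Rightarrow> real) \<Rightarrow>
   (real \<Rightarrow> real \<Rightarrow> real) \<Rightarrow> (real \<Rightarrow> real \<Rightarrow> real) \<Rightarrow> bool" where
  "test_function B L T \<phi> \<phi>t \<phi>s \<phi>ss \<longleftrightarrow>
     (\<forall>\<psi>\<in>{\<phi>, \<phi>t, \<phi>s, \<phi>ss}. continuous_on ({0..T} \<times> {0..L}) (\<lambda>(t, s). \<psi> t s)) \<and>
     (\<forall>t\<in>{0..T}. \<forall>s\<in>{0..L}.
        ((\<lambda>r. \<phi> r s) has_real_derivative \<phi>t t s) (at t within {0..T}) \<and>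
        ((\<lambda>x. \<phi> t x) has_real_derivative \<phi>s t s) (at s within {0..L}) \<and>
        ((\<lambda>x. \<phi>s t x) has_real_derivative \<phi>ss t s) (at s within {0..L})) \<and>
     (\<forall>t\<in>{0..T}. apply_boundary_op B (\<phi> t 0) (\<phi>s t 0) = 0 \<and> \<phi> t L = 0)"

text \<open>
  \<open>u \<in> C\<^sup>0([0,\<infinity>), L\<^sup>2(0,L))\<close> solves
  \<open>\<partial>\<^sub>t u - \<partial>\<^sub>s\<^sup>2 u = 0\<close> in \<open>]0,T[ \<times> ]0,L[\<close>, \<open>(Bu)|\<^sub>s\<^sub>=\<^sub>0 = 0\<close>, \<open>u|\<^sub>s\<^sub>=\<^sub>L = g\<close>, \<open>u|\<^sub>t\<^sub>=\<^sub>0 = u0\<close>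
  in the sense of transposition. For merely square-integrable \<open>g\<close> the function \<open>u\<close> need not have
  traces at \<open>s = 0\<close> and \<open>s = L\<close>; the equation and both boundary conditions are encoded in the
  formula that results from multiplying the equation by a test function \<open>\<phi>\<close> and integrating by
  parts over \<open>[0,t] \<times> [0,L]\<close>: since \<open>\<phi>|\<^sub>s\<^sub>=\<^sub>L = 0\<close>, the boundary term at \<open>s = L\<close> is
  \<open>- g(t) \<partial>\<^sub>s\<phi>(t,L)\<close>, while the one at \<open>s = 0\<close> vanishes because \<open>Bu = B\<phi> = 0\<close> there. All
  integrals below exist, since \<open>u\<close> is continuous with values in \<open>L\<^sup>2(0,L)\<close> and \<open>\<phi>\<close> and its
  derivatives are continuous on the closed rectangle. Nothing but continuity is required of \<open>u\<close>
  after time \<open>T\<close>.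
\<close>

definition heat_solution ::
  "boundary_op \<Rightarrow> real \<Rightarrow> real \<Rightarrow> (real \<Rightarrow> complex) \<Rightarrow> (real \<Rightarrow> complex) \<Rightarrow>
   (real \<Rightarrow> real \<Rightarrow> complex) \<Rightarrow> bool" where
  "heat_solution B L T g u0 u \<longleftrightarrow>
     C0_L2 L u \<and>
     (AE s in lebesgue_on {0<..<L}. u 0 s = u0 s) \<and>
     (\<forall>\<phi> \<phi>t \<phi>s \<phi>ss. test_function B L T \<phi> \<phi>t \<phi>s \<phi>ss \<longrightarrow>
        (\<forall>t\<in>{0..T}.
           (LINT s|lebesgue_on {0<..<L}. of_real (\<phi> t s) * u t s)
           - (LINT s|lebesgue_on {0<..<L}. of_real (\<phi> 0 s) * u0 s)
           = (LINT r|lebesgue_on {0<..<t}.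
                LINT s|lebesgue_on {0<..<L}. of_real (\<phi>t r s + \<phi>ss r s) * u r s)
             - (LINT r|lebesgue_on {0<..<t}. of_real (\<phi>s r L) * g r)))"

end

theory Submission
  imports Defs "HOL-Complex_Analysis.Cauchy_Integral_Formula"
begin

text \<open>
  The control is found by flatness. A function \<open>f\<close> holomorphic near a time interval yields the
  solution \<open>\<Sum>i. f\<^sup>(\<^sup>i\<^sup>)(t) s\<^sup>2\<^sup>i / (2i)!\<close> of the heat equation with the Neumann condition at \<open>s = 0\<close>
  (\<open>s\<^sup>2\<^sup>i\<^sup>+\<^sup>1 / (2i+1)!\<close> for Dirichlet), and \<open>f(t) = exp(-\<mu>\<^sup>2t)\<close> yields the eigenmode of frequency \<open>\<mu>\<close>.
  Each eigenmode is left free on \<open>[0, T/10]\<close> and then switched off by multiplying \<open>f\<close> with a cutoff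
  \<open>1 - \<Psi>\<close>, where \<open>\<Psi>\<close> is the normalised primitive of \<open>exp(-\<nu>/(t-a) - \<nu>/(b-t))\<close> on \<open>[a,b] = [T/10, T]\<close>; the
  control is the trace at \<open>s = L\<close>. Cauchy's estimates on the largest disc around \<open>t\<close> inside the disc
  with diameter \<open>[a,b]\<close> show that the series converges as soon as \<open>\<nu> > L\<^sup>2/2\<close>, with a bound of order
  \<open>exp(-\<nu>/(b-a))\<close>, while the normalisation costs about \<open>exp(4\<nu>/(b-a))\<close>. The total cost
  \<open>exp(3\<nu>/(b-a))\<close> is about \<open>exp(3L\<^sup>2/(2(b-a)))\<close>; the choices \<open>\<nu> = 11L\<^sup>2/20\<close> and \<open>b - a = 9T/10\<close> give the
  exponent \<open>301/162\<close>, which is less than \<open>2(36/37)\<^sup>2\<close>. The factor \<open>exp(-\<mu>\<^sup>2T/10)\<close> gained during the free evolution makes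
  the sum over all eigenmodes converge at a cost polynomial in \<open>L\<^sup>2/T\<close>.
\<close>

section \<open>Solutions of the heat equation with analytic flat output\<close>

text \<open>A nonzero analytic function of time cannot vanish on an interval, so switching a mode
  off destroys analyticity at the switching instants; the cutoff is holomorphic in a disc only and
  degenerates at two of its boundary points. With r the distance from t to the nearer instant, the
  series costs exp(L^2/(4r)) and the cutoff gains exp(-\<nu>/(2r)). This competition is the origin
  of the threshold on \<nu>; a factor r left over from the primitive yields continuity at the
  instants. A second obstacle is that the initial state is merely square-integrable: the bounds on
  the modes are not summable uniformly as t tends to 0. Orthogonality controls the error during the
  free phase, the sup norm controls it afterwards, and convergence at t = 0 requires completeness of
  the eigenfunctions. Finally, the theorem speaks of every solution with the constructed control. It
  is enough that control and initial state determine the state at time T, which follows from testing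
  with solutions of the backward equation and, again, from completeness.\<close>

definition heat_term :: "nat \<Rightarrow> (complex \<Rightarrow> complex) \<Rightarrow> nat \<Rightarrow> complex \<Rightarrow> complex \<Rightarrow> complex" where
  "heat_term p f i z s = (deriv ^^ i) f z * s ^ (2 * i + p) / fact (2 * i + p)"

definition heat_series :: "nat \<Rightarrow> (complex \<Rightarrow> complex) \<Rightarrow> complex \<Rightarrow> complex \<Rightarrow> complex" where
  "heat_series p f z s = (\<Sum>i. heat_term p f i z s)"

text \<open>The open ball matters: the largest disc around a time t touches a switching instant,
  where the cutoff is not holomorphic. Cauchy's inequality is applied with radii
  \<open>q < r\<close>, and letting \<open>q\<close> tend to \<open>r\<close> loses nothing in the
  exponent.\<close>

lemma higher_deriv_bound_ball:
  assumes hol: "f holomorphic_on ball z r" and r: "0 < r"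
    and bd: "\<And>w. w \<in> ball z r \<Longrightarrow> cmod (f w) \<le> M"
  shows "cmod ((deriv ^^ i) f z) \<le> fact i * M / r ^ i"
proof (rule tendsto_lowerbound)
  show "((\<lambda>q. fact i * M / q ^ i) \<longlongrightarrow> fact i * M / r ^ i) (at_left r)"
    using r by (intro tendsto_intros) auto
  have "eventually (\<lambda>q. q \<in> {0<..<r}) (at_left r)"
    using r by (rule eventually_at_left_real)
  then show "\<forall>\<^sub>F q in at_left r. cmod ((deriv ^^ i) f z) \<le> fact i * M / q ^ i"
  proof eventually_elim
    case (elim q)
    then have sub: "cball z q \<subseteq> ball z r" by auto
    show ?case
    proof (rule Cauchy_inequality)
      show "f holomorphic_on ball z q"
        using hol sub ball_subset_cball holomorphic_on_subset by blast
      show "continuous_on (cball z q) f"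
        using hol sub holomorphic_on_imp_continuous_on holomorphic_on_subset by blast
      show "0 < q" using elim by simp
      fix x assume "cmod (z - x) = q"
      then show "cmod (f x) \<le> M" using elim by (intro bd) (simp add: dist_norm)
    qed
  qed
qed auto

text \<open>The factor \<open>4\<^sup>i\<close> matters: the cruder bound \<open>1 / i!\<close> would multiply the final exponent by four.\<close>
lemma fact_quotient_bound: "fact i / fact (2 * i) \<le> real (2 * i + 1) / (4 ^ i * fact i)"
proof -
  have "real ((2 * i) choose i) * (2 * real i + 1) \<ge> 4 ^ i"
  proof (cases "i = 0")
    case False
    then have "4 ^ i \<le> real ((2 * i) choose i) * (2 * real i)"
      using central_binomial_lower_bound[of i] by (simp add: field_simps)
    also have "\<dots> \<le> real ((2 * i) choose i) * (2 * real i + 1)"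
      by (intro mult_left_mono) auto
    finally show ?thesis .
  qed simp
  moreover have "real ((2 * i) choose i) = fact (2 * i) / (fact i * fact i)"
    using binomial_fact[of i "2 * i", where 'a = real] by simp
  ultimately have "4 ^ i \<le> fact (2 * i) / (fact i * fact i) * (2 * real i + 1)"
    by simp
  then show ?thesis by (simp add: field_simps)
qed

text \<open>The sum of the majorant coming from \<open>fact_quotient_bound\<close>: the weight
  \<open>2 * i + 1\<close> costs only the polynomial factor \<open>1 + 2 * y\<close>.\<close>

lemma sums_odd_exp:
  fixes y :: real
  shows "(\<lambda>i. real (2 * i + 1) * y ^ i / fact i) sums ((1 + 2 * y) * exp y)"
proof -
  have e: "(\<lambda>i. y ^ i / fact i) sums exp y"
    using exp_converges[of y] by (simp add: scaleR_conv_of_real field_simps)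
  have "(\<lambda>i. real (Suc i) * y ^ Suc i / fact (Suc i)) = (\<lambda>i. y * (y ^ i / fact i))"
  proof
    fix i
    have "real (Suc i) \<noteq> 0" by simp
    then show "real (Suc i) * y ^ Suc i / fact (Suc i) = y * (y ^ i / fact i)"
      unfolding fact_Suc power_Suc of_nat_mult by (metis mult_divide_mult_cancel_left times_divide_eq_right)
  qed
  then have "(\<lambda>i. real (Suc i) * y ^ Suc i / fact (Suc i)) sums (y * exp y)"
    using sums_mult[OF e, of y] by simp
  from sums_Suc[OF this] have "(\<lambda>i. real i * y ^ i / fact i) sums (y * exp y)" by simp
  from sums_add[OF sums_mult[OF this, of 2] e] show ?thesis
    by (simp add: algebra_simps add_divide_distrib)
qed

lemma heat_term_bound:
  assumes hol: "f holomorphic_on ball z r" and r: "0 < r"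
    and bd: "\<And>w. w \<in> ball z r \<Longrightarrow> cmod (f w) \<le> M" and s: "cmod s \<le> L"
  shows "cmod (heat_term p f i z s) \<le>
    M * L ^ p * (real (2 * i + 1) * (L\<^sup>2 / (4 * r)) ^ i / fact i)"
proof -
  have L: "0 \<le> L" using order_trans[OF norm_ge_zero s] .
  have M: "0 \<le> M" using order_trans[OF norm_ge_zero bd[of z]] r by simp
  have "cmod (heat_term p f i z s) = cmod ((deriv ^^ i) f z) * cmod s ^ (2 * i + p) / fact (2 * i + p)"
    by (simp add: heat_term_def norm_mult norm_divide norm_power)
  \<comment> \<open>Weakening the denominator to \<open>fact (2 * i)\<close> gives one majorant for
    all \<open>p\<close>, up to the factor \<open>L ^ p\<close>.\<close>
  also have "\<dots> \<le> (fact i * M / r ^ i) * L ^ (2 * i + p) / fact (2 * i)"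
  proof (rule frac_le)
    show "cmod ((deriv ^^ i) f z) * cmod s ^ (2 * i + p) \<le> fact i * M / r ^ i * L ^ (2 * i + p)"
      using M r by (intro mult_mono higher_deriv_bound_ball[OF hol r bd] power_mono s) auto
  qed (use M L r in \<open>auto intro!: fact_mono mult_nonneg_nonneg\<close>)
  also have "\<dots> = M * L ^ p * (L\<^sup>2 / r) ^ i * (fact i / fact (2 * i))"
    by (simp add: power_add power_mult power_divide)
  also have "\<dots> \<le> M * L ^ p * (L\<^sup>2 / r) ^ i * (real (2 * i + 1) / (4 ^ i * fact i))"
    using M L r by (intro mult_left_mono fact_quotient_bound) auto
  also have "\<dots> = M * L ^ p * (real (2 * i + 1) * (L\<^sup>2 / (4 * r)) ^ i / fact i)"
    by (simp add: power_divide power_mult_distrib field_simps)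
  finally show ?thesis .
qed

lemma
  assumes hol: "f holomorphic_on ball z r" and r: "0 < r"
    and bd: "\<And>w. w \<in> ball z r \<Longrightarrow> cmod (f w) \<le> M" and s: "cmod s \<le> L"
  shows summable_heat_term: "summable (\<lambda>i. heat_term p f i z s)"
    and heat_series_bound: "cmod (heat_series p f z s) \<le>
      M * L ^ p * ((1 + L\<^sup>2 / (2 * r)) * exp (L\<^sup>2 / (4 * r)))"
proof -
  note sms = sums_mult[OF sums_odd_exp[of "L\<^sup>2 / (4 * r)"], of "M * L ^ p"]
  show "summable (\<lambda>i. heat_term p f i z s)"
    by (rule summable_comparison_test'[where N = 0, OF sums_summable[OF sms]])
       (rule heat_term_bound[OF hol r bd s])
  have "cmod (heat_series p f z s) \<le> M * L ^ p * ((1 + 2 * (L\<^sup>2 / (4 * r))) * exp (L\<^sup>2 / (4 * r)))"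
    unfolding heat_series_def sums_unique[OF sms]
    by (rule norm_suminf_le[OF _ sums_summable[OF sms]]) (rule heat_term_bound[OF hol r bd s])
  then show "cmod (heat_series p f z s) \<le> M * L ^ p * ((1 + L\<^sup>2 / (2 * r)) * exp (L\<^sup>2 / (4 * r)))"
    by simp
qed

text \<open>One radius and one bound serve all centres near \<open>z0\<close>, which makes the
  majorant in \<open>heat_term_bound\<close> independent of the point. Halving \<open>d\<close>
  leaves room for a ball around each centre.\<close>

lemma holomorphic_locally_bounded:
  assumes "f holomorphic_on S" "open S" "z0 \<in> S"
  obtains e M where "0 < e" "\<And>z. z \<in> ball z0 e \<Longrightarrow> ball z e \<subseteq> S"
    "\<And>z w. z \<in> ball z0 e \<Longrightarrow> w \<in> ball z e \<Longrightarrow> cmod (f w) \<le> M"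
proof -
  obtain d where d: "d > 0" "cball z0 d \<subseteq> S"
    using assms open_contains_cball by metis
  have "compact (f ` cball z0 d)"
    using assms(1) d by (intro compact_continuous_image holomorphic_on_imp_continuous_on
        holomorphic_on_subset[OF assms(1)]) auto
  then obtain M where M: "\<And>w. w \<in> cball z0 d \<Longrightarrow> cmod (f w) \<le> M"
    using bounded_iff[of "f ` cball z0 d"] compact_imp_bounded by blast
  have in_d: "w \<in> cball z0 d" if "z \<in> ball z0 (d/2)" "w \<in> ball z (d/2)" for z w
    using that dist_triangle[of z0 w z] by (simp add: dist_commute)
  show ?thesis
    using d M in_d by (intro that[of "d/2" M]) (fastforce | simp)+
qed

lemma summable_heat_term_open:
  assumes "f holomorphic_on S" "open S" "z \<in> S"
  shows "summable (\<lambda>i. heat_term p f i z s)"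
proof -
  obtain e M where e: "0 < e" "\<And>w. w \<in> ball z e \<Longrightarrow> ball w e \<subseteq> S"
    "\<And>v w. v \<in> ball z e \<Longrightarrow> w \<in> ball v e \<Longrightarrow> cmod (f w) \<le> M"
    using holomorphic_locally_bounded[OF assms] by blast
  show ?thesis
  proof (rule summable_heat_term)
    show "f holomorphic_on ball z e" using e assms by (meson centre_in_ball holomorphic_on_subset)
    show "\<And>w. w \<in> ball z e \<Longrightarrow> cmod (f w) \<le> M" using e(1) e(3)[of z] by auto
  qed (use e in auto)
qed

text \<open>The M-test works jointly, locally in time and on any bounded set in space; continuity
  and both termwise differentiations rest on it.\<close>

lemma heat_series_locally_uniform:
  assumes hol: "f holomorphic_on S" and S: "open S" and z0: "z0 \<in> S"
  obtains e where "0 < e" "ball z0 e \<subseteq> S"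
    "uniform_limit (ball z0 e \<times> ball 0 R) (\<lambda>n (z, s). \<Sum>i<n. heat_term p f i z s)
       (\<lambda>(z, s). heat_series p f z s) sequentially"
proof -
  obtain e M where e: "0 < e" "\<And>z. z \<in> ball z0 e \<Longrightarrow> ball z e \<subseteq> S"
    "\<And>z w. z \<in> ball z0 e \<Longrightarrow> w \<in> ball z e \<Longrightarrow> cmod (f w) \<le> M"
    using holomorphic_locally_bounded[OF assms] by blast
  have "uniform_limit (ball z0 e \<times> ball 0 R) (\<lambda>n x. \<Sum>i<n. heat_term p f i (fst x) (snd x))
       (\<lambda>x. \<Sum>i. heat_term p f i (fst x) (snd x)) sequentially"
  proof (rule Weierstrass_m_test)
    show "summable (\<lambda>i. M * R ^ p * (real (2 * i + 1) * (R\<^sup>2 / (4 * e)) ^ i / fact i))"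
      using sums_mult[OF sums_odd_exp] sums_summable by blast
    fix i and x :: "complex \<times> complex" assume x: "x \<in> ball z0 e \<times> ball 0 R"
    show "norm (heat_term p f i (fst x) (snd x)) \<le> M * R ^ p * (real (2 * i + 1) * (R\<^sup>2 / (4 * e)) ^ i / fact i)"
      using x e hol holomorphic_on_subset
      by (intro heat_term_bound) (auto simp: dist_norm)
  qed
  then have "uniform_limit (ball z0 e \<times> ball 0 R) (\<lambda>n (z, s). \<Sum>i<n. heat_term p f i z s)
       (\<lambda>(z, s). heat_series p f z s) sequentially"
    by (simp add: heat_series_def case_prod_beta')
  moreover have "ball z0 e \<subseteq> S" using e by auto
  ultimately show ?thesis using e(1) that by blast
qed

lemma continuous_on_heat_term:
  assumes hol: "f holomorphic_on S" and S: "open S"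
  shows "continuous_on (S \<times> UNIV) (\<lambda>(z, s). heat_term p f i z s)"
proof -
  have "continuous_on S ((deriv ^^ i) f)"
    by (intro holomorphic_on_imp_continuous_on holomorphic_higher_deriv assms)
  then have "continuous_on (S \<times> UNIV) (\<lambda>x. (deriv ^^ i) f (fst x))"
    by (rule continuous_on_compose2) (auto intro: continuous_intros)
  then show ?thesis
    unfolding heat_term_def case_prod_beta' by (intro continuous_intros) auto
qed

lemma continuous_on_heat_series:
  assumes hol: "f holomorphic_on S" and S: "open S"
  shows "continuous_on (S \<times> UNIV) (\<lambda>(z, s). heat_series p f z s)"
proof (rule continuous_at_imp_continuous_on, rule ballI)
  fix x :: "complex \<times> complex" assume "x \<in> S \<times> UNIV"
  then have z0: "fst x \<in> S" by auto
  define R where "R = cmod (snd x) + 1"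
  obtain e where e: "0 < e" "ball (fst x) e \<subseteq> S"
    "uniform_limit (ball (fst x) e \<times> ball 0 R) (\<lambda>n (z, s). \<Sum>i<n. heat_term p f i z s)
       (\<lambda>(z, s). heat_series p f z s) sequentially"
    using heat_series_locally_uniform[OF hol S z0, where R = R and p = p] by blast
  have "continuous_on (ball (fst x) e \<times> ball 0 R) (\<lambda>(z, s). heat_series p f z s)"
  proof (rule uniform_limit_theorem[OF _ e(3)])
    have "continuous_on (ball (fst x) e \<times> ball 0 R) (\<lambda>(z, s). heat_term p f i z s)" for i
      by (rule continuous_on_subset[OF continuous_on_heat_term[OF hol S]]) (use e in auto)
    then show "\<forall>\<^sub>F n in sequentially. continuous_on (ball (fst x) e \<times> ball 0 R)
        (\<lambda>(z, s). \<Sum>i<n. heat_term p f i z s)"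
      unfolding case_prod_beta' by (intro always_eventually allI continuous_intros)
  qed auto
  moreover have "x \<in> ball (fst x) e \<times> ball 0 R" using e by (cases x) (auto simp: R_def)
  moreover have "open (ball (fst x) e \<times> (ball 0 R :: complex set))" by (intro open_Times) auto
  ultimately show "isCont (\<lambda>(z, s). heat_series p f z s) x"
    using continuous_on_eq_continuous_at by blast
qed

section \<open>Termwise differentiation of the series in time and space\<close>

lemma heat_series_deriv_time:
  assumes hol: "f holomorphic_on S" and S: "open S" and z0: "z0 \<in> S"
  shows "((\<lambda>z. heat_series p f z s) has_field_derivative heat_series p (deriv f) z0 s) (at z0)"
proof -
  have hol': "deriv f holomorphic_on S" using hol S by (rule holomorphic_deriv)
  obtain e where e: "0 < e" "ball z0 e \<subseteq> S"
    "uniform_limit (ball z0 e \<times> ball 0 (cmod s + 1)) (\<lambda>n (z, s). \<Sum>i<n. heat_term p (deriv f) i z s)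
       (\<lambda>(z, s). heat_series p (deriv f) z s) sequentially"
    using heat_series_locally_uniform[OF hol' S z0, where R = "cmod s + 1" and p = p] by blast
  have "uniform_limit (ball z0 e) (\<lambda>n z. \<Sum>i<n. heat_term p (deriv f) i z s)
       (\<lambda>z. heat_series p (deriv f) z s) sequentially"
    using uniform_limit_compose'[OF e(3), of "\<lambda>z. (z, s)" "ball z0 e"] by auto
  then have uc: "uniformly_convergent_on (ball z0 e) (\<lambda>n z. \<Sum>i<n. heat_term p (deriv f) i z s)"
    by (auto simp: uniformly_convergent_on_def)
  have der: "((\<lambda>z. heat_term p f i z s) has_field_derivative heat_term p (deriv f) i z s)
      (at z within ball z0 e)" if "z \<in> ball z0 e" for i z
  proof -
    have "((deriv ^^ i) f has_field_derivative deriv ((deriv ^^ i) f) z) (at z within ball z0 e)"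
      using that e hol S by (meson has_field_derivative_at_within holomorphic_derivI
          holomorphic_higher_deriv subsetD)
    moreover have "deriv ((deriv ^^ i) f) = (deriv ^^ i) (deriv f)"
      by (metis funpow_swap1)
    ultimately show ?thesis
      unfolding heat_term_def by (auto intro!: derivative_eq_intros)
  qed
  show ?thesis
    unfolding heat_series_def
    by (rule has_field_derivative_series'(2)[OF _ der uc]) (use e summable_heat_term_open[OF hol S z0] in auto)
qed

lemma heat_series_deriv_space:
  assumes hol: "f holomorphic_on S" and S: "open S" and z0: "z0 \<in> S"
  shows "((\<lambda>s. heat_series (Suc p) f z0 s) has_field_derivative heat_series p f z0 s) (at s)"
proof -
  obtain e where e: "0 < e" "ball z0 e \<subseteq> S"
    "uniform_limit (ball z0 e \<times> ball 0 (cmod s + 1)) (\<lambda>n (z, s). \<Sum>i<n. heat_term p f i z s)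
       (\<lambda>(z, s). heat_series p f z s) sequentially"
    using heat_series_locally_uniform[OF hol S z0, where R = "cmod s + 1" and p = p] by blast
  have "uniform_limit (ball 0 (cmod s + 1)) (\<lambda>n s. \<Sum>i<n. heat_term p f i z0 s)
       (\<lambda>s. heat_series p f z0 s) sequentially"
    using uniform_limit_compose'[OF e(3), of "\<lambda>s. (z0, s)" "ball 0 (cmod s + 1)"] e(1) by auto
  then have uc: "uniformly_convergent_on (ball 0 (cmod s + 1)) (\<lambda>n s. \<Sum>i<n. heat_term p f i z0 s)"
    by (auto simp: uniformly_convergent_on_def)
  have der: "((\<lambda>s. heat_term (Suc p) f i z0 s) has_field_derivative heat_term p f i z0 x)
      (at x within ball 0 (cmod s + 1))" for i x
  proof -
    define c where "c = (deriv ^^ i) f z0 / fact (2 * i + Suc p)"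
    have "((\<lambda>s. c * s ^ Suc (2 * i + p)) has_field_derivative
        c * (of_nat (Suc (2 * i + p)) * x ^ (2 * i + p))) (at x within ball 0 (cmod s + 1))"
      by (rule derivative_eq_intros refl | simp)+
    moreover have "c * (of_nat (Suc (2 * i + p)) * x ^ (2 * i + p)) = heat_term p f i z0 x"
      by (simp add: c_def heat_term_def del: of_nat_Suc)
    moreover have "heat_term (Suc p) f i z0 = (\<lambda>s. c * s ^ Suc (2 * i + p))"
      by (simp add: c_def heat_term_def fun_eq_iff)
    ultimately show ?thesis by simp
  qed
  show ?thesis
    unfolding heat_series_def
    by (rule has_field_derivative_series'(2)[OF _ der uc, of s])
       (use summable_heat_term_open[OF hol S z0] in auto)
qed

text \<open>The term \<open>i = 0\<close> is constant in \<open>s\<close>; without it all exponents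
  are positive and \<open>heat_series_deriv_space\<close> applies. The index shift turns
  \<open>f\<close> into \<open>deriv f\<close>, which is why two space derivatives amount to one
  time derivative.\<close>

lemma heat_series_0_eq:
  assumes hol: "f holomorphic_on S" and S: "open S" and z0: "z0 \<in> S"
  shows "heat_series 0 f z0 s = f z0 + heat_series 2 (deriv f) z0 s"
proof -
  have eq: "heat_term 0 f (Suc i) z0 s = heat_term 2 (deriv f) i z0 s" for i
    by (simp add: heat_term_def funpow_swap1 del: funpow.simps(2) add: funpow_Suc_right)
  have "heat_series 0 f z0 s = (\<Sum>i. heat_term 0 f (Suc i) z0 s) + heat_term 0 f 0 z0 s"
    unfolding heat_series_def
    using suminf_split_head[OF summable_heat_term_open[OF hol S z0, of 0 s]] by simp
  also have "heat_term 0 f 0 z0 s = f z0" by (simp add: heat_term_def)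
  finally show ?thesis by (simp add: eq heat_series_def)
qed

lemma heat_series_0_deriv_space:
  assumes hol: "f holomorphic_on S" and S: "open S" and z0: "z0 \<in> S"
  shows "((\<lambda>s. heat_series 0 f z0 s) has_field_derivative heat_series 1 (deriv f) z0 s) (at s)"
proof -
  have "((\<lambda>s. f z0 + heat_series 2 (deriv f) z0 s) has_field_derivative heat_series 1 (deriv f) z0 s) (at s)"
    using heat_series_deriv_space[OF holomorphic_deriv[OF hol S] S z0, of 1 s]
    by (auto intro!: derivative_eq_intros simp: numeral_2_eq_2)
  then show ?thesis by (simp add: heat_series_0_eq[OF assms])
qed

lemma heat_series_add:
  assumes "f holomorphic_on S" "g holomorphic_on S" "open S" "z \<in> S"
  shows "heat_series p (\<lambda>z. f z + g z) z s = heat_series p f z s + heat_series p g z s"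
proof -
  have "heat_term p (\<lambda>z. f z + g z) i z s = heat_term p f i z s + heat_term p g i z s" for i
    using assms by (simp add: heat_term_def higher_deriv_add algebra_simps add_divide_distrib)
  then show ?thesis
    unfolding heat_series_def using assms by (simp add: suminf_add summable_heat_term_open)
qed

lemma heat_series_at_0 [simp]: "heat_series (Suc p) f z 0 = 0"
  by (simp add: heat_series_def heat_term_def)

lemma higher_deriv_exp_mult:
  "(deriv ^^ i) (\<lambda>z. exp (a * z)) z = a ^ i * exp (a * z :: complex)"
proof (induction i arbitrary: z)
  case (Suc i)
  then have "(deriv ^^ Suc i) (\<lambda>z. exp (a * z)) z = deriv (\<lambda>z. a ^ i * exp (a * z)) z"
    by (simp add: ext[OF Suc])
  also have "\<dots> = a ^ Suc i * exp (a * z)"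
    by (rule DERIV_imp_deriv) (auto intro!: derivative_eq_intros)
  finally show ?case .
qed auto

text \<open>The i-th derivative contributes the factor (-\<mu>^2)^i, so these are the cosine and
  sine series. Multiplying by \<open>\<mu>\<close> on the left, instead of dividing on the right,
  covers \<open>\<mu> = 0\<close> and explains the weight \<open>c\<close> of the Dirichlet case in
  \<open>controlled_mode\<close>.\<close>

lemma heat_series_exp:
  fixes \<mu> :: complex
  shows "heat_series 0 (\<lambda>z. exp (- \<mu>\<^sup>2 * z)) z s = exp (- \<mu>\<^sup>2 * z) * cos (\<mu> * s)"
    and "\<mu> * heat_series 1 (\<lambda>z. exp (- \<mu>\<^sup>2 * z)) z s = exp (- \<mu>\<^sup>2 * z) * sin (\<mu> * s)"
proof -
  have pow: "(\<mu> * s) ^ (2 * n) = (\<mu>\<^sup>2) ^ n * s ^ (2 * n)" for n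
    by (simp add: power_mult_distrib power_mult)
  have c: "(\<lambda>n. cos_coeff n *\<^sub>R (\<mu> * s) ^ n) sums cos (\<mu> * s)" by (rule cos_converges)
  \<comment> \<open>Reindexing by even numbers is legitimate because the odd coefficients vanish;
    the sine series is treated likewise.\<close>
  have "(\<lambda>n. cos_coeff (2 * n) *\<^sub>R (\<mu> * s) ^ (2 * n)) sums cos (\<mu> * s)"
    by (rule iffD2[OF sums_mono_reindex[of "\<lambda>n. 2 * n"] c])
       (auto simp: strict_mono_def cos_coeff_def elim!: evenE)
  then have "(\<lambda>n. exp (- \<mu>\<^sup>2 * z) * (cos_coeff (2 * n) *\<^sub>R (\<mu> * s) ^ (2 * n))) sums (exp (- \<mu>\<^sup>2 * z) * cos (\<mu> * s))"
    by (rule sums_mult)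
  moreover have "heat_term 0 (\<lambda>z. exp (- \<mu>\<^sup>2 * z)) n z s
      = exp (- \<mu>\<^sup>2 * z) * (cos_coeff (2 * n) *\<^sub>R (\<mu> * s) ^ (2 * n))" for n
    unfolding heat_term_def higher_deriv_exp_mult
    by (simp add: cos_coeff_def scaleR_conv_of_real pow power_minus')
  ultimately show "heat_series 0 (\<lambda>z. exp (- \<mu>\<^sup>2 * z)) z s = exp (- \<mu>\<^sup>2 * z) * cos (\<mu> * s)"
    unfolding heat_series_def by (simp add: sums_iff)
  have c: "(\<lambda>n. sin_coeff n *\<^sub>R (\<mu> * s) ^ n) sums sin (\<mu> * s)" by (rule sin_converges)
  have "(\<lambda>n. sin_coeff (2 * n + 1) *\<^sub>R (\<mu> * s) ^ (2 * n + 1)) sums sin (\<mu> * s)"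
    by (rule iffD2[OF sums_mono_reindex[of "\<lambda>n. 2 * n + 1"] c])
       (auto simp: strict_mono_def sin_coeff_def elim!: oddE)
  then have "(\<lambda>n. exp (- \<mu>\<^sup>2 * z) * (sin_coeff (2 * n + 1) *\<^sub>R (\<mu> * s) ^ (2 * n + 1))) sums (exp (- \<mu>\<^sup>2 * z) * sin (\<mu> * s))"
    by (rule sums_mult)
  moreover have "\<mu> * heat_term 1 (\<lambda>z. exp (- \<mu>\<^sup>2 * z)) n z s
      = exp (- \<mu>\<^sup>2 * z) * (sin_coeff (2 * n + 1) *\<^sub>R (\<mu> * s) ^ (2 * n + 1))" for n
    unfolding heat_term_def higher_deriv_exp_mult
    by (simp add: sin_coeff_def scaleR_conv_of_real pow power_minus')
  ultimately have "(\<lambda>n. \<mu> * heat_term 1 (\<lambda>z. exp (- \<mu>\<^sup>2 * z)) n z s) sums (exp (- \<mu>\<^sup>2 * z) * sin (\<mu> * s))"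
    by simp
  moreover have "summable (\<lambda>n. heat_term 1 (\<lambda>z. exp (- \<mu>\<^sup>2 * z)) n z s)"
    by (rule summable_heat_term_open[of _ UNIV]) (auto intro!: holomorphic_intros)
  ultimately show "\<mu> * heat_series 1 (\<lambda>z. exp (- \<mu>\<^sup>2 * z)) z s = exp (- \<mu>\<^sup>2 * z) * sin (\<mu> * s)"
    unfolding heat_series_def by (simp add: sums_iff suminf_mult)
qed

section \<open>A cutoff function of Gevrey order two\<close>

text \<open>Inversion maps the disc with diameter from 0 to 2q onto the half-plane where the real
  part exceeds 1/(2q).\<close>

lemma Re_inverse_ge_ball:
  assumes "w \<in> ball (of_real q) q"
  shows "1 / (2 * q) \<le> Re (1 / w)"
proof -
  have q: "0 < q" using assms by (metis ball_eq_empty empty_iff not_less)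
  have "(q - Re w)\<^sup>2 + (Im w)\<^sup>2 < q\<^sup>2"
  proof -
    have "cmod (of_real q - w) < q" using assms by (simp add: dist_norm)
    then have "(cmod (of_real q - w))\<^sup>2 < q\<^sup>2" by (simp add: power_strict_mono)
    then show ?thesis by (simp add: cmod_power2)
  qed
  then have lt: "(Re w)\<^sup>2 + (Im w)\<^sup>2 < 2 * q * Re w"
    by (simp add: power2_eq_square algebra_simps)
  moreover have pos: "0 < (Re w)\<^sup>2 + (Im w)\<^sup>2"
    using lt by (smt (verit) mult_eq_0_iff sum_power2_gt_zero_iff zero_le_power2 power_zero_numeral)
  ultimately have "1 / (2 * q) \<le> Re w / ((Re w)\<^sup>2 + (Im w)\<^sup>2)"
    using q by (simp add: field_simps)
  then show ?thesis by (simp add: Re_divide)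
qed

text \<open>The point \<open>e\<close> is going to be a switching instant on the boundary of
  \<open>D\<close>, where only the extension \<open>G\<close> of \<open>F\<close> exists. The mean
  value estimate inside the small ball is carried to \<open>e\<close> by continuity. Taking
  \<open>m\<close> on that ball rather than on \<open>D\<close> is what makes the result
  exponentially small near the instant.\<close>

lemma primitive_extension_bound:
  assumes prim: "\<And>z. z \<in> D \<Longrightarrow> (F has_field_derivative \<psi> z) (at z within D)"
    and ext: "\<And>z. z \<in> D \<Longrightarrow> F z = G z" and G: "continuous_on (closure D) G"
    and sub: "ball t r \<subseteq> D" and r: "0 < r"
    and bd: "\<And>z. z \<in> ball t r \<Longrightarrow> cmod (\<psi> z) \<le> m"
    and z: "z \<in> ball t r" and e: "e \<in> cball t r"
  shows "cmod (F z - G e) \<le> m * (2 * r)"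
proof -
  have m: "0 \<le> m" using order_trans[OF norm_ge_zero bd[OF z]] .
  have cl: "closure (ball t r) = cball t r" using r by simp
  have "cmod (F z - G w) \<le> m * (2 * r)" if w: "w \<in> ball t r" for w
  proof -
    have "cmod (F z - F w) \<le> m * cmod (z - w)"
    proof (rule field_differentiable_bound[of "ball t r" F \<psi>])
      show "(F has_field_derivative \<psi> v) (at v within ball t r)" if "v \<in> ball t r" for v
        using prim[of v] that sub DERIV_subset by blast
    qed (use bd z w in auto)
    also have "\<dots> \<le> m * (2 * r)"
      using m z w norm_triangle_ineq4[of "z - t" "w - t"]
      by (intro mult_left_mono) (auto simp: dist_norm norm_minus_commute)
    finally show ?thesis using ext w sub by auto
  qed
  moreover have "continuous_on (closure (ball t r)) (\<lambda>w. F z - G w)"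
    by (intro continuous_intros continuous_on_subset[OF G] closure_mono sub)
  ultimately show ?thesis
    using continuous_on_closure_norm_le[of "ball t r" "\<lambda>w. F z - G w" "m * (2 * r)" e] e cl by auto
qed

text \<open>
  On \<open>ball t (t - a)\<close> the exponents satisfy \<open>Re (1/(z-a)) \<ge> 1/(2(t-a))\<close> and \<open>Re (1/(b-z)) \<ge> 1/(b-a)\<close>.
  The constant \<open>301/99 = 400/99 - 1\<close> arises from bounding the integral of the bump from below by its
  middle tenth, where \<open>1/(x-a) + 1/(b-x) \<le> 400/(99(b-a))\<close>.
\<close>
lemma smooth_cutoff_exists:
  fixes a b \<nu> :: real
  assumes ab: "a < b" and nu: "0 \<le> \<nu>"
  defines "mid \<equiv> (a + b) / 2" and "K \<equiv> 10 / (b - a) * exp (301 / 99 * \<nu> / (b - a))"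
  obtains \<Psi> where "\<Psi> holomorphic_on ball (of_real mid) ((b - a) / 2)"
    "\<And>t z. a < t \<Longrightarrow> t \<le> mid \<Longrightarrow> z \<in> ball (of_real t) (t - a) \<Longrightarrow>
       cmod (\<Psi> z) \<le> K * (2 * (t - a)) * exp (- \<nu> / (2 * (t - a)))"
    "\<And>t z. mid \<le> t \<Longrightarrow> t < b \<Longrightarrow> z \<in> ball (of_real t) (b - t) \<Longrightarrow>
       cmod (1 - \<Psi> z) \<le> K * (2 * (b - t)) * exp (- \<nu> / (2 * (b - t)))"
proof -
  define \<theta> where "\<theta> = b - a"
  define D where "D = ball (complex_of_real mid) (\<theta> / 2)"
  define \<psi> where "\<psi> z = exp (- (of_real \<nu> / (z - of_real a)) - of_real \<nu> / (of_real b - z))" for z :: complex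
  have th: "0 < \<theta>" using ab by (simp add: \<theta>_def)
  have norm_psi: "cmod (\<psi> z) = exp (- (\<nu> * Re (1 / (z - of_real a))) - \<nu> * Re (1 / (of_real b - z)))" for z
  proof -
    have "Re (of_real \<nu> / w) = \<nu> * Re (1 / w)" for w :: complex
      by (simp add: Re_divide)
    then show ?thesis unfolding \<psi>_def norm_exp_eq_Re by simp
  qed
  have shift_a: "z - of_real a \<in> ball (of_real (t - a)) r" if "z \<in> ball (of_real t) r" for z :: complex and t r
    using that by (simp add: dist_norm)
  have shift_b: "of_real b - z \<in> ball (of_real (b - t)) r" if "z \<in> ball (of_real t) r" for z :: complex and t r
    using that by (simp add: dist_norm norm_minus_commute)
  have mid: "mid - a = \<theta> / 2" "b - mid = \<theta> / 2" by (auto simp: mid_def \<theta>_def field_simps)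
  have Da: "1 / \<theta> \<le> Re (1 / (z - of_real a))" and Db: "1 / \<theta> \<le> Re (1 / (of_real b - z))" if "z \<in> D" for z
    using Re_inverse_ge_ball[OF shift_a[OF that[unfolded D_def], unfolded mid]]
      Re_inverse_ge_ball[OF shift_b[OF that[unfolded D_def], unfolded mid]] by auto
  have ne: "z \<noteq> of_real a" "z \<noteq> of_real b" if "z \<in> D" for z
    using Da[OF that] Db[OF that] th by (auto simp: divide_le_0_iff)
  have hol: "\<psi> holomorphic_on D"
    unfolding \<psi>_def by (intro holomorphic_intros) (use ne in force)+
  have le1: "cmod (\<psi> z) \<le> 1" if "z \<in> D" for z
  proof -
    have "0 \<le> \<nu> * Re (1 / (z - of_real a))" "0 \<le> \<nu> * Re (1 / (of_real b - z))"
      using Da[OF that] Db[OF that] th nu by (smt (verit) divide_pos_pos mult_nonneg_nonneg)+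
    then show ?thesis unfolding norm_psi by simp
  qed
  have convD: "convex D" and opD: "open D" by (auto simp: D_def)
  obtain F where F: "\<And>z. z \<in> D \<Longrightarrow> (F has_field_derivative \<psi> z) (at z within D)"
  proof (rule holomorphic_convex_primitive[of D "{}" \<psi>])
    show "\<psi> field_differentiable at x" if "x \<in> interior D - {}" for x
      using that hol opD by (simp add: holomorphic_on_imp_differentiable_at interior_open)
  qed (use convD hol holomorphic_on_imp_continuous_on in auto)
  \<comment> \<open>For positive \<open>\<nu>\<close> the bump has essential singularities at
    \<open>a\<close> and \<open>b\<close>, yet it is bounded by 1 in the disc. Hence the primitive
    is Lipschitz and has boundary values there, by which it is normalised to be 0 at
    \<open>a\<close> and 1 at \<open>b\<close>.\<close>
  have lip: "cmod (F z - F w) \<le> 1 * cmod (z - w)" if "z \<in> D" "w \<in> D" for z w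
    by (rule field_differentiable_bound[OF convD F le1]) (use that in auto)
  have "uniformly_continuous_on D F"
    unfolding uniformly_continuous_on_def dist_norm using lip by (metis (no_types) mult_1 order_le_less_trans)
  then obtain G where G: "uniformly_continuous_on (closure D) G" "\<And>x. x \<in> D \<Longrightarrow> F x = G x"
    using uniformly_continuous_on_extension_on_closure by metis
  have Gc: "continuous_on (closure D) G" using G(1) uniformly_continuous_imp_continuous by blast
  have clD: "closure D = cball (of_real mid) (\<theta> / 2)" using th by (simp add: D_def)
  define N where "N = G (of_real b) - G (of_real a)"
  define N0 where "N0 = \<theta> / 10 * exp (- (400 / 99 * \<nu> / \<theta>))"
  \<comment> \<open>On the real axis the bump is positive, so the normalising constant can be
    bounded below through a monotone real function.\<close>
  define h where "h x = Re (G (of_real x))" for x :: real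
  have xD: "complex_of_real x \<in> D" if "a < x" "x < b" for x
  proof -
    have "\<bar>mid - x\<bar> < \<theta> / 2" using that by (auto simp: \<theta>_def mid_def abs_if field_simps)
    then show ?thesis by (simp add: D_def dist_norm flip: of_real_diff)
  qed
  have xclD: "complex_of_real x \<in> closure D" if "a \<le> x" "x \<le> b" for x
  proof -
    have "\<bar>mid - x\<bar> \<le> \<theta> / 2" using that by (auto simp: \<theta>_def mid_def abs_if field_simps)
    then show ?thesis by (simp add: clD dist_norm flip: of_real_diff)
  qed
  have hc: "continuous_on {a..b} h"
    unfolding h_def by (intro continuous_intros continuous_on_compose2[OF Gc]) (auto intro: xclD)
  define \<psi>r where "\<psi>r x = exp (- (\<nu> / (x - a)) - \<nu> / (b - x))" for x
  have hd: "(h has_real_derivative \<psi>r x) (at x)" if x: "a < x" "x < b" for x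
  proof -
    have "(F has_field_derivative \<psi> (of_real x)) (at (of_real x))"
      using F[OF xD[OF x]] at_within_open[OF xD[OF x] opD] by simp
    then have "(G has_field_derivative \<psi> (of_real x)) (at (of_real x))"
      by (rule has_field_derivative_transform_within_open[OF _ opD xD[OF x] G(2)])
    then have "((\<lambda>x. Re (G (of_real x))) has_vector_derivative Re (\<psi> (of_real x))) (at x)"
      by (intro bounded_linear.has_vector_derivative[OF bounded_linear_Re] has_vector_derivative_real_field)
    moreover have "\<psi> (of_real x) = of_real (\<psi>r x)"
      by (simp add: \<psi>_def \<psi>r_def exp_of_real flip: of_real_diff of_real_divide of_real_minus)
    ultimately show ?thesis
      by (simp add: h_def[abs_def] has_real_derivative_iff_has_vector_derivative)
  qed
  have mono: "h x \<le> h y" if "a \<le> x" "x \<le> y" "y \<le> b" for x y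
  proof (rule DERIV_nonneg_imp_increasing_open[OF that(2)])
    show "\<exists>y. DERIV h z :> y \<and> 0 \<le> y" if "x < z" "z < y" for z
      using hd[of z] that \<open>a \<le> x\<close> \<open>y \<le> b\<close> by (intro exI[of _ "\<psi>r z"]) (auto simp: \<psi>r_def)
  qed (use that in \<open>auto intro: continuous_on_subset[OF hc]\<close>)
  define m0 where "m0 = exp (- (400 / 99 * \<nu> / \<theta>))"
  have low: "m0 \<le> \<psi>r x" if "mid - \<theta> / 20 \<le> x" "x \<le> mid + \<theta> / 20" for x
  proof -
    have "\<bar>x - mid\<bar> \<le> \<theta> / 20" using that by (auto simp: abs_if)
    then have "(x - mid)\<^sup>2 \<le> (\<theta> / 20)\<^sup>2" by (metis abs_ge_zero power2_abs power_mono)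
    moreover have "(x - a) * (b - x) = (\<theta> / 2)\<^sup>2 - (x - mid)\<^sup>2"
      by (simp add: \<theta>_def mid_def power2_eq_square field_simps)
    \<comment> \<open>99/400 = 1/4 - 1/400: the squared half-length minus the squared offset, which
      is at most (\<theta>/20)^2.\<close>
    ultimately have ge: "99 / 400 * \<theta>\<^sup>2 \<le> (x - a) * (b - x)"
      by (simp add: power_divide)
    have pos: "0 < x - a" "0 < b - x" using that th mid by auto
    have "\<nu> / (x - a) + \<nu> / (b - x) = \<nu> * \<theta> / ((x - a) * (b - x))"
      using pos by (simp add: \<theta>_def field_simps)
    also have "\<dots> \<le> \<nu> * \<theta> / (99 / 400 * \<theta>\<^sup>2)"
      using ge th nu by (intro divide_left_mono mult_pos_pos mult_nonneg_nonneg pos) auto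
    also have "\<dots> = 400 / 99 * \<nu> / \<theta>" using th by (simp add: power2_eq_square)
    finally show ?thesis by (simp add: m0_def \<psi>r_def)
  qed
  \<comment> \<open>Subtracting the line of slope \<open>m0\<close> leaves a nondecreasing function
    on the middle tenth, so the increment of \<open>h\<close> is estimated without an
    integral.\<close>
  have "h (mid - \<theta> / 20) - m0 * (mid - \<theta> / 20) \<le> h (mid + \<theta> / 20) - m0 * (mid + \<theta> / 20)"
  proof (rule DERIV_nonneg_imp_increasing_open[where f = "\<lambda>x. h x - m0 * x"])
    show "\<exists>y. DERIV (\<lambda>x. h x - m0 * x) x :> y \<and> 0 \<le> y" if "mid - \<theta> / 20 < x" "x < mid + \<theta> / 20" for x
    proof -
      have "a < x" "x < b" using that mid th by auto
      from hd[OF this] show ?thesis using low[of x] that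
        by (intro exI[of _ "\<psi>r x - m0"]) (auto intro!: derivative_eq_intros)
    qed
    show "continuous_on {mid - \<theta> / 20..mid + \<theta> / 20} (\<lambda>x. h x - m0 * x)"
      using mid th by (intro continuous_intros continuous_on_subset[OF hc]) auto
  qed (use th in auto)
  then have "N0 \<le> h (mid + \<theta> / 20) - h (mid - \<theta> / 20)"
    by (simp add: N0_def m0_def algebra_simps)
  also have "\<dots> \<le> h b - h a"
    using mono[of a "mid - \<theta> / 20"] mono[of "mid + \<theta> / 20" b] mid th by auto
  also have "\<dots> = Re N" by (simp add: N_def h_def)
  also have "\<dots> \<le> cmod N" by (rule complex_Re_le_cmod)
  finally have N0: "N0 \<le> cmod N" .
  have N0pos: "0 < N0" using th by (simp add: N0_def)
  have Nne: "N \<noteq> 0" using N0 N0pos by auto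
  \<comment> \<open>The factor \<open>exp (- (\<nu> / \<theta>))\<close> comes from the far endpoint
    and is common to both cutoff bounds; dividing it by the normalisation gives
    \<open>K\<close>.\<close>
  have KN: "exp (- (\<nu> / \<theta>)) / N0 = K"
  proof -
    have "exp (- (\<nu> / \<theta>)) / exp (- (400 / 99 * \<nu> / \<theta>)) = exp (301 / 99 * \<nu> / \<theta>)"
      unfolding exp_diff[symmetric] by (rule arg_cong[where f = exp]) (simp add: field_simps)
    then show ?thesis unfolding K_def N0_def \<theta>_def[symmetric] by (simp add: field_simps)
  qed
  define \<Psi> where "\<Psi> z = (F z - G (of_real a)) / N" for z
  have FD: "F holomorphic_on D"
    using F opD by (auto simp: holomorphic_on_def field_differentiable_def)
  have quot: "m * (2 * q) / cmod N \<le> K * (2 * q) * E"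
    if "m = exp (- (\<nu> / \<theta>)) * E" "0 < q" "0 \<le> E" for m q E
  proof -
    have "m * (2 * q) / cmod N \<le> m * (2 * q) / N0"
      using that N0 N0pos Nne by (intro divide_left_mono) auto
    also have "\<dots> = K * (2 * q) * E" by (simp add: that(1) flip: KN)
    finally show ?thesis .
  qed
  show ?thesis
  proof (rule that[of \<Psi>])
    show "\<Psi> holomorphic_on ball (of_real mid) ((b - a) / 2)"
      using FD Nne unfolding \<Psi>_def D_def \<theta>_def by (auto intro!: holomorphic_intros)
    show "cmod (\<Psi> z) \<le> K * (2 * (t - a)) * exp (- \<nu> / (2 * (t - a)))"
      if t: "a < t" "t \<le> mid" and z: "z \<in> ball (of_real t) (t - a)" for t z
    proof -
      have sub: "ball (complex_of_real t) (t - a) \<subseteq> D"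
        unfolding D_def using t mid by (subst ball_subset_ball_iff) (auto simp: dist_norm simp flip: of_real_diff)
      define m where "m = exp (- (\<nu> / \<theta>)) * exp (- \<nu> / (2 * (t - a)))"
      have bd: "cmod (\<psi> w) \<le> m" if w: "w \<in> ball (of_real t) (t - a)" for w
      proof -
        have "\<nu> * (1 / (2 * (t - a))) \<le> \<nu> * Re (1 / (w - of_real a))"
          by (intro mult_left_mono Re_inverse_ge_ball shift_a w nu)
        moreover have "\<nu> * (1 / \<theta>) \<le> \<nu> * Re (1 / (of_real b - w))"
          using Db w sub by (intro mult_left_mono nu) auto
        ultimately show ?thesis unfolding norm_psi m_def exp_add[symmetric] by simp
      qed
      have "cmod (F z - G (of_real a)) \<le> m * (2 * (t - a))"
        by (rule primitive_extension_bound[OF F G(2) Gc sub _ bd z])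
           (use t in \<open>auto simp: dist_norm simp flip: of_real_diff\<close>)
      then have "cmod (\<Psi> z) \<le> m * (2 * (t - a)) / cmod N"
        unfolding \<Psi>_def norm_divide by (intro divide_right_mono) auto
      then show ?thesis using quot[OF m_def, of "t - a"] t by simp
    qed
    show "cmod (1 - \<Psi> z) \<le> K * (2 * (b - t)) * exp (- \<nu> / (2 * (b - t)))"
      if t: "mid \<le> t" "t < b" and z: "z \<in> ball (of_real t) (b - t)" for t z
    proof -
      have sub: "ball (complex_of_real t) (b - t) \<subseteq> D"
        unfolding D_def using t mid by (subst ball_subset_ball_iff) (auto simp: dist_norm simp flip: of_real_diff)
      define m where "m = exp (- (\<nu> / \<theta>)) * exp (- \<nu> / (2 * (b - t)))"
      have bd: "cmod (\<psi> w) \<le> m" if w: "w \<in> ball (of_real t) (b - t)" for w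
      proof -
        have "\<nu> * (1 / (2 * (b - t))) \<le> \<nu> * Re (1 / (of_real b - w))"
          by (intro mult_left_mono Re_inverse_ge_ball shift_b w nu)
        moreover have "\<nu> * (1 / \<theta>) \<le> \<nu> * Re (1 / (w - of_real a))"
          using Da w sub by (intro mult_left_mono nu) auto
        ultimately show ?thesis unfolding norm_psi m_def exp_add[symmetric] by simp
      qed
      have "cmod (F z - G (of_real b)) \<le> m * (2 * (b - t))"
        by (rule primitive_extension_bound[OF F G(2) Gc sub _ bd z])
           (use t in \<open>auto simp: dist_norm simp flip: of_real_diff\<close>)
      moreover have "1 - \<Psi> z = (G (of_real b) - F z) / N"
        using Nne by (simp add: \<Psi>_def N_def field_simps)
      ultimately have "cmod (1 - \<Psi> z) \<le> m * (2 * (b - t)) / cmod N"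
        by (simp add: norm_divide norm_minus_commute divide_right_mono)
      then show ?thesis using quot[OF m_def, of "b - t"] t by simp
    qed
  qed
qed

section \<open>Controlled eigenmodes\<close>

text \<open>The equation is encoded by the witness \<open>wt\<close>, which is at once the time
  derivative of \<open>w\<close> and the space derivative of \<open>ws\<close>. Space derivatives
  are taken within \<open>I\<close>, so that integration by parts reaches the boundary;
  \<open>U\<close> is going to omit the switching instants.\<close>

definition classical_heat ::
  "boundary_op \<Rightarrow> real set \<Rightarrow> real set \<Rightarrow> (real \<Rightarrow> real \<Rightarrow> complex) \<Rightarrow> bool" where
  "classical_heat B U I w \<longleftrightarrow> (\<exists>ws wt.
     continuous_on (U \<times> I) (\<lambda>(t, s). wt t s) \<and>
     (\<forall>t\<in>U. \<forall>s\<in>I.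
        ((\<lambda>r. w r s) has_vector_derivative wt t s) (at t) \<and>
        (w t has_vector_derivative ws t s) (at s within I) \<and>
        (ws t has_vector_derivative wt t s) (at s within I)) \<and>
     (\<forall>t\<in>U. case B of Dirichlet \<Rightarrow> w t 0 = 0 | Neumann \<Rightarrow> ws t 0 = 0))"

definition eig :: "boundary_op \<Rightarrow> real \<Rightarrow> real \<Rightarrow> real" where
  "eig B \<mu> s = (case B of Dirichlet \<Rightarrow> sin (\<mu> * s) | Neumann \<Rightarrow> cos (\<mu> * s))"

text \<open>The solution with flat output \<open>c * f\<close>, that is with \<open>w = c * f\<close> (Neumann) or \<open>\<partial>\<^sub>s w = c * f\<close> (Dirichlet) at \<open>s = 0\<close>.\<close>
definition heat_flow :: "boundary_op \<Rightarrow> real \<Rightarrow> (complex \<Rightarrow> complex) \<Rightarrow> real \<Rightarrow> real \<Rightarrow> complex" where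
  "heat_flow B c f t s =
     of_real c * heat_series (case B of Dirichlet \<Rightarrow> 1 | Neumann \<Rightarrow> 0) f (of_real t) (of_real s)"

lemma abs_eig_le_1: "\<bar>eig B \<mu> s\<bar> \<le> 1"
  by (cases B) (auto simp: eig_def)

lemma heat_flow_deriv_time:
  assumes "f holomorphic_on S" "open S" "of_real t \<in> S"
  shows "((\<lambda>r. heat_flow B c f r s) has_vector_derivative heat_flow B c (deriv f) t s) (at t)"
  unfolding heat_flow_def
  by (rule has_vector_derivative_real_field[of "\<lambda>z. of_real c * heat_series _ f z (of_real s)"])
     (intro DERIV_cmult heat_series_deriv_time[OF assms])

lemma continuous_on_heat_flow:
  assumes hol: "f holomorphic_on S" and S: "open S"
    and A: "\<And>x. x \<in> A \<Longrightarrow> of_real (fst x) \<in> S"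
  shows "continuous_on A (\<lambda>(t, s). heat_flow B c f t s)"
proof -
  have "continuous_on A (\<lambda>x. (\<lambda>(z, s). heat_series p f z s) (of_real (fst x), of_real (snd x)))" for p
    by (rule continuous_on_compose2[OF continuous_on_heat_series[OF hol S, of p]])
       (use A in \<open>auto intro!: continuous_intros\<close>)
  then show ?thesis
    unfolding heat_flow_def case_prod_beta' by (intro continuous_intros) simp
qed

lemma classical_heat_flow:
  assumes hol: "f holomorphic_on S" and S: "open S" and U: "\<And>t. t \<in> U \<Longrightarrow> of_real t \<in> S"
  shows "classical_heat B U I (heat_flow B c f)"
  unfolding classical_heat_def
proof (intro exI conjI ballI)
  \<comment> \<open>Differentiation in space takes index 1 to index 0 with the same
    \<open>f\<close>, and index 0 to index 1 with \<open>deriv f\<close>. From either start, two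
    steps end at the flow of \<open>deriv f\<close>, which is also the time derivative.\<close>
  define ws where "ws t s = (case B of
      Dirichlet \<Rightarrow> of_real c * heat_series 0 f (of_real t) (of_real s)
    | Neumann \<Rightarrow> of_real c * heat_series 1 (deriv f) (of_real t) (of_real s))" for t s :: real
  have hol': "deriv f holomorphic_on S" using hol S by (rule holomorphic_deriv)
  show "continuous_on (U \<times> I) (\<lambda>(t, s). heat_flow B c (deriv f) t s)"
    by (rule continuous_on_heat_flow[OF hol' S]) (use U in auto)
  fix t assume "t \<in> U"
  then have t: "of_real t \<in> S" by (rule U)
  show "case B of Dirichlet \<Rightarrow> heat_flow B c f t 0 = 0 | Neumann \<Rightarrow> ws t 0 = 0"
    by (cases B) (use heat_series_at_0[of 0] in \<open>auto simp: heat_flow_def ws_def\<close>)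
  fix s
  show "((\<lambda>r. heat_flow B c f r s) has_vector_derivative heat_flow B c (deriv f) t s) (at t)"
    by (rule heat_flow_deriv_time[OF hol S t])
  show "(heat_flow B c f t has_vector_derivative ws t s) (at s within I)"
  proof (cases B)
    case Dirichlet
    then show ?thesis
      using has_vector_derivative_real_field[OF DERIV_cmult[OF heat_series_deriv_space[OF hol S t, of 0 "of_real s"], of "of_real c"]]
      by (simp add: heat_flow_def[abs_def] ws_def)
  next
    case Neumann
    then show ?thesis
      using has_vector_derivative_real_field[OF DERIV_cmult[OF heat_series_0_deriv_space[OF hol S t, of "of_real s"], of "of_real c"]]
      by (simp add: heat_flow_def[abs_def] ws_def)
  qed
  show "(ws t has_vector_derivative heat_flow B c (deriv f) t s) (at s within I)"
  proof (cases B)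
    case Dirichlet
    then show ?thesis
      using has_vector_derivative_real_field[OF DERIV_cmult[OF heat_series_0_deriv_space[OF hol S t, of "of_real s"], of "of_real c"]]
      by (simp add: heat_flow_def ws_def[abs_def])
  next
    case Neumann
    then show ?thesis
      using has_vector_derivative_real_field[OF DERIV_cmult[OF heat_series_deriv_space[OF hol' S t, of 0 "of_real s"], of "of_real c"]]
      by (simp add: heat_flow_def ws_def[abs_def])
  qed
qed

lemma classical_heat_cong:
  assumes w: "classical_heat B V I w" and U: "open U" "U \<subseteq> V" and I: "0 \<in> I"
    and eq: "\<And>t s. t \<in> U \<Longrightarrow> s \<in> I \<Longrightarrow> v t s = w t s"
  shows "classical_heat B U I v"
proof -
  obtain ws wt where *: "continuous_on (V \<times> I) (\<lambda>(t, s). wt t s)"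
    "\<And>t s. t \<in> V \<Longrightarrow> s \<in> I \<Longrightarrow> ((\<lambda>r. w r s) has_vector_derivative wt t s) (at t)"
    "\<And>t s. t \<in> V \<Longrightarrow> s \<in> I \<Longrightarrow> (w t has_vector_derivative ws t s) (at s within I)"
    "\<And>t s. t \<in> V \<Longrightarrow> s \<in> I \<Longrightarrow> (ws t has_vector_derivative wt t s) (at s within I)"
    "\<And>t. t \<in> V \<Longrightarrow> case B of Dirichlet \<Rightarrow> w t 0 = 0 | Neumann \<Rightarrow> ws t 0 = 0"
    using w unfolding classical_heat_def by blast
  show ?thesis
    unfolding classical_heat_def
  proof (rule exI[of _ ws], rule exI[of _ wt], intro conjI ballI)
    show "continuous_on (U \<times> I) (\<lambda>(t, s). wt t s)"
      by (rule continuous_on_subset[OF *(1)]) (use U in auto)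
    fix t assume t: "t \<in> U"
    then have tV: "t \<in> V" using U by auto
    show "case B of Dirichlet \<Rightarrow> v t 0 = 0 | Neumann \<Rightarrow> ws t 0 = 0"
      using *(5)[OF tV] eq[OF t I] by (cases B) auto
    fix s assume s: "s \<in> I"
    show "((\<lambda>r. v r s) has_vector_derivative wt t s) (at t)"
      by (rule has_vector_derivative_transform_within_open[OF *(2)[OF tV s] U(1) t]) (simp add: eq s)
    show "(v t has_vector_derivative ws t s) (at s within I)"
      by (rule has_vector_derivative_transform[OF s _ *(3)[OF tV s]]) (simp add: eq t)
    show "(ws t has_vector_derivative wt t s) (at s within I)" by (rule *(4)[OF tV s])
  qed
qed

text \<open>The two pieces may come from different flat outputs and have different witnesses;
  openness and disjointness of the time sets make the glued witness continuous.\<close>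

lemma classical_heat_Un:
  assumes "classical_heat B U I w" "classical_heat B V I w" "open U" "open V" "U \<inter> V = {}"
  shows "classical_heat B (U \<union> V) I w"
proof -
  obtain us ut where u: "continuous_on (U \<times> I) (\<lambda>(t, s). ut t s)"
    "\<And>t s. t \<in> U \<Longrightarrow> s \<in> I \<Longrightarrow> ((\<lambda>r. w r s) has_vector_derivative ut t s) (at t) \<and>
        (w t has_vector_derivative us t s) (at s within I) \<and>
        (us t has_vector_derivative ut t s) (at s within I)"
    "\<And>t. t \<in> U \<Longrightarrow> case B of Dirichlet \<Rightarrow> w t 0 = 0 | Neumann \<Rightarrow> us t 0 = 0"
    using assms(1) unfolding classical_heat_def by blast
  obtain vs vt where v: "continuous_on (V \<times> I) (\<lambda>(t, s). vt t s)"
    "\<And>t s. t \<in> V \<Longrightarrow> s \<in> I \<Longrightarrow> ((\<lambda>r. w r s) has_vector_derivative vt t s) (at t) \<and>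
        (w t has_vector_derivative vs t s) (at s within I) \<and>
        (vs t has_vector_derivative vt t s) (at s within I)"
    "\<And>t. t \<in> V \<Longrightarrow> case B of Dirichlet \<Rightarrow> w t 0 = 0 | Neumann \<Rightarrow> vs t 0 = 0"
    using assms(2) unfolding classical_heat_def by blast
  define ws where "ws t = (if t \<in> U then us t else vs t)" for t
  define wt where "wt t = (if t \<in> U then ut t else vt t)" for t
  have V: "t \<notin> U" if "t \<in> V" for t using that assms(5) by auto
  have "continuous_on (U \<times> I \<union> V \<times> I) (\<lambda>(t, s). wt t s)"
  proof (rule continuous_on_Un_local_open)
    show "openin (top_of_set (U \<times> I \<union> V \<times> I)) (U \<times> I)"
      unfolding openin_open using assms(3,5) by (intro exI[of _ "U \<times> UNIV"]) (auto simp: open_Times)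
    show "openin (top_of_set (U \<times> I \<union> V \<times> I)) (V \<times> I)"
      unfolding openin_open using assms(4,5) by (intro exI[of _ "V \<times> UNIV"]) (auto simp: open_Times)
    show "continuous_on (U \<times> I) (\<lambda>(t, s). wt t s)"
      using u(1) by (rule continuous_on_eq) (auto simp: wt_def)
    show "continuous_on (V \<times> I) (\<lambda>(t, s). wt t s)"
      using v(1) by (rule continuous_on_eq) (auto simp: wt_def V)
  qed
  then have cont: "continuous_on ((U \<union> V) \<times> I) (\<lambda>(t, s). wt t s)"
    by (simp only: Sigma_Un_distrib1)
  show ?thesis
    unfolding classical_heat_def
  proof (rule exI[of _ ws], rule exI[of _ wt], intro conjI[OF cont] conjI ballI)
    fix t assume t: "t \<in> U \<union> V"
    show "case B of Dirichlet \<Rightarrow> w t 0 = 0 | Neumann \<Rightarrow> ws t 0 = 0"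
      using t u(3)[of t] v(3)[of t] V by (cases B) (auto simp: ws_def)
    fix s assume "s \<in> I"
    with t show "((\<lambda>r. w r s) has_vector_derivative wt t s) (at t)"
      "(w t has_vector_derivative ws t s) (at s within I)"
      "(ws t has_vector_derivative wt t s) (at s within I)"
      using u(2)[of t s] v(2)[of t s] V by (auto simp: ws_def wt_def)
  qed
qed

text \<open>This gives continuity at a switching instant, with \<open>d\<close> the distance in time
  to it: where \<open>d\<close> vanishes the bound forces both the value and the limit to be
  0.\<close>

lemma continuous_on_of_vanishing_bound:
  fixes E :: "'a::topological_space \<Rightarrow> 'b::real_normed_vector"
  assumes cont: "continuous_on {x \<in> A. 0 < d x} E" and d: "continuous_on A d"
    and bd: "\<And>x. x \<in> A \<Longrightarrow> norm (E x) \<le> C * d x" and d0: "\<And>x. x \<in> A \<Longrightarrow> 0 \<le> d x"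
  shows "continuous_on A E"
  unfolding continuous_on_def
proof
  fix x assume x: "x \<in> A"
  show "(E \<longlongrightarrow> E x) (at x within A)"
  proof (cases "0 < d x")
    case True
    have "(E \<longlongrightarrow> E x) (at x within {x \<in> A. 0 < d x})"
      using cont x True by (auto simp: continuous_on_def)
    moreover have "\<forall>\<^sub>F y in at x within A. 0 < d y"
      using d x True by (intro order_tendstoD(1)) (auto simp: continuous_on_def)
    ultimately show ?thesis
      unfolding tendsto_def eventually_at_filter
      by (auto elim: eventually_elim2)
  next
    case False
    then have dx: "d x = 0" using d0[OF x] by simp
    have "(d \<longlongrightarrow> d x) (at x within A)" using d x by (auto simp: continuous_on_def)
    then have "((\<lambda>y. C * d y) \<longlongrightarrow> 0) (at x within A)"
      using dx tendsto_mult_right_zero by fastforce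
    moreover have "\<forall>\<^sub>F y in at x within A. norm (E y) \<le> C * d y"
      using bd by (auto simp: eventually_at_filter)
    ultimately have "(E \<longlongrightarrow> 0) (at x within A)"
      by (rule Lim_null_comparison[rotated])
    then show ?thesis using bd[OF x] dx by simp
  qed
qed

text \<open>The exponents add up to -L^2/(40r), because 11/40 - 1/4 = 1/40. This surplus, which is
  why \<open>11 / 20\<close> exceeds 1/2, absorbs the polynomial factor 1 + 20y uniformly in
  \<open>r\<close>.\<close>

lemma exp_cutoff_bound:
  fixes L r :: real
  assumes "0 < r"
  shows "exp (- (11 / 20 * L\<^sup>2) / (2 * r)) * ((1 + L\<^sup>2 / (2 * r)) * exp (L\<^sup>2 / (4 * r))) \<le> 21"
proof -
  define y where "y = L\<^sup>2 / (40 * r)"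
  have y: "0 \<le> y" using assms by (simp add: y_def)
  have *: "exp (- (11 / 20 * L\<^sup>2) / (2 * r)) * exp (L\<^sup>2 / (4 * r)) = exp (- y)"
    unfolding exp_add[symmetric] y_def using assms by (intro arg_cong[where f = exp]) (simp add: field_simps)
  have "exp (- (11 / 20 * L\<^sup>2) / (2 * r)) * ((1 + L\<^sup>2 / (2 * r)) * exp (L\<^sup>2 / (4 * r)))
      = (1 + L\<^sup>2 / (2 * r)) * exp (- y)"
    unfolding *[symmetric] by (simp only: mult_ac)
  also have "\<dots> = (1 + 20 * y) * exp (- y)" using assms by (simp add: y_def)
  also have "(1 + 20 * y) * exp (- y) \<le> (21 * exp y) * exp (- y)"
  proof (rule mult_right_mono)
    show "1 + 20 * y \<le> 21 * exp y" using exp_ge_add_one_self[of y] y by linarith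
  qed simp
  also have "\<dots> = 21" by (simp add: exp_minus)
  finally show ?thesis .
qed

text \<open>Up to \<open>mid\<close> the mode is compared with the free one, the difference being
  the flow of \<open>\<Psi> * f0\<close>; from there on the flow of \<open>(1 - \<Psi>) * f0\<close>
  is small by itself. If the free eigenfunction vanishes at \<open>L\<close>, only the error
  \<open>Q\<close> is left in the trace, and this is what bounds the control.\<close>

lemma controlled_mode:
  fixes B :: boundary_op and L T \<mu> :: real
  assumes L: "0 < L" and T: "0 < T" and mu: "0 \<le> \<mu>"
  defines "Q \<equiv> 210 * exp (301 / 162 * (L\<^sup>2 / T)) * (case B of Dirichlet \<Rightarrow> \<mu> * L | Neumann \<Rightarrow> 1)
      * exp (- (\<mu>\<^sup>2 * T / 10))"
  obtains W where
    "continuous_on ({0..T} \<times> {0..L}) (\<lambda>(t, s). W t s)"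
    "\<And>t s. t \<le> T / 10 \<Longrightarrow> W t s = of_real (exp (- (\<mu>\<^sup>2 * t)) * eig B \<mu> s)"
    "\<And>s. W T s = 0"
    "\<And>t s. \<lbrakk>T / 10 \<le> t; t \<le> T; 0 \<le> s; s \<le> L\<rbrakk> \<Longrightarrow> cmod (W t s) \<le> exp (- (\<mu>\<^sup>2 * T / 10)) + Q"
    "\<And>t. \<lbrakk>eig B \<mu> L = 0; t \<le> T\<rbrakk> \<Longrightarrow> cmod (W t L) \<le> Q"
    "classical_heat B ({0<..<T} - {T / 10}) {0..L} W"
proof -
  define a where "a = T / 10"
  define mid where "mid = (a + T) / 2"
  define c where "c = (case B of Dirichlet \<Rightarrow> \<mu> | Neumann \<Rightarrow> 1)"
  define p :: nat where "p = (case B of Dirichlet \<Rightarrow> 1 | Neumann \<Rightarrow> 0)"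
  define K where "K = 10 / (T - a) * exp (301 / 99 * (11 / 20 * L\<^sup>2) / (T - a))"
  have aT: "0 < a" "a < T" "a < mid" "mid < T" using T by (auto simp: a_def mid_def)
  define D where "D = ball (complex_of_real mid) ((T - a) / 2)"
  obtain \<Psi> where \<Psi>: "\<Psi> holomorphic_on D"
    "\<And>t z. a < t \<Longrightarrow> t \<le> mid \<Longrightarrow> z \<in> ball (of_real t) (t - a) \<Longrightarrow>
       cmod (\<Psi> z) \<le> K * (2 * (t - a)) * exp (- (11 / 20 * L\<^sup>2) / (2 * (t - a)))"
    "\<And>t z. mid \<le> t \<Longrightarrow> t < T \<Longrightarrow> z \<in> ball (of_real t) (T - t) \<Longrightarrow>
       cmod (1 - \<Psi> z) \<le> K * (2 * (T - t)) * exp (- (11 / 20 * L\<^sup>2) / (2 * (T - t)))"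
    using smooth_cutoff_exists[OF aT(2), of "11 / 20 * L\<^sup>2"] unfolding K_def mid_def D_def by auto
  define f0 where "f0 z = exp (- (of_real \<mu>)\<^sup>2 * z)" for z :: complex
  define E where "E = exp (- (\<mu>\<^sup>2 * T / 10))"
  have hol0: "f0 holomorphic_on S" for S unfolding f0_def by (intro holomorphic_intros)
  have opD: "open D" by (simp add: D_def)
  have tD: "of_real t \<in> D" if "a < t" "t < T" for t
  proof -
    have "\<bar>mid - t\<bar> < (T - a) / 2" using that by (auto simp: mid_def abs_if field_simps)
    then show ?thesis by (simp add: D_def dist_norm flip: of_real_diff)
  qed
  \<comment> \<open>The discs used below stay to the right of \<open>a\<close>, so the full decay of
    the free phase is available on them.\<close>
  have f0_bound: "cmod (f0 z) \<le> E" if "a \<le> Re z" for z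
  proof -
    have "\<mu>\<^sup>2 * a \<le> \<mu>\<^sup>2 * Re z" using that by (intro mult_left_mono) auto
    then show ?thesis by (simp add: f0_def norm_exp_eq_Re E_def a_def flip: of_real_power)
  qed
  \<comment> \<open>42 = 2 * 21, from the diameter \<open>2 * r\<close> in the cutoff bound and the
    constant of \<open>exp_cutoff_bound\<close>. At the largest distance \<open>(T - a) / 2\<close>
    this becomes 21 * 10 = 210, the constant in \<open>Q\<close>.\<close>
  define C where "C = 42 * K * E * (c * L ^ p)"
  have K0: "0 \<le> K" using aT by (simp add: K_def)
  have c0: "0 \<le> c" using mu by (cases B) (auto simp: c_def)
  have C0: "0 \<le> C" using K0 c0 L by (simp add: C_def E_def)
  have CQ: "C * r \<le> Q" if "r \<le> (T - a) / 2" for r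
  proof -
    have "C * r \<le> C * ((T - a) / 2)" using that C0 by (rule mult_left_mono)
    also have "\<dots> = 21 * ((T - a) * K) * (c * L ^ p) * E" by (simp add: C_def)
    \<comment> \<open>The exponent is (301/99) * (11/20) * (10/9), since \<open>T - a\<close> is
      nine tenths of \<open>T\<close>.\<close>
    also have "(T - a) * K = 10 * exp (301 / 162 * (L\<^sup>2 / T))"
    proof -
      have "301 / 99 * (11 / 20 * L\<^sup>2) / (T - a) = 301 / 162 * (L\<^sup>2 / T)"
        using T by (simp add: a_def field_simps)
      then show ?thesis using aT by (simp add: K_def)
    qed
    finally show ?thesis by (cases B) (simp_all add: Q_def c_def p_def E_def)
  qed
  have flow_bound: "cmod (heat_flow B c f t s) \<le> C * r"
    if hol: "f holomorphic_on ball (of_real t) r" and r: "0 < r"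
      and bd: "\<And>z. z \<in> ball (of_real t) r \<Longrightarrow>
        cmod (f z) \<le> K * (2 * r) * exp (- (11 / 20 * L\<^sup>2) / (2 * r)) * E"
      and s: "0 \<le> s" "s \<le> L" for f t r s
  proof -
    let ?M = "K * (2 * r) * exp (- (11 / 20 * L\<^sup>2) / (2 * r)) * E"
    have "cmod (heat_flow B c f t s) = c * cmod (heat_series p f (of_real t) (of_real s))"
      using c0 by (simp add: heat_flow_def norm_mult p_def)
    also have "\<dots> \<le> c * (?M * L ^ p * ((1 + L\<^sup>2 / (2 * r)) * exp (L\<^sup>2 / (4 * r))))"
      using s by (intro mult_left_mono heat_series_bound[OF hol r bd] c0) auto
    also have "\<dots> = 2 * K * E * (c * L ^ p) * r *
        (exp (- (11 / 20 * L\<^sup>2) / (2 * r)) * ((1 + L\<^sup>2 / (2 * r)) * exp (L\<^sup>2 / (4 * r))))"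
      by (simp only: mult_ac)
    also have "\<dots> \<le> 2 * K * E * (c * L ^ p) * r * 21"
      using K0 c0 L r by (intro mult_left_mono exp_cutoff_bound) (auto simp: E_def)
    finally show ?thesis by (simp add: C_def mult_ac)
  qed
  define f1 where "f1 z = \<Psi> z * f0 z" for z
  define f2 where "f2 z = (1 - \<Psi> z) * f0 z" for z
  have hol1: "f1 holomorphic_on D" unfolding f1_def by (intro holomorphic_intros \<Psi> hol0)
  have hol2: "f2 holomorphic_on D" unfolding f2_def by (intro holomorphic_intros \<Psi> hol0)
  define free where "free t s = heat_flow B c f0 t s" for t s
  have free: "free t s = of_real (exp (- (\<mu>\<^sup>2 * t)) * eig B \<mu> s)" for t s
  proof -
    have e: "exp (- (of_real \<mu>)\<^sup>2 * of_real t) = complex_of_real (exp (- (\<mu>\<^sup>2 * t)))"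
      by (simp flip: exp_of_real)
    show ?thesis
      using heat_series_exp[of "of_real \<mu>" "of_real t" "of_real s"]
      unfolding free_def heat_flow_def f0_def[abs_def, symmetric] e
      by (cases B) (simp_all add: c_def eig_def flip: cos_of_real sin_of_real)
  qed
  have split: "free t s = heat_flow B c f1 t s + heat_flow B c f2 t s" if "a < t" "t < T" for t s
  proof -
    have "f0 = (\<lambda>z. f1 z + f2 z)" by (auto simp: f1_def f2_def algebra_simps)
    then show ?thesis
      unfolding free_def heat_flow_def using heat_series_add[OF hol1 hol2 opD tD[OF that]]
      by (simp add: distrib_left)
  qed
  have b1: "cmod (heat_flow B c f1 t s) \<le> C * (t - a)" if t: "a < t" "t \<le> mid" and s: "0 \<le> s" "s \<le> L" for t s
  proof (rule flow_bound[OF _ _ _ s])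
    have sub: "ball (complex_of_real t) (t - a) \<subseteq> D"
    proof -
      have "dist (complex_of_real t) (of_real mid) + (t - a) \<le> (T - a) / 2"
        using t aT unfolding dist_of_real dist_real_def by (simp add: mid_def abs_if field_simps)
      then show ?thesis unfolding D_def by (subst ball_subset_ball_iff) auto
    qed
    then show "f1 holomorphic_on ball (of_real t) (t - a)" using hol1 holomorphic_on_subset by blast
    fix z assume z: "z \<in> ball (complex_of_real t) (t - a)"
    have "a \<le> Re z" using z abs_Re_le_cmod[of "of_real t - z"] by (simp add: dist_norm)
    then show "cmod (f1 z) \<le> K * (2 * (t - a)) * exp (- (11 / 20 * L\<^sup>2) / (2 * (t - a))) * E"
      unfolding f1_def norm_mult using \<Psi>(2)[OF t z] f0_bound K0 t by (intro mult_mono) auto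
  qed (use t in auto)
  have b2: "cmod (heat_flow B c f2 t s) \<le> C * (T - t)" if t: "mid \<le> t" "t < T" and s: "0 \<le> s" "s \<le> L" for t s
  proof (rule flow_bound[OF _ _ _ s])
    have sub: "ball (complex_of_real t) (T - t) \<subseteq> D"
    proof -
      have "dist (complex_of_real t) (of_real mid) + (T - t) \<le> (T - a) / 2"
        using t aT unfolding dist_of_real dist_real_def by (simp add: mid_def abs_if field_simps)
      then show ?thesis unfolding D_def by (subst ball_subset_ball_iff) auto
    qed
    then show "f2 holomorphic_on ball (of_real t) (T - t)" using hol2 holomorphic_on_subset by blast
    fix z assume z: "z \<in> ball (complex_of_real t) (T - t)"
    have "a \<le> Re z" using z abs_Re_le_cmod[of "of_real t - z"] t by (simp add: dist_norm mid_def field_simps)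
    then show "cmod (f2 z) \<le> K * (2 * (T - t)) * exp (- (11 / 20 * L\<^sup>2) / (2 * (T - t))) * E"
      unfolding f2_def norm_mult using \<Psi>(3)[OF t z] f0_bound K0 t by (intro mult_mono) auto
  qed (use t in auto)
  \<comment> \<open>The pieces fit together continuously: past \<open>a\<close> the jump from
    \<open>free\<close> is the flow of \<open>f1\<close>, which is O(t - a), and the flow of
    \<open>f2\<close> is O(T - t) near \<open>T\<close>.\<close>
  define W where "W t s = (if t \<le> a then free t s else if t < T then heat_flow B c f2 t s else 0)" for t s
  define J where "J = {0..L}"
  have freec: "continuous_on A (\<lambda>(t, s). free t s)" for A
    unfolding free_def by (rule continuous_on_heat_flow[OF hol0 open_UNIV]) simp
  have c1: "continuous_on ({0..a} \<times> J) (\<lambda>(t, s). W t s)"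
    by (rule continuous_on_eq[OF freec]) (auto simp: W_def)
  have c2: "continuous_on ({a..mid} \<times> J) (\<lambda>(t, s). W t s)"
  proof -
    \<comment> \<open>Near \<open>a\<close> there is no direct estimate for the flow of
      \<open>f2\<close>, so by \<open>split\<close> it is written as \<open>free\<close> plus this
      correction.\<close>
    define e where "e = (\<lambda>x::real \<times> real. if fst x \<le> a then 0 else - heat_flow B c f1 (fst x) (snd x))"
    have "continuous_on ({a..mid} \<times> J) e"
    proof (rule continuous_on_of_vanishing_bound[where d = "\<lambda>x. fst x - a" and C = C])
      have "continuous_on {x \<in> {a..mid} \<times> J. 0 < fst x - a} (\<lambda>x. - (\<lambda>(t, s). heat_flow B c f1 t s) x)"
        by (intro continuous_on_minus continuous_on_heat_flow[OF hol1 opD]) (use tD aT in auto)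
      then show "continuous_on {x \<in> {a..mid} \<times> J. 0 < fst x - a} e"
        by (rule continuous_on_eq) (auto simp: e_def)
    qed (use b1 in \<open>auto simp: e_def J_def intro!: continuous_intros\<close>)
    then have "continuous_on ({a..mid} \<times> J) (\<lambda>x. (\<lambda>(t, s). free t s) x + e x)"
      by (intro continuous_on_add freec)
    then show ?thesis
      by (rule continuous_on_eq) (use aT in \<open>auto simp: e_def W_def split\<close>)
  qed
  have c3: "continuous_on ({mid..T} \<times> J) (\<lambda>(t, s). W t s)"
  proof (rule continuous_on_of_vanishing_bound[where d = "\<lambda>x. T - fst x" and C = C])
    have "continuous_on {x \<in> {mid..T} \<times> J. 0 < T - fst x} (\<lambda>(t, s). heat_flow B c f2 t s)"
      by (intro continuous_on_heat_flow[OF hol2 opD]) (use tD aT in auto)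
    then show "continuous_on {x \<in> {mid..T} \<times> J. 0 < T - fst x} (\<lambda>(t, s). W t s)"
      by (rule continuous_on_eq) (use aT in \<open>auto simp: W_def\<close>)
  qed (use b2 aT in \<open>auto simp: W_def J_def intro!: continuous_intros\<close>)
  have cl: "closed ({x..y} \<times> J)" for x y :: real by (intro closed_Times) (auto simp: J_def)
  have "continuous_on ({0..a} \<times> J \<union> ({a..mid} \<times> J \<union> {mid..T} \<times> J)) (\<lambda>(t, s). W t s)"
    by (intro continuous_on_closed_Un cl closed_Un c1 c2 c3)
  moreover have "{0..a} \<times> J \<union> ({a..mid} \<times> J \<union> {mid..T} \<times> J) = {0..T} \<times> {0..L}"
    using aT by (auto simp: J_def)
  ultimately have cont: "continuous_on ({0..T} \<times> {0..L}) (\<lambda>(t, s). W t s)" by simp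
  have free_bound: "cmod (free t s) \<le> exp (- (\<mu>\<^sup>2 * t))" for t s
    unfolding free norm_of_real abs_mult using abs_eig_le_1[of B \<mu> s] by (simp add: mult_left_le)
  have Q0: "0 \<le> Q" using CQ[of 0] aT by simp
  have W1: "W t s = free t s - heat_flow B c f1 t s" if "a < t" "t \<le> mid" for t s
    using that aT split[of t s] by (simp add: W_def)
  have near_end: "cmod (W t s) \<le> Q" if "mid < t" "t \<le> T" "0 \<le> s" "s \<le> L" for t s
  proof (cases "t < T")
    case True
    then have "cmod (W t s) \<le> C * (T - t)" using that aT b2 by (simp add: W_def)
    also have "\<dots> \<le> Q" using that by (intro CQ) (auto simp: mid_def field_simps)
    finally show ?thesis .
  qed (use that aT Q0 in \<open>simp add: W_def\<close>)
  have near_start: "cmod (W t s - free t s) \<le> Q" if "t \<le> mid" "0 \<le> s" "s \<le> L" for t s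
  proof (cases "a < t")
    case True
    then have "cmod (W t s - free t s) \<le> C * (t - a)" using that W1 b1 by simp
    also have "\<dots> \<le> Q" using that by (intro CQ) (auto simp: mid_def field_simps)
    finally show ?thesis .
  qed (use Q0 in \<open>simp add: W_def\<close>)
  show ?thesis
  proof (rule that[of W, OF cont])
    show "W t s = of_real (exp (- (\<mu>\<^sup>2 * t)) * eig B \<mu> s)" if "t \<le> T / 10" for t s
      using that by (simp add: W_def a_def free)
    show "W T s = 0" for s using aT by (simp add: W_def)
    show "cmod (W t s) \<le> exp (- (\<mu>\<^sup>2 * T / 10)) + Q"
      if t: "T / 10 \<le> t" "t \<le> T" and s: "0 \<le> s" "s \<le> L" for t s
    proof (cases "t \<le> mid")
      case True
      have "\<mu>\<^sup>2 * (T / 10) \<le> \<mu>\<^sup>2 * t" using t by (intro mult_left_mono) auto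
      then have "cmod (free t s) \<le> exp (- (\<mu>\<^sup>2 * T / 10))"
        using order_trans[OF free_bound[of t s]] by simp
      then show ?thesis
        using near_start[OF True s] norm_triangle_sub[of "W t s" "free t s"] by linarith
    next
      case False
      then show ?thesis using near_end[of t s] t s by (simp add: add_increasing)
    qed
    show "cmod (W t L) \<le> Q" if "eig B \<mu> L = 0" "t \<le> T" for t
      using near_start[of t L] near_end[of t L] that L by (cases "t \<le> mid") (auto simp: free)
    have "classical_heat B {..<a} {0..L} W"
      by (rule classical_heat_cong[OF classical_heat_flow[OF hol0 open_UNIV, of UNIV B _ c]])
         (use L in \<open>auto simp: W_def free_def\<close>)
    moreover have "classical_heat B {a<..<T} {0..L} W"
      by (rule classical_heat_cong[OF classical_heat_flow[OF hol2 opD, of "{a<..<T}" B _ c]])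
         (use L tD in \<open>auto simp: W_def\<close>)
    ultimately have "classical_heat B ({..<a} \<union> {a<..<T}) {0..L} W"
      by (intro classical_heat_Un) auto
    then show "classical_heat B ({0<..<T} - {T / 10}) {0..L} W"
      by (rule classical_heat_cong) (use L aT in \<open>auto simp: a_def intro!: open_Diff\<close>)
  qed
qed

section \<open>Transposition formula for classical solutions\<close>

lemma continuous_on_Times_section:
  assumes "continuous_on (A \<times> I) (\<lambda>(t, s). f t s)" "t \<in> A"
  shows "continuous_on I (f t)"
proof -
  have "continuous_on I (\<lambda>s. (t, s))" by (intro continuous_intros)
  from continuous_on_compose2[OF assms(1) this] show ?thesis using assms(2) by auto
qed

text \<open>Off \<open>S\<close> the time derivative of the integral of \<phi> w is computed under
  the integral sign, and Green's formula in space moves the derivatives from \<open>w\<close> to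
  \<open>\<phi>\<close>. At the finitely many instants in \<open>S\<close>, continuity suffices for
  the fundamental theorem of calculus.\<close>

lemma classical_heat_transposition:
  assumes test: "test_function B L T \<phi> \<phi>t \<phi>s \<phi>ss"
    and w: "continuous_on ({0..T} \<times> {0..L}) (\<lambda>(t, s). w t s)"
    and S: "finite S" and cl: "classical_heat B ({0<..<T} - S) {0..L} w"
    and L: "0 < L" and t: "0 \<le> t" "t \<le> T"
  shows "((\<lambda>r. integral {0..L} (\<lambda>s. of_real (\<phi>t r s + \<phi>ss r s) * w r s) - of_real (\<phi>s r L) * w r L)
      has_integral (integral {0..L} (\<lambda>s. of_real (\<phi> t s) * w t s)
        - integral {0..L} (\<lambda>s. of_real (\<phi> 0 s) * w 0 s))) {0..t}"
proof (rule fundamental_theorem_of_calculus_interior_strong[OF S t(1)])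
  obtain ws wt where wt: "continuous_on (({0<..<T} - S) \<times> {0..L}) (\<lambda>(t, s). wt t s)"
    and der: "\<And>t s. \<lbrakk>t \<in> {0<..<T} - S; s \<in> {0..L}\<rbrakk> \<Longrightarrow> ((\<lambda>r. w r s) has_vector_derivative wt t s) (at t)"
      "\<And>t s. \<lbrakk>t \<in> {0<..<T} - S; s \<in> {0..L}\<rbrakk> \<Longrightarrow> (w t has_vector_derivative ws t s) (at s within {0..L})"
      "\<And>t s. \<lbrakk>t \<in> {0<..<T} - S; s \<in> {0..L}\<rbrakk> \<Longrightarrow> (ws t has_vector_derivative wt t s) (at s within {0..L})"
    and bc: "\<And>t. t \<in> {0<..<T} - S \<Longrightarrow> case B of Dirichlet \<Rightarrow> w t 0 = 0 | Neumann \<Rightarrow> ws t 0 = 0"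
    using cl unfolding classical_heat_def by blast
  have ct: "continuous_on ({0..T} \<times> {0..L}) (\<lambda>(t, s). \<psi> t s)" if "\<psi> \<in> {\<phi>, \<phi>t, \<phi>s, \<phi>ss}" for \<psi>
    using test that unfolding test_function_def by blast
  have test_der: "((\<lambda>r. \<phi> r s) has_real_derivative \<phi>t t s) (at t within {0..T})"
      "((\<lambda>x. \<phi> t x) has_real_derivative \<phi>s t s) (at s within {0..L})"
      "((\<lambda>x. \<phi>s t x) has_real_derivative \<phi>ss t s) (at s within {0..L})"
    if "t \<in> {0..T}" "s \<in> {0..L}" for t s
    using test that unfolding test_function_def by blast+
  have test_bc: "apply_boundary_op B (\<phi> t 0) (\<phi>s t 0) = 0" "\<phi> t L = 0" if "t \<in> {0..T}" for t
    using test that unfolding test_function_def by blast+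
  have cmul: "continuous_on A (\<lambda>x. (case x of (t, s) \<Rightarrow> of_real (\<psi> t s)) * (case x of (t, s) \<Rightarrow> v t s))"
    if "A \<subseteq> {0..T} \<times> {0..L}" "\<psi> \<in> {\<phi>, \<phi>t, \<phi>s, \<phi>ss}" "continuous_on A (\<lambda>(t, s). v t s)"
    for A and v :: "real \<Rightarrow> real \<Rightarrow> complex" and \<psi>
  proof -
    have "continuous_on A (\<lambda>x. complex_of_real ((\<lambda>(t, s). \<psi> t s) x))"
      by (intro continuous_intros continuous_on_subset[OF ct[OF that(2)] that(1)])
    then show ?thesis using that(3) by (auto intro!: continuous_intros simp: case_prod_beta')
  qed
  have "continuous_on {0..T} (\<lambda>t. integral (cbox 0 L) (\<lambda>s. of_real (\<phi> t s) * w t s))"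
    by (rule integral_continuous_on_param)
       (use cmul[OF _ _ w, of \<phi>] in \<open>auto simp: case_prod_beta'\<close>)
  from continuous_on_subset[OF this, of "{0..t}"]
  show "continuous_on {0..t} (\<lambda>t. integral {0..L} (\<lambda>s. of_real (\<phi> t s) * w t s))"
    using t by simp
  fix r assume "r \<in> {0<..<t} - S"
  then have r: "r \<in> {0<..<T} - S" using t by auto
  have "open ({0<..<T} - S)" using finite_imp_closed[OF S] by (intro open_Diff) auto
  then obtain e where e: "0 < e" "cball r e \<subseteq> {0<..<T} - S"
    using r open_contains_cball by metis
  \<comment> \<open>The Leibniz rule asks for a convex set of times on which the derivative of the
    integrand is continuous, hence a ball that avoids \<open>S\<close>.\<close>
  define U where "U = cball r e"
  have U: "U \<subseteq> {0<..<T} - S" "U \<subseteq> {0..T}" "r \<in> U" "convex U" using e by (auto simp: U_def)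
  have r0: "r \<in> {0..T}" using U by auto
  note wU = continuous_on_subset[OF w, of "U \<times> {0..L}"]
  note wtU = continuous_on_subset[OF wt, of "U \<times> {0..L}"]
  define fx where "fx t s = of_real (\<phi>t t s) * w t s + of_real (\<phi> t s) * wt t s" for t s
  have sub: "U \<times> {0..L} \<subseteq> {0..T} \<times> {0..L}" "U \<times> {0..L} \<subseteq> ({0<..<T} - S) \<times> {0..L}" using U by auto
  have fxc: "continuous_on (U \<times> {0..L}) (\<lambda>(t, s). fx t s)"
    unfolding fx_def using cmul[OF sub(1) _ wU[OF sub(1)], of \<phi>t] cmul[OF sub(1) _ wtU[OF sub(2)], of \<phi>]
    by (auto intro!: continuous_intros simp: case_prod_beta')
  have "((\<lambda>t. integral (cbox 0 L) (\<lambda>s. of_real (\<phi> t s) * w t s)) has_vector_derivative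
      integral (cbox 0 L) (fx r)) (at r within U)"
  proof (rule leibniz_rule_vector_derivative[OF _ _ _ U(3,4)])
    show "continuous_on (U \<times> cbox 0 L) (\<lambda>(t, s). fx t s)" using fxc by simp
    fix t assume t: "t \<in> U"
    then have t': "t \<in> {0..T}" "t \<in> {0<..<T} - S" using U by auto
    show "(\<lambda>s. of_real (\<phi> t s) * w t s) integrable_on cbox 0 L"
      using continuous_on_Times_section[OF ct[of \<phi>] t'(1)] continuous_on_Times_section[OF w t'(1)]
      by (intro integrable_continuous continuous_intros) auto
    fix s assume "s \<in> cbox 0 L"
    then have s: "s \<in> {0..L}" by simp
    have "((\<lambda>r. \<phi> r s) has_real_derivative \<phi>t t s) (at t within U)"
      using test_der(1)[OF t'(1) s] DERIV_subset U(2) by blast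
    then have "((\<lambda>r. complex_of_real (\<phi> r s)) has_vector_derivative of_real (\<phi>t t s)) (at t within U)"
      by (intro has_vector_derivative_of_real) (simp add: has_real_derivative_iff_has_vector_derivative)
    from has_vector_derivative_mult[OF this has_vector_derivative_at_within[OF der(1)[OF t'(2) s]]]
    show "((\<lambda>r. of_real (\<phi> r s) * w r s) has_vector_derivative fx t s) (at t within U)"
      by (simp add: fx_def add.commute)
  qed
  moreover have "at r within U = at r"
    using e by (intro at_within_interior) (simp add: U_def)
  ultimately have D: "((\<lambda>t. integral {0..L} (\<lambda>s. of_real (\<phi> t s) * w t s)) has_vector_derivative
      integral {0..L} (fx r)) (at r)"
    by simp
  \<comment> \<open>The boundary form of Green's formula. At \<open>L\<close> only the term with
    \<open>\<phi>s\<close> survives because \<open>\<phi>\<close> vanishes; at 0 both terms vanish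
    since \<open>w\<close> and \<open>\<phi>\<close> satisfy the same boundary condition.\<close>
  define h where "h s = of_real (\<phi> r s) * ws r s - of_real (\<phi>s r s) * w r s" for s
  have "((\<lambda>s. of_real (\<phi> r s) * wt r s - of_real (\<phi>ss r s) * w r s) has_integral h L - h 0) {0..L}"
  proof (rule fundamental_theorem_of_calculus)
    fix s assume s: "s \<in> {0..L}"
    have 1: "((\<lambda>s. complex_of_real (\<phi> r s)) has_vector_derivative of_real (\<phi>s r s)) (at s within {0..L})"
      using test_der(2)[OF r0 s] by (intro has_vector_derivative_of_real) (simp add: has_real_derivative_iff_has_vector_derivative)
    have 2: "((\<lambda>s. complex_of_real (\<phi>s r s)) has_vector_derivative of_real (\<phi>ss r s)) (at s within {0..L})"
      using test_der(3)[OF r0 s] by (intro has_vector_derivative_of_real) (simp add: has_real_derivative_iff_has_vector_derivative)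
    show "(h has_vector_derivative (of_real (\<phi> r s) * wt r s - of_real (\<phi>ss r s) * w r s)) (at s within {0..L})"
      using has_vector_derivative_diff[OF has_vector_derivative_mult[OF 1 der(3)[OF r s]]
          has_vector_derivative_mult[OF 2 der(2)[OF r s]]]
      by (simp add: h_def[abs_def])
  qed (use L in simp)
  moreover have "h L = - (of_real (\<phi>s r L) * w r L)" using test_bc(2)[OF r0] by (simp add: h_def)
  moreover have "h 0 = 0" using test_bc(1)[OF r0] bc[OF r] by (cases B) (auto simp: h_def)
  moreover have "((\<lambda>s. of_real (\<phi>t r s + \<phi>ss r s) * w r s) has_integral
      integral {0..L} (\<lambda>s. of_real (\<phi>t r s + \<phi>ss r s) * w r s)) {0..L}"
    using continuous_on_Times_section[OF ct[of \<phi>t] r0] continuous_on_Times_section[OF ct[of \<phi>ss] r0]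
      continuous_on_Times_section[OF w r0]
    by (intro integrable_integral integrable_continuous_interval continuous_intros) auto
  ultimately have "((\<lambda>s. (of_real (\<phi>t r s + \<phi>ss r s) * w r s) + (of_real (\<phi> r s) * wt r s - of_real (\<phi>ss r s) * w r s)) has_integral
      integral {0..L} (\<lambda>s. of_real (\<phi>t r s + \<phi>ss r s) * w r s) + (- (of_real (\<phi>s r L) * w r L))) {0..L}"
    by (intro has_integral_add) simp_all
  then have "(fx r has_integral
      integral {0..L} (\<lambda>s. of_real (\<phi>t r s + \<phi>ss r s) * w r s) - of_real (\<phi>s r L) * w r L) {0..L}"
    by (simp add: fx_def[abs_def] algebra_simps)
  with D show "((\<lambda>t. integral {0..L} (\<lambda>s. of_real (\<phi> t s) * w t s)) has_vector_derivative
      integral {0..L} (\<lambda>s. of_real (\<phi>t r s + \<phi>ss r s) * w r s) - of_real (\<phi>s r L) * w r L) (at r)"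
    by (simp add: integral_unique)
qed

section \<open>Orthogonality of the eigenfunctions\<close>

abbreviation (input) ivl :: "real \<Rightarrow> real measure" where
  "ivl L \<equiv> lebesgue_on {0<..<L}"

definition L2_sq :: "real \<Rightarrow> (real \<Rightarrow> complex) \<Rightarrow> real" where
  "L2_sq L f = (LINT s|ivl L. (cmod (f s))\<^sup>2)"

lemma L2_norm_on_eq: "L2_norm_on 0 L f = sqrt (L2_sq L f)"
  by (simp add: L2_norm_on_def L2_sq_def)

lemma L2_sq_nonneg [simp]: "0 \<le> L2_sq L f"
  by (simp add: L2_sq_def)

lemma finite_measure_ivl: "finite_measure (ivl L)"
  by (rule finite_measure_lebesgue_on) simp

lemma measure_ivl: "0 \<le> L \<Longrightarrow> measure (ivl L) (space (ivl L)) = L"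
  by (simp add: measure_restrict_space)

lemma measurable_ivl:
  fixes f :: "real \<Rightarrow> 'a::euclidean_space"
  shows "continuous_on {0..L} f \<Longrightarrow> f \<in> borel_measurable (ivl L)"
  by (rule continuous_imp_measurable_on_sets_lebesgue) (auto intro: continuous_on_subset)

lemma integrable_ivl_bounded:
  fixes f :: "real \<Rightarrow> 'a::euclidean_space"
  assumes "f \<in> borel_measurable (ivl L)" "\<And>s. s \<in> {0<..<L} \<Longrightarrow> norm (f s) \<le> C"
  shows "integrable (ivl L) f"
  by (rule finite_measure.integrable_const_bound[OF finite_measure_ivl, where B = C])
     (use assms in \<open>auto intro!: AE_I2\<close>)

lemma continuous_on_ivl_bounded:
  fixes f :: "real \<Rightarrow> 'a::euclidean_space"
  assumes "continuous_on {0..L} f"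
  obtains C where "0 \<le> C" "\<And>s. s \<in> {0..L} \<Longrightarrow> norm (f s) \<le> C"
proof -
  have "bounded (f ` {0..L})"
    using assms by (intro compact_imp_bounded compact_continuous_image) auto
  then obtain C where C: "\<And>s. s \<in> {0..L} \<Longrightarrow> norm (f s) \<le> C"
    unfolding bounded_iff by (metis imageI)
  show ?thesis
    by (rule that[of "max C 0"]) (use C in \<open>auto simp: le_max_iff_disj\<close>)
qed

lemma integrable_ivl:
  fixes f :: "real \<Rightarrow> 'a::euclidean_space"
  assumes "continuous_on {0..L} f"
  shows "integrable (ivl L) f"
proof -
  obtain C where "\<And>s. s \<in> {0..L} \<Longrightarrow> norm (f s) \<le> C"
    using continuous_on_ivl_bounded[OF assms] by blast
  then show ?thesis
    by (intro integrable_ivl_bounded[where C = C] measurable_ivl assms) auto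
qed

lemma LINT_ivl_eq_integral:
  fixes f :: "real \<Rightarrow> 'a::euclidean_space"
  assumes "integrable (ivl L) f"
  shows "(LINT s|ivl L. f s) = integral {0..L} f"
  using lebesgue_integral_eq_integral[OF assms] integral_open_interval_real[of 0 L f] by simp

lemma L2_on_continuous: "continuous_on {0..L} f \<Longrightarrow> L2_on 0 L f"
  unfolding L2_on_def by (intro conjI measurable_ivl integrable_ivl continuous_intros)

lemma L2_on_bounded:
  assumes "f \<in> borel_measurable (ivl L)" "\<And>s. s \<in> {0<..<L} \<Longrightarrow> cmod (f s) \<le> C"
  shows "L2_on 0 L f"
  unfolding L2_on_def using assms
  by (intro conjI integrable_ivl_bounded[where C = "C\<^sup>2"]) (auto intro!: power_mono)

lemma cmod_add_sq_le: "(cmod (z + w))\<^sup>2 \<le> 2 * (cmod z)\<^sup>2 + 2 * (cmod w)\<^sup>2"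
proof -
  have "(cmod (z + w))\<^sup>2 \<le> (cmod z + cmod w)\<^sup>2"
    by (intro power_mono norm_triangle_ineq) auto
  also have "\<dots> \<le> 2 * (cmod z)\<^sup>2 + 2 * (cmod w)\<^sup>2"
    using sum_squares_bound[of "cmod z" "cmod w"] by (simp add: power2_sum)
  finally show ?thesis .
qed

text \<open>For squared norms a triangle inequality with factor 2 takes the place of Minkowski's;
  the error estimates below tolerate such factors.\<close>

lemma
  assumes "L2_on 0 L f" "L2_on 0 L g"
  shows L2_on_add: "L2_on 0 L (\<lambda>s. f s + g s)"
    and L2_sq_add: "L2_sq L (\<lambda>s. f s + g s) \<le> 2 * L2_sq L f + 2 * L2_sq L g"
proof -
  have m: "f \<in> borel_measurable (ivl L)" "g \<in> borel_measurable (ivl L)"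
    and i: "integrable (ivl L) (\<lambda>s. (cmod (f s))\<^sup>2)" "integrable (ivl L) (\<lambda>s. (cmod (g s))\<^sup>2)"
    using assms by (auto simp: L2_on_def)
  have i2: "integrable (ivl L) (\<lambda>s. 2 * (cmod (f s))\<^sup>2 + 2 * (cmod (g s))\<^sup>2)"
    using i by auto
  have i3: "integrable (ivl L) (\<lambda>s. (cmod (f s + g s))\<^sup>2)"
    by (rule Bochner_Integration.integrable_bound[OF i2]) (use m cmod_add_sq_le in auto)
  then show "L2_on 0 L (\<lambda>s. f s + g s)" using m by (auto simp: L2_on_def)
  have "L2_sq L (\<lambda>s. f s + g s) \<le> (LINT s|ivl L. 2 * (cmod (f s))\<^sup>2 + 2 * (cmod (g s))\<^sup>2)"
    unfolding L2_sq_def by (intro integral_mono i2 i3 cmod_add_sq_le)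
  also have "\<dots> = 2 * L2_sq L f + 2 * L2_sq L g" using i by (simp add: L2_sq_def)
  finally show "L2_sq L (\<lambda>s. f s + g s) \<le> 2 * L2_sq L f + 2 * L2_sq L g" .
qed

lemma L2_on_mult_bounded:
  assumes "L2_on 0 L f" "h \<in> borel_measurable (ivl L)" "\<And>s. s \<in> {0<..<L} \<Longrightarrow> cmod (h s) \<le> C"
  shows "L2_on 0 L (\<lambda>s. h s * f s)"
proof -
  have i: "integrable (ivl L) (\<lambda>s. C\<^sup>2 * (cmod (f s))\<^sup>2)" using assms(1) by (auto simp: L2_on_def)
  have "integrable (ivl L) (\<lambda>s. (cmod (h s * f s))\<^sup>2)"
  proof (rule Bochner_Integration.integrable_bound[OF i])
    show "AE s in ivl L. norm ((cmod (h s * f s))\<^sup>2) \<le> norm (C\<^sup>2 * (cmod (f s))\<^sup>2)"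
      using assms(3) by (auto simp: norm_mult power_mult_distrib intro!: AE_I2 mult_right_mono power_mono)
  qed (use assms in \<open>auto simp: L2_on_def\<close>)
  then show ?thesis using assms by (auto simp: L2_on_def)
qed

lemma L2_on_cmult: "L2_on 0 L f \<Longrightarrow> L2_on 0 L (\<lambda>s. c * f s)"
  by (rule L2_on_mult_bounded[where h = "\<lambda>_. c" and C = "cmod c"]) auto

lemma L2_on_uminus: "L2_on 0 L f \<Longrightarrow> L2_on 0 L (\<lambda>s. - f s)"
  using L2_on_cmult[of L f "-1"] by simp

lemma L2_on_diff: "L2_on 0 L f \<Longrightarrow> L2_on 0 L g \<Longrightarrow> L2_on 0 L (\<lambda>s. f s - g s)"
  using L2_on_add[OF _ L2_on_uminus, of L f g] by simp

lemma L2_sq_diff_commute: "L2_sq L (\<lambda>s. f s - g s) = L2_sq L (\<lambda>s. g s - f s)"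
  by (simp add: L2_sq_def norm_minus_commute)

lemma L2_sq_diff_le:
  assumes "L2_on 0 L f" "L2_on 0 L g" "L2_on 0 L h"
  shows "L2_sq L (\<lambda>s. f s - h s) \<le> 2 * L2_sq L (\<lambda>s. f s - g s) + 2 * L2_sq L (\<lambda>s. g s - h s)"
  using L2_sq_add[OF L2_on_diff[OF assms(1,2)] L2_on_diff[OF assms(2,3)]] by simp

lemma L2_on_integrable:
  assumes "L2_on 0 L f"
  shows "integrable (ivl L) f"
proof (rule Bochner_Integration.integrable_bound)
  show "integrable (ivl L) (\<lambda>s. 1 + (cmod (f s))\<^sup>2)"
    using assms integrable_ivl[of L "\<lambda>s. 1 :: real"] by (auto simp: L2_on_def)
  have "x \<le> 1 + x\<^sup>2" for x :: real
    using sum_squares_bound[of 1 x] by (simp add: power2_eq_square) (smt (verit) mult_nonneg_nonneg zero_le_square)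
  then show "AE s in ivl L. norm (f s) \<le> norm (1 + (cmod (f s))\<^sup>2)"
    by (intro AE_I2) (simp add: abs_of_nonneg add_nonneg_nonneg)
qed (use assms in \<open>auto simp: L2_on_def\<close>)

text \<open>The variance of |f| about its mean \<open>m\<close> is nonnegative. Pairing with the
  constant 1 is sufficient, because all other factors are bounded, as in
  \<open>LINT_mult_bound\<close>.\<close>

lemma L2_cauchy_schwarz:
  assumes f: "L2_on 0 L f" and L: "0 < L"
  shows "(LINT s|ivl L. cmod (f s)) \<le> sqrt (L * L2_sq L f)"
proof -
  have i: "integrable (ivl L) (\<lambda>s. cmod (f s))" "integrable (ivl L) (\<lambda>s. (cmod (f s))\<^sup>2)"
    using L2_on_integrable[OF f] f by (auto simp: L2_on_def)
  define A where "A = (LINT s|ivl L. cmod (f s))"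
  define m where "m = A / L"
  have "0 \<le> (LINT s|ivl L. (cmod (f s) - m)\<^sup>2)" by simp
  also have "\<dots> = (LINT s|ivl L. (cmod (f s))\<^sup>2 - 2 * m * cmod (f s) + m\<^sup>2)"
    by (intro Bochner_Integration.integral_cong) (auto simp: power2_diff)
  also have "\<dots> = L2_sq L f - 2 * m * A + m\<^sup>2 * L"
    using i L measure_ivl[of L] integrable_ivl[of L "\<lambda>s. m\<^sup>2"]
    by (simp add: L2_sq_def A_def mult.commute)
  also have "\<dots> = L2_sq L f - A\<^sup>2 / L"
    using L by (simp add: m_def power2_eq_square field_simps)
  finally have "A\<^sup>2 \<le> L * L2_sq L f" using L by (simp add: field_simps)
  then show ?thesis by (simp add: A_def[symmetric] real_le_rsqrt)
qed

lemma LINT_mult_bound: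
  assumes f: "L2_on 0 L f" and L: "0 < L" and h: "h \<in> borel_measurable (ivl L)"
    and C: "\<And>s. s \<in> {0<..<L} \<Longrightarrow> cmod (h s) \<le> C" "0 \<le> C"
  shows "cmod (LINT s|ivl L. h s * f s) \<le> C * sqrt (L * L2_sq L f)"
proof -
  have "integrable (ivl L) (\<lambda>s. h s * f s)"
    by (intro L2_on_integrable L2_on_mult_bounded[OF f h C(1)])
  from integrable_norm[OF this]
  have "cmod (LINT s|ivl L. h s * f s) \<le> (LINT s|ivl L. C * cmod (f s))"
    using C L2_on_integrable[OF f]
    by (intro order_trans[OF integral_norm_bound] integral_mono) (auto simp: norm_mult intro!: mult_right_mono)
  also have "\<dots> \<le> C * sqrt (L * L2_sq L f)"
    using L2_cauchy_schwarz[OF f L] C(2) by (simp add: mult_left_mono)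
  finally show ?thesis .
qed

section \<open>Eigenfunctions, orthogonality and Fourier coefficients\<close>

definition freq :: "boundary_op \<Rightarrow> real \<Rightarrow> nat \<Rightarrow> real" where
  "freq B L n = (case B of Dirichlet \<Rightarrow> real n + 1 | Neumann \<Rightarrow> real n + 1 / 2) * pi / L"

abbreviation eigf :: "boundary_op \<Rightarrow> real \<Rightarrow> nat \<Rightarrow> real \<Rightarrow> real" where
  "eigf B L n \<equiv> eig B (freq B L n)"

text \<open>The frequencies are those for which the eigenfunction vanishes at \<open>L\<close> as
  well, and \<open>2 / L\<close> is the inverse of the squared norm common to all
  eigenfunctions.\<close>

definition coeff :: "boundary_op \<Rightarrow> real \<Rightarrow> (real \<Rightarrow> complex) \<Rightarrow> nat \<Rightarrow> complex" where
  "coeff B L f n = of_real (2 / L) * (LINT s|ivl L. of_real (eigf B L n s) * f s)"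

lemma continuous_on_eig: "continuous_on A (eig B \<mu>)"
  by (cases B) (auto simp: eig_def[abs_def] intro!: continuous_intros)

lemma eigf_at_end: "0 < L \<Longrightarrow> eigf B L n L = 0"
proof (cases B)
  case Dirichlet
  assume "0 < L"
  then show ?thesis using Dirichlet sin_npi[of "Suc n"] by (simp add: eig_def freq_def add.commute)
next
  case Neumann
  assume "0 < L"
  moreover have "cos ((real n + 1 / 2) * pi) = 0"
    by (simp add: distrib_right cos_add)
  ultimately show ?thesis using Neumann by (simp add: eig_def freq_def)
qed

lemma integral_cos_pi:
  assumes "0 < L"
  shows "integral {0..L} (\<lambda>s. cos (of_int k * pi / L * s)) = (if k = 0 then L else 0)"
proof (cases "k = 0")
  case False
  define c where "c = of_int k * pi / L"
  have c: "c \<noteq> 0" using False assms by (simp add: c_def)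
  have "((\<lambda>s. cos (c * s)) has_integral sin (c * L) / c - sin (c * 0) / c) {0..L}"
    using assms c
    by (intro fundamental_theorem_of_calculus)
       (auto intro!: derivative_eq_intros simp: has_real_derivative_iff_has_vector_derivative[symmetric])
  moreover have "sin (c * L) = 0" using assms sin_npi_int by (simp add: c_def mult.commute)
  ultimately show ?thesis using False by (simp add: c_def integral_unique)
qed (use assms in simp)

lemma eigf_orthogonal:
  assumes "0 < L"
  shows "(LINT s|ivl L. eigf B L n s * eigf B L m s) = (if n = m then L / 2 else 0)"
proof -
  define d :: real where "d = (case B of Dirichlet \<Rightarrow> -1 | Neumann \<Rightarrow> 1)"
  define j :: int where "j = int n - int m"
  \<comment> \<open>The offset is twice the shift 1 or 1/2 in \<open>freq\<close>. As
    \<open>k\<close> is positive, its integral vanishes and only \<open>j = 0\<close> can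
    contribute.\<close>
  define k :: int where "k = int n + int m + (case B of Dirichlet \<Rightarrow> 2 | Neumann \<Rightarrow> 1)"
  have eq: "eigf B L n s * eigf B L m s = (cos (of_int j * pi / L * s) + d * cos (of_int k * pi / L * s)) / 2" for s
  proof -
    have "freq B L n * s - freq B L m * s = of_int j * pi / L * s"
      "freq B L n * s + freq B L m * s = of_int k * pi / L * s"
      by (cases B; simp add: freq_def j_def k_def ring_distribs add_divide_distrib diff_divide_distrib)+
    then show ?thesis
      by (cases B) (simp_all add: eig_def d_def sin_times_sin cos_times_cos)
  qed
  have "(LINT s|ivl L. eigf B L n s * eigf B L m s) = integral {0..L} (\<lambda>s. eigf B L n s * eigf B L m s)"
    by (intro LINT_ivl_eq_integral integrable_ivl continuous_intros continuous_on_eig)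
  also have "\<dots> = (integral {0..L} (\<lambda>s. cos (of_int j * pi / L * s))
      + d * integral {0..L} (\<lambda>s. cos (of_int k * pi / L * s))) / 2"
    unfolding eq using assms
    by (subst integral_divide, subst integral_add)
       (auto intro!: integrable_continuous_interval continuous_intros)
  also have "\<dots> = (if n = m then L / 2 else 0)"
    unfolding integral_cos_pi[OF assms] using assms by (cases B) (auto simp: j_def k_def)
  finally show ?thesis .
qed

lemma L2_on_eigf_sum: "L2_on 0 L (\<lambda>s. \<Sum>n<N. c n * of_real (eigf B L n s))"
  by (intro L2_on_continuous continuous_intros continuous_on_eig)

lemma integrable_eigf_mult:
  "L2_on 0 L f \<Longrightarrow> integrable (ivl L) (\<lambda>s. of_real (eigf B L n s) * f s)"
  by (intro L2_on_integrable L2_on_mult_bounded[where C = 1])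
     (auto intro!: measurable_ivl continuous_intros continuous_on_eig simp: abs_eig_le_1)

lemma coeff_diff_sum:
  assumes f: "L2_on 0 L f" and L: "0 < L" and N: "N \<le> m"
  shows "coeff B L (\<lambda>s. f s - (\<Sum>n<N. c n * of_real (eigf B L n s))) m = coeff B L f m"
proof -
  have i: "integrable (ivl L) (\<lambda>s. complex_of_real (eigf B L m s) * (c n * of_real (eigf B L n s)))" for n
    by (intro integrable_eigf_mult L2_on_cmult L2_on_continuous continuous_intros continuous_on_eig)
  have "(LINT s|ivl L. of_real (eigf B L m s) * (f s - (\<Sum>n<N. c n * of_real (eigf B L n s))))
      = (LINT s|ivl L. of_real (eigf B L m s) * f s)
        - (\<Sum>n<N. LINT s|ivl L. of_real (eigf B L m s) * (c n * of_real (eigf B L n s)))"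
    using i integrable_eigf_mult[OF f] by (simp add: right_diff_distrib sum_distrib_left)
  also have "(\<Sum>n<N. LINT s|ivl L. of_real (eigf B L m s) * (c n * of_real (eigf B L n s))) = 0"
  proof (rule sum.neutral, rule ballI)
    fix n assume "n \<in> {..<N}"
    have "(LINT s|ivl L. of_real (eigf B L m s) * (c n * of_real (eigf B L n s)))
        = (LINT s|ivl L. c n * complex_of_real (eigf B L m s * eigf B L n s))"
      by (simp add: mult_ac)
    also have "\<dots> = c n * of_real (LINT s|ivl L. eigf B L m s * eigf B L n s)"
      by (simp only: integral_mult_right_zero integral_complex_of_real)
    finally show "(LINT s|ivl L. of_real (eigf B L m s) * (c n * of_real (eigf B L n s))) = 0"
      using \<open>n \<in> {..<N}\<close> N by (simp add: eigf_orthogonal[OF L])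
  qed
  finally show ?thesis by (simp add: coeff_def)
qed

text \<open>Completing the square in each coefficient. With \<open>c\<close> the Fourier
  coefficients this is the error of the partial sum and Bessel's inequality, with arbitrary
  \<open>c\<close> the best approximation property, and with \<open>f = 0\<close> Parseval's
  identity for finite sums.\<close>

lemma L2_sq_diff_eigf_sum:
  assumes f: "L2_on 0 L f" and L: "0 < L"
  shows "L2_sq L (\<lambda>s. f s - (\<Sum>n<N. c n * of_real (eigf B L n s))) =
    L2_sq L f + L / 2 * (\<Sum>n<N. (cmod (c n - coeff B L f n))\<^sup>2 - (cmod (coeff B L f n))\<^sup>2)"
proof (induction N)
  case (Suc N)
  define r where "r s = f s - (\<Sum>n<N. c n * of_real (eigf B L n s))" for s
  define a where "a = coeff B L f N"
  have r: "L2_on 0 L r" unfolding r_def by (intro L2_on_diff f L2_on_eigf_sum)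
  \<comment> \<open>Removing the earlier modes does not change the coefficient of index
    \<open>N\<close>.\<close>
  have a: "(LINT s|ivl L. of_real (eigf B L N s) * r s) = of_real (L / 2) * a"
    using coeff_diff_sum[OF f L order.refl, where B = B and c = c] L by (simp add: a_def r_def[abs_def] coeff_def field_simps)
  have ir: "integrable (ivl L) (\<lambda>s. (cmod (r s))\<^sup>2)" using r by (simp add: L2_on_def)
  define z where "z s = cnj (c N) * (of_real (eigf B L N s) * r s)" for s
  have ie: "integrable (ivl L) z"
    unfolding z_def by (intro integrable_mult_right integrable_eigf_mult r)
  have iee: "integrable (ivl L) (\<lambda>s. eigf B L N s * eigf B L N s)"
    by (intro integrable_ivl continuous_intros continuous_on_eig)
  have pt: "(cmod (r s - c N * of_real (eigf B L N s)))\<^sup>2 =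
      (cmod (r s))\<^sup>2 - 2 * Re (z s)
      + (cmod (c N))\<^sup>2 * (eigf B L N s * eigf B L N s)" for s
    by (simp add: cmod_power2 z_def) (simp add: power2_eq_square algebra_simps)
  have "L2_sq L (\<lambda>s. f s - (\<Sum>n<Suc N. c n * of_real (eigf B L n s)))
      = L2_sq L (\<lambda>s. r s - c N * of_real (eigf B L N s))"
    by (simp add: r_def diff_diff_eq)
  also have "\<dots> = L2_sq L r - 2 * Re (LINT s|ivl L. z s)
      + (cmod (c N))\<^sup>2 * (LINT s|ivl L. eigf B L N s * eigf B L N s)"
    unfolding L2_sq_def pt using ir ie iee by simp
  also have "(LINT s|ivl L. z s) = cnj (c N) * (of_real (L / 2) * a)"
    unfolding a[symmetric] z_def by simp
  also have "L2_sq L r - 2 * Re (cnj (c N) * (of_real (L / 2) * a))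
      + (cmod (c N))\<^sup>2 * (LINT s|ivl L. eigf B L N s * eigf B L N s)
      = L2_sq L r + L / 2 * ((cmod (c N - a))\<^sup>2 - (cmod a)\<^sup>2)"
    unfolding eigf_orthogonal[OF L] by (simp add: cmod_power2) (simp add: power2_eq_square algebra_simps)
  finally show ?case using Suc by (simp add: r_def[abs_def] a_def algebra_simps)
qed simp

section \<open>Completeness of the eigenfunctions\<close>

definition eig_combination :: "boundary_op \<Rightarrow> real \<Rightarrow> (real \<Rightarrow> complex) \<Rightarrow> bool" where
  "eig_combination B L f \<longleftrightarrow> (\<exists>N c. f = (\<lambda>s. \<Sum>n<N. c n * of_real (eigf B L n s)))"

lemma eig_combination_scale: "eig_combination B L f \<Longrightarrow> eig_combination B L (\<lambda>s. a * f s)"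
proof -
  assume "eig_combination B L f"
  then obtain N c where "f = (\<lambda>s. \<Sum>n<N. c n * of_real (eigf B L n s))"
    by (auto simp: eig_combination_def)
  then have "(\<lambda>s. a * f s) = (\<lambda>s. \<Sum>n<N. (a * c n) * of_real (eigf B L n s))"
    by (simp add: sum_distrib_left mult.assoc)
  then show ?thesis unfolding eig_combination_def by (intro exI)
qed

lemma eig_combination_add:
  assumes "eig_combination B L f" "eig_combination B L g"
  shows "eig_combination B L (\<lambda>s. f s + g s)"
proof -
  obtain N c where f: "f = (\<lambda>s. \<Sum>n<N. c n * of_real (eigf B L n s))"
    using assms by (auto simp: eig_combination_def)
  obtain M d where g: "g = (\<lambda>s. \<Sum>n<M. d n * of_real (eigf B L n s))"
    using assms by (auto simp: eig_combination_def)
  define K where "K = max N M"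
  have f': "f s = (\<Sum>n<K. (if n < N then c n else 0) * of_real (eigf B L n s))" for s
    unfolding f K_def by (rule sum.mono_neutral_cong_left) auto
  have g': "g s = (\<Sum>n<K. (if n < M then d n else 0) * of_real (eigf B L n s))" for s
    unfolding g K_def by (rule sum.mono_neutral_cong_left) auto
  have "(\<lambda>s. f s + g s) = (\<lambda>s. \<Sum>n<K. ((if n < N then c n else 0) + (if n < M then d n else 0)) * of_real (eigf B L n s))"
    by (simp only: f' g' sum.distrib[symmetric] distrib_right)
  then show ?thesis unfolding eig_combination_def by (intro exI)
qed

lemma eig_combination_0: "eig_combination B L (\<lambda>s. 0)"
  unfolding eig_combination_def by (intro exI[of _ 0] exI) simp

lemma eig_combination_eigf: "eig_combination B L (\<lambda>s. of_real (eigf B L n s))"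
proof -
  have "(\<lambda>s. complex_of_real (eigf B L n s)) = (\<lambda>s. \<Sum>k<Suc n. (if k = n then 1 else 0) * of_real (eigf B L k s))"
    by (auto simp: if_distrib[of "\<lambda>x. x * _"] sum.delta cong: if_cong)
  then show ?thesis unfolding eig_combination_def by (intro exI)
qed

lemma eig_combination_mult_cos:
  assumes "eig_combination B L f"
  shows "eig_combination B L (\<lambda>s. f s * of_real (cos (pi / L * s)))"
proof -
  obtain N c where f: "f = (\<lambda>s. \<Sum>n<N. c n * of_real (eigf B L n s))"
    using assms by (auto simp: eig_combination_def)
  \<comment> \<open>The lower neighbour in the product formula. At \<open>n = 0\<close> it is sin 0
    = 0 for Dirichlet, while for Neumann evenness of the cosine gives the first eigenfunction
    back.\<close>
  define e where "e n s = (case n of 0 \<Rightarrow> (case B of Dirichlet \<Rightarrow> 0 | Neumann \<Rightarrow> eigf B L 0 s)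
      | Suc m \<Rightarrow> eigf B L m s)" for n s
  have prod: "eigf B L n s * cos (pi / L * s) = (eigf B L (Suc n) s + e n s) / 2" for n s
  proof -
    have 1: "freq A L n * s + pi / L * s = freq A L (Suc n) * s" for A n
      by (cases A; simp add: freq_def ring_distribs add_divide_distrib)
    have 2: "freq A L (Suc m) * s - pi / L * s = freq A L m * s" for A m
      by (cases A; simp add: freq_def ring_distribs add_divide_distrib)
    have 3: "freq Dirichlet L 0 * s - pi / L * s = 0" "freq Neumann L 0 * s - pi / L * s = - (freq Neumann L 0 * s)"
      by (simp_all add: freq_def)
    show ?thesis
      by (cases n; cases B) (simp_all only: eig_def boundary_op.case sin_times_cos cos_times_cos 1 2 3 e_def nat.case minus_zero cos_minus  sin_minus cos_zero sin_zero,
        simp_all only: add.commute)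
  qed
  have e: "eig_combination B L (\<lambda>s. of_real (e n s))" for n
    by (cases n; cases B) (auto simp: e_def eig_combination_0 eig_combination_eigf)
  have 1: "eig_combination B L (\<lambda>s. of_real (eigf B L n s) * of_real (cos (pi / L * s)))" for n
  proof -
    have "(\<lambda>s. of_real (eigf B L n s) * of_real (cos (pi / L * s))) =
        (\<lambda>s. (1 / 2) * (complex_of_real (eigf B L (Suc n) s) + of_real (e n s)))"
      unfolding of_real_mult[symmetric] prod by simp
    then show ?thesis
      by (simp only: eig_combination_scale eig_combination_add eig_combination_eigf e)
  qed
  have "eig_combination B L (\<lambda>s. \<Sum>n<N. c n * (of_real (eigf B L n s) * of_real (cos (pi / L * s))))"
  proof (induction N)
    case (Suc N)
    from eig_combination_add[OF this eig_combination_scale[OF 1]] show ?case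
      by (simp only: sum.lessThan_Suc)
  qed (simp add: eig_combination_0)
  then show ?thesis unfolding f by (simp add: sum_distrib_right mult.assoc)
qed

lemma eig_combination_mult_real_polynomial:
  assumes "real_polynomial_function p" "eig_combination B L f"
  shows "eig_combination B L (\<lambda>s. f s * of_real (p (cos (pi / L * s))))"
  using assms
proof (induction p arbitrary: f rule: real_polynomial_function.induct)
  case (linear p)
  interpret bounded_linear p by fact
  have p: "p x = p 1 * x" for x using scale[of x 1] by simp
  have "(\<lambda>s. f s * of_real (p (cos (pi / L * s)))) = (\<lambda>s. of_real (p 1) * (f s * of_real (cos (pi / L * s))))"
    unfolding p[of "cos _"] by (simp add: mult_ac)
  then show ?case
    using eig_combination_scale[OF eig_combination_mult_cos[OF linear.prems], of "of_real (p 1)"] by simp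
next
  case (const c)
  then show ?case using eig_combination_scale[of B L f "of_real c"] by (simp add: mult.commute)
next
  case (add p q)
  from eig_combination_add[OF add.IH(1)[OF add.prems] add.IH(2)[OF add.prems]]
  show ?case by (simp add: distrib_left)
next
  case (mult p q)
  then have "eig_combination B L (\<lambda>s. (f s * of_real (p (cos (pi / L * s)))) * of_real (q (cos (pi / L * s))))"
    by blast
  then show ?case by (simp add: mult.assoc)
qed

lemma eig_combination_mult_polynomial:
  fixes g :: "real \<Rightarrow> complex"
  assumes "polynomial_function g" "eig_combination B L f"
  shows "eig_combination B L (\<lambda>s. f s * g (cos (pi / L * s)))"
proof -
  have rp: "real_polynomial_function (\<lambda>x. Re (g x))" "real_polynomial_function (\<lambda>x. Im (g x))"
    using assms(1) bounded_linear_Re bounded_linear_Im by (auto simp: polynomial_function_def o_def)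
  have "eig_combination B L (\<lambda>s. f s * of_real (Re (g (cos (pi / L * s))))
      + \<i> * (f s * of_real (Im (g (cos (pi / L * s))))))"
    by (intro eig_combination_add eig_combination_scale
        eig_combination_mult_real_polynomial[OF rp(1) assms(2)]
        eig_combination_mult_real_polynomial[OF rp(2) assms(2)])
  moreover have "f s * of_real (Re z) + \<i> * (f s * of_real (Im z)) = f s * z" for s z
    by (subst (3) complex_eq) (simp add: algebra_simps)
  ultimately show ?thesis by simp
qed

lemma eigf_0_pos: "0 < s \<Longrightarrow> s < L \<Longrightarrow> 0 < eigf B L 0 s"
proof -
  assume s: "0 < s" "s < L"
  then have "0 < pi * s / L" "pi * s / L < pi" by (auto simp: field_simps)
  then show ?thesis
    by (cases B) (auto simp: eig_def freq_def intro!: sin_gt_zero cos_gt_zero_pi)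
qed

text \<open>
  Every eigenfunction is the first one times a polynomial in \<open>cos (\<pi>s/L)\<close>, so that the Weierstrass
  theorem applies to functions divisible by the first eigenfunction.
\<close>
lemma weighted_continuous_approx:
  fixes k :: "real \<Rightarrow> complex"
  assumes L: "0 < L" and k: "continuous_on UNIV k" and e: "0 < e"
  obtains q where "eig_combination B L q"
    "\<And>s. s \<in> {0..L} \<Longrightarrow> cmod (of_real (eigf B L 0 s) * k s - q s) \<le> e"
proof -
  \<comment> \<open>The substitution y = cos(\<pi>s/L) is injective on [0,L], so any continuous
    function of \<open>s\<close> becomes one of y on [-1,1].\<close>
  define K where "K y = k (L / pi * arccos y)" for y
  have "continuous_on {-1..1} K"
    unfolding K_def by (intro continuous_on_compose2[OF k] continuous_intros) auto
  then obtain g where g: "polynomial_function g" "\<And>y. y \<in> {-1..1} \<Longrightarrow> cmod (K y - g y) < e"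
    using Stone_Weierstrass_polynomial_function[of "{-1..1}" K e] e by auto
  show ?thesis
  proof (rule that)
    show "eig_combination B L (\<lambda>s. of_real (eigf B L 0 s) * g (cos (pi / L * s)))"
      by (intro eig_combination_mult_polynomial g eig_combination_eigf)
    fix s assume s: "s \<in> {0..L}"
    have "0 \<le> pi / L * s" "pi / L * s \<le> pi" using s L by (auto simp: field_simps)
    then have "K (cos (pi / L * s)) = k s" using L by (simp add: K_def arccos_cos)
    then have "cmod (k s - g (cos (pi / L * s))) < e" using g(2)[of "cos (pi / L * s)"] by simp
    then have "\<bar>eigf B L 0 s\<bar> * cmod (k s - g (cos (pi / L * s))) \<le> 1 * e"
      using abs_eig_le_1[of B "freq B L 0" s] e by (intro mult_mono) auto
    then show "cmod (of_real (eigf B L 0 s) * k s - of_real (eigf B L 0 s) * g (cos (pi / L * s))) \<le> e"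
      by (simp add: norm_mult flip: right_diff_distrib)
  qed
qed

lemma L2_sq_tendsto_0_dominated:
  assumes f: "L2_on 0 L f" and h: "\<And>n. h n \<in> borel_measurable (ivl L)"
    and lim: "AE s in ivl L. (\<lambda>n. h n s) \<longlonglongrightarrow> f s"
    and w: "integrable (ivl L) w" and bd: "\<And>n s. s \<in> {0<..<L} \<Longrightarrow> (cmod (f s - h n s))\<^sup>2 \<le> w s"
  shows "(\<lambda>n. L2_sq L (\<lambda>s. f s - h n s)) \<longlonglongrightarrow> 0"
proof -
  have "(\<lambda>n. LINT s|ivl L. (cmod (f s - h n s))\<^sup>2) \<longlonglongrightarrow> (LINT s|ivl L. 0)"
  proof (rule integral_dominated_convergence[where w = w])
    show "AE s in ivl L. (\<lambda>n. (cmod (f s - h n s))\<^sup>2) \<longlonglongrightarrow> 0"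
      using lim
    proof eventually_elim
      case (elim s)
      then have "(\<lambda>n. (cmod (f s - h n s))\<^sup>2) \<longlonglongrightarrow> (cmod (f s - f s))\<^sup>2"
        by (intro tendsto_intros)
      then show ?case by simp
    qed
  qed (use f h w bd in \<open>auto simp: L2_on_def intro!: AE_I2\<close>)
  then show ?thesis by (simp add: L2_sq_def)
qed

text \<open>Almost everywhere \<open>f\<close> is a limit of continuous functions. These are made
  bounded and divisible by the first eigenfunction, so that dominated convergence and
  \<open>weighted_continuous_approx\<close> apply.\<close>

lemma eig_combination_dense_bounded:
  assumes L: "0 < L" and f: "f \<in> borel_measurable (ivl L)" and M: "\<And>s. s \<in> {0<..<L} \<Longrightarrow> cmod (f s) \<le> M"
    and e: "0 < e"
  obtains q where "eig_combination B L q" "L2_sq L (\<lambda>s. f s - q s) < e"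
proof -
  have M0: "0 \<le> M" using M[of "L / 2"] L order_trans[OF norm_ge_zero] by auto
  have fL2: "L2_on 0 L f" using L2_on_bounded[OF f M] .
  have "f measurable_on {0<..<L}" using f by (simp add: measurable_on_iff_borel_measurable)
  then obtain N g where N: "negligible N" and g: "\<And>n. continuous_on UNIV (g n)"
    "\<And>x. x \<notin> N \<Longrightarrow> (\<lambda>n. g n x) \<longlonglongrightarrow> (if x \<in> {0<..<L} then f x else 0)"
    unfolding measurable_on_def by blast
  \<comment> \<open>The approximants \<open>g n\<close> have no common bound; projection onto the
    ball of radius \<open>M\<close> supplies one and leaves the limit \<open>f\<close>
    unchanged.\<close>
  define clip where "clip = closest_point (cball (0::complex) M)"
  have clip: "continuous_on A clip" "cmod (clip z) \<le> M" "cmod z \<le> M \<Longrightarrow> clip z = z" for A z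
    using M0 closest_point_in_set[of "cball (0::complex) M" z] closest_point_self[of z "cball 0 M"]
    by (auto simp: clip_def intro!: continuous_on_closest_point)
  \<comment> \<open>A regularised reciprocal of the first eigenfunction, which may vanish at the
    ends. Its product with the eigenfunction lies in [0,1] and tends to 1 where the eigenfunction is
    positive.\<close>
  define \<eta> where "\<eta> n s = eigf B L 0 s / ((eigf B L 0 s)\<^sup>2 + 1 / real (Suc n))" for n s
  have den: "0 < (eigf B L 0 s)\<^sup>2 + 1 / real (Suc n)" for n s
    by (intro add_nonneg_pos) auto
  define k where "k n s = of_real (\<eta> n s) * clip (g n s)" for n s
  have kc: "continuous_on UNIV (k n)" for n
    unfolding k_def \<eta>_def using den[of _ n]
    by (intro continuous_intros continuous_on_compose2[OF clip(1)[of UNIV] g(1)] continuous_on_eig)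
       (auto simp: less_imp_neq[symmetric])
  have w: "0 \<le> eigf B L 0 s * \<eta> n s" "eigf B L 0 s * \<eta> n s \<le> 1" for n s
    using den[of s n] by (auto simp: \<eta>_def power2_eq_square[symmetric])
  have hb: "cmod (of_real (eigf B L 0 s) * k n s) \<le> M" for n s
  proof -
    have "cmod (of_real (eigf B L 0 s) * k n s) = \<bar>eigf B L 0 s * \<eta> n s\<bar> * cmod (clip (g n s))"
      by (simp add: k_def norm_mult abs_mult)
    also have "\<dots> \<le> 1 * M" using w[of s n] clip(2) by (intro mult_mono) auto
    finally show ?thesis by simp
  qed
  have "(\<lambda>n. L2_sq L (\<lambda>s. f s - of_real (eigf B L 0 s) * k n s)) \<longlonglongrightarrow> 0"
  proof (rule L2_sq_tendsto_0_dominated[OF fL2, where w = "\<lambda>s. (2 * M)\<^sup>2"])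
    show "(\<lambda>s. of_real (eigf B L 0 s) * k n s) \<in> borel_measurable (ivl L)" for n
      by (intro measurable_ivl continuous_intros continuous_on_eig continuous_on_subset[OF kc]) auto
    show "integrable (ivl L) (\<lambda>s. (2 * M)\<^sup>2)" by (intro integrable_ivl continuous_intros)
    show "(cmod (f s - of_real (eigf B L 0 s) * k n s))\<^sup>2 \<le> (2 * M)\<^sup>2" if "s \<in> {0<..<L}" for n s
      using norm_triangle_ineq4[of "f s" "of_real (eigf B L 0 s) * k n s"] M[OF that] hb[of s n]
      by (intro power_mono) auto
    have "AE s in lebesgue. s \<notin> N" using N by (intro AE_not_in) (simp add: negligible_iff_null_sets)
    then show "AE s in ivl L. (\<lambda>n. of_real (eigf B L 0 s) * k n s) \<longlonglongrightarrow> f s"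
    proof (subst AE_restrict_space_iff, simp, eventually_elim, intro impI)
      fix s assume sN: "s \<notin> N" and s: "s \<in> {0<..<L}"
      have pos: "0 < eigf B L 0 s" using s by (intro eigf_0_pos) auto
      have "(\<lambda>n. g n s) \<longlonglongrightarrow> f s" using g(2)[OF sN] s by simp
      moreover have "isCont clip (f s)"
        using clip(1)[of UNIV] by (simp add: continuous_on_eq_continuous_at)
      ultimately have "(\<lambda>n. clip (g n s)) \<longlonglongrightarrow> clip (f s)" using isCont_tendsto_compose by blast
      then have c: "(\<lambda>n. clip (g n s)) \<longlonglongrightarrow> f s" using clip(3) M[OF s] by simp
      have "(\<lambda>n. eigf B L 0 s * (eigf B L 0 s / ((eigf B L 0 s)\<^sup>2 + 1 / real (Suc n))))
          \<longlonglongrightarrow> eigf B L 0 s * (eigf B L 0 s / ((eigf B L 0 s)\<^sup>2 + 0))"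
        using pos by (intro tendsto_intros LIMSEQ_Suc[OF lim_1_over_n]) auto
      then have "(\<lambda>n. eigf B L 0 s * \<eta> n s) \<longlonglongrightarrow> 1"
        using pos by (simp add: \<eta>_def power2_eq_square)
      from tendsto_mult[OF tendsto_of_real[OF this] c]
      show "(\<lambda>n. of_real (eigf B L 0 s) * k n s) \<longlonglongrightarrow> f s"
        by (simp add: k_def mult.assoc)
    qed
  qed
  then have "\<forall>\<^sub>F n in sequentially. L2_sq L (\<lambda>s. f s - of_real (eigf B L 0 s) * k n s) < e / 4"
    using e by (intro order_tendstoD(2)) auto
  then obtain n where n: "L2_sq L (\<lambda>s. f s - of_real (eigf B L 0 s) * k n s) < e / 4"
    by (auto simp: eventually_sequentially)
  \<comment> \<open>Chosen so that \<open>L * d\<^sup>2 = e / 4\<close>; the factors 2 of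
    \<open>L2_sq_diff_le\<close> then add up to \<open>e\<close>.\<close>
  define d where "d = sqrt (e / (4 * L))"
  have d: "0 < d" using e L by (simp add: d_def)
  obtain q where q: "eig_combination B L q"
    "\<And>s. s \<in> {0..L} \<Longrightarrow> cmod (of_real (eigf B L 0 s) * k n s - q s) \<le> d"
    using weighted_continuous_approx[OF L kc d, of B n] by blast
  have L2q: "L2_on 0 L q" using q(1) L2_on_eigf_sum by (auto simp: eig_combination_def)
  have L2k: "L2_on 0 L (\<lambda>s. of_real (eigf B L 0 s) * k n s)"
    by (intro L2_on_continuous continuous_intros continuous_on_eig continuous_on_subset[OF kc]) auto
  have "L2_sq L (\<lambda>s. of_real (eigf B L 0 s) * k n s - q s) \<le> (LINT s|ivl L. d\<^sup>2)"
    unfolding L2_sq_def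
  proof (rule integral_mono)
    show "integrable (ivl L) (\<lambda>s. (cmod (of_real (eigf B L 0 s) * k n s - q s))\<^sup>2)"
      using L2_on_diff[OF L2k L2q] by (simp add: L2_on_def)
  qed (use q(2) in \<open>auto intro!: power_mono integrable_ivl\<close>)
  also have "\<dots> = e / 4" using L e measure_ivl[of L] by (simp add: d_def)
  finally have "L2_sq L (\<lambda>s. f s - q s) < e"
    using L2_sq_diff_le[OF fL2 L2k L2q] n by simp
  then show ?thesis using q(1) that by blast
qed

text \<open>Replacing the values of modulus above \<open>n\<close> by 0 reduces this to the bounded
  case, with |f|^2 as dominating function.\<close>

lemma eig_combination_dense:
  assumes L: "0 < L" and f: "L2_on 0 L f" and e: "0 < e"
  obtains q where "eig_combination B L q" "L2_sq L (\<lambda>s. f s - q s) < e"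
proof -
  have fm: "f \<in> borel_measurable (ivl L)" using f by (simp add: L2_on_def)
  define h where "h n s = (if cmod (f s) \<le> real n then f s else 0)" for n s
  have hm: "h n \<in> borel_measurable (ivl L)" for n
    unfolding h_def using fm by measurable
  have "(\<lambda>n. L2_sq L (\<lambda>s. f s - h n s)) \<longlonglongrightarrow> 0"
  proof (rule L2_sq_tendsto_0_dominated[OF f hm, where w = "\<lambda>s. (cmod (f s))\<^sup>2"])
    show "AE s in ivl L. (\<lambda>n. h n s) \<longlonglongrightarrow> f s"
    proof (rule AE_I2)
      fix s
      obtain m where "cmod (f s) \<le> real m" using real_arch_simple by blast
      then have "\<forall>\<^sub>F n in sequentially. h n s = f s"
        unfolding eventually_sequentially by (intro exI[of _ m]) (auto simp: h_def)
      then show "(\<lambda>n. h n s) \<longlonglongrightarrow> f s" by (rule tendsto_eventually)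
    qed
  qed (use f in \<open>auto simp: L2_on_def h_def\<close>)
  then have "\<forall>\<^sub>F n in sequentially. L2_sq L (\<lambda>s. f s - h n s) < e / 4"
    using e by (intro order_tendstoD(2)) auto
  then obtain n where n: "L2_sq L (\<lambda>s. f s - h n s) < e / 4" by (auto simp: eventually_sequentially)
  have hb: "cmod (h n s) \<le> real n" for s by (simp add: h_def)
  obtain q where q: "eig_combination B L q" "L2_sq L (\<lambda>s. h n s - q s) < e / 4"
    using eig_combination_dense_bounded[OF L hm hb, of "e / 4" B] e by auto
  have "L2_on 0 L q" using q(1) L2_on_eigf_sum by (auto simp: eig_combination_def)
  from L2_sq_diff_le[OF f L2_on_bounded[OF hm hb] this] n q(2)
  have "L2_sq L (\<lambda>s. f s - q s) < e" by simp
  then show ?thesis using q(1) that by blast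
qed

text \<open>Partial sums are best approximations and their errors decrease in \<open>N\<close>, so
  one good combination of \<open>N\<close> eigenfunctions bounds the errors of all later partial
  sums.\<close>

lemma eigf_expansion:
  assumes L: "0 < L" and f: "L2_on 0 L f"
  shows "(\<lambda>N. L2_sq L (\<lambda>s. f s - (\<Sum>n<N. coeff B L f n * of_real (eigf B L n s)))) \<longlonglongrightarrow> 0"
proof (rule LIMSEQ_I)
  fix e :: real assume e: "0 < e"
  define R where "R N = L2_sq L (\<lambda>s. f s - (\<Sum>n<N. coeff B L f n * of_real (eigf B L n s)))" for N
  obtain q where q: "eig_combination B L q" "L2_sq L (\<lambda>s. f s - q s) < e"
    using eig_combination_dense[OF L f e] by blast
  obtain N c where c: "q = (\<lambda>s. \<Sum>n<N. c n * of_real (eigf B L n s))"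
    using q(1) by (auto simp: eig_combination_def)
  have R: "R m = L2_sq L f - L / 2 * (\<Sum>n<m. (cmod (coeff B L f n))\<^sup>2)" for m
    unfolding R_def L2_sq_diff_eigf_sum[OF f L] by (simp add: sum_negf)
  have "R m < e" if m: "N \<le> m" for m
  proof -
    have "R m \<le> R N"
      unfolding R using L m by (intro diff_left_mono mult_left_mono sum_mono2) auto
    also have "\<dots> \<le> L2_sq L (\<lambda>s. f s - q s)"
      unfolding R c L2_sq_diff_eigf_sum[OF f L] using L
      by (simp add: sum_subtractf right_diff_distrib sum_nonneg)
    finally show ?thesis using q(2) by simp
  qed
  then show "\<exists>N. \<forall>m\<ge>N. norm (R m - 0) < e"
    by (intro exI[of _ N]) (auto simp: R_def)
qed

lemma bessel:
  assumes L: "0 < L" and f: "L2_on 0 L f"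
  shows "L / 2 * (\<Sum>n<N. (cmod (coeff B L f n))\<^sup>2) \<le> L2_sq L f"
proof -
  have "0 \<le> L2_sq L (\<lambda>s. f s - (\<Sum>n<N. coeff B L f n * of_real (eigf B L n s)))" by simp
  then show ?thesis unfolding L2_sq_diff_eigf_sum[OF f L] by (simp add: sum_negf)
qed

lemma L2_sq_eq_0_AE:
  assumes "L2_on 0 L f" "L2_sq L f = 0"
  shows "AE s in ivl L. f s = 0"
  using assms by (simp add: L2_sq_def L2_on_def integral_nonneg_eq_0_iff_AE)

lemma AE_eq_0_of_coeff:
  assumes L: "0 < L" and f: "L2_on 0 L f" and c: "\<And>n. coeff B L f n = 0"
  shows "AE s in ivl L. f s = 0"
proof -
  have "(\<lambda>N::nat. L2_sq L f) \<longlonglongrightarrow> 0" using eigf_expansion[OF L f, of B] by (simp add: c)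
  then have "L2_sq L f = 0" by (simp add: LIMSEQ_const_iff)
  with f show ?thesis by (rule L2_sq_eq_0_AE)
qed

section \<open>Limits of solutions and uniqueness of the final state\<close>

lemma continuous_on_Times_section':
  assumes "continuous_on (A \<times> I) (\<lambda>(t, s). f t s)" "s \<in> I"
  shows "continuous_on A (\<lambda>t. f t s)"
proof -
  have "continuous_on A (\<lambda>t. (t, s))" by (intro continuous_intros)
  from continuous_on_compose2[OF assms(1) this] show ?thesis using assms(2) by auto
qed

lemma heat_solutionD:
  assumes "heat_solution B L T g u0 u" "test_function B L T \<phi> \<phi>t \<phi>s \<phi>ss" "t \<in> {0..T}"
  shows "(LINT s|ivl L. of_real (\<phi> t s) * u t s) - (LINT s|ivl L. of_real (\<phi> 0 s) * u0 s)
     = (LINT r|ivl t. LINT s|ivl L. of_real (\<phi>t r s + \<phi>ss r s) * u r s)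
       - (LINT r|ivl t. of_real (\<phi>s r L) * g r)"
  using assms unfolding heat_solution_def by blast

lemma L2_sq_sup_bound:
  assumes "0 \<le> L" "f \<in> borel_measurable (ivl L)" "\<And>s. s \<in> {0<..<L} \<Longrightarrow> cmod (f s) \<le> C"
  shows "L2_sq L f \<le> L * C\<^sup>2"
proof -
  have "L2_sq L f \<le> (LINT s|ivl L. C\<^sup>2)"
    unfolding L2_sq_def
    by (rule integral_mono) (use L2_on_bounded[OF assms(2,3)] assms(3) in \<open>auto simp: L2_on_def intro!: integrable_ivl power_mono\<close>)
  also have "\<dots> = L * C\<^sup>2" using measure_ivl[OF assms(1)] by simp
  finally show ?thesis .
qed

text \<open>Integrability of the limit is a conclusion: for a limit solution \<open>u\<close>, the
  dependence on time of its space integrals is known only through the approximations.\<close>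

lemma LINT_uniform_limit:
  fixes f :: "nat \<Rightarrow> real \<Rightarrow> complex"
  assumes t: "0 \<le> t" and i: "\<And>N. integrable (ivl t) (f N)"
    and bd: "\<And>N r. r \<in> {0<..<t} \<Longrightarrow> cmod (f N r - g r) \<le> \<delta> N" and \<delta>: "\<delta> \<longlonglongrightarrow> 0"
  shows "(\<lambda>N. LINT r|ivl t. f N r) \<longlonglongrightarrow> (LINT r|ivl t. g r)" and "integrable (ivl t) g"
proof -
  have lim: "(\<lambda>N. f N r) \<longlonglongrightarrow> g r" if "r \<in> {0<..<t}" for r
    by (rule LIM_zero_cancel[OF Lim_null_comparison[OF _ \<delta>]]) (use bd[OF that] in auto)
  have m: "g \<in> borel_measurable (ivl t)"
    by (rule borel_measurable_LIMSEQ_metric[where f = f]) (use i lim in auto)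
  have d0: "0 \<le> \<delta> 0" if "r \<in> {0<..<t}" for r using order_trans[OF norm_ge_zero bd[OF that]] .
  have "integrable (ivl t) (\<lambda>r. cmod (f 0 r) + \<delta> 0)"
    using integrable_norm[OF i[of 0]] integrable_ivl[of t "\<lambda>_. \<delta> 0"] by simp
  then show ig: "integrable (ivl t) g"
  proof (rule Bochner_Integration.integrable_bound[OF _ m], intro AE_I2)
    fix r assume "r \<in> space (ivl t)"
    then have r: "r \<in> {0<..<t}" by simp
    show "norm (g r) \<le> norm (cmod (f 0 r) + \<delta> 0)"
      using bd[OF r, of 0] d0[OF r] norm_triangle_sub[of "g r" "f 0 r"] by (simp add: norm_minus_commute)
  qed
  show "(\<lambda>N. LINT r|ivl t. f N r) \<longlonglongrightarrow> (LINT r|ivl t. g r)"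
  proof (rule LIM_zero_cancel, rule Lim_null_comparison)
    show "(\<lambda>N. t * \<delta> N) \<longlonglongrightarrow> 0" using tendsto_mult_left[OF \<delta>, of t] by simp
    show "\<forall>\<^sub>F N in sequentially. norm ((LINT r|ivl t. f N r) - (LINT r|ivl t. g r)) \<le> t * \<delta> N"
    proof (rule always_eventually, rule allI)
      fix N
      have id: "integrable (ivl t) (\<lambda>r. f N r - g r)" using i ig by auto
      have "norm ((LINT r|ivl t. f N r) - (LINT r|ivl t. g r)) = norm (LINT r|ivl t. f N r - g r)"
        using i ig by simp
      also have "\<dots> \<le> (LINT r|ivl t. cmod (f N r - g r))" by (rule integral_norm_bound)
      also have "\<dots> \<le> (LINT r|ivl t. \<delta> N)"
        by (rule integral_mono[OF integrable_norm[OF id]]) (use bd in \<open>auto intro!: integrable_ivl\<close>)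
      also have "\<dots> = t * \<delta> N" using measure_ivl[OF t] by simp
      finally show "norm ((LINT r|ivl t. f N r) - (LINT r|ivl t. g r)) \<le> t * \<delta> N" .
    qed
  qed
qed

lemma LINT_mult_limit:
  assumes L: "0 < L" and h: "continuous_on {0..L} h" and u: "L2_on 0 L u" "\<And>N. L2_on 0 L (v N)"
    and lim: "(\<lambda>N. L2_sq L (\<lambda>s. u s - v N s)) \<longlonglongrightarrow> 0"
  shows "(\<lambda>N. LINT s|ivl L. h s * v N s) \<longlonglongrightarrow> (LINT s|ivl L. h s * u s)"
proof -
  obtain C where C: "0 \<le> C" "\<And>s. s \<in> {0..L} \<Longrightarrow> cmod (h s) \<le> C"
    using continuous_on_ivl_bounded[OF h] by blast
  have Cs: "\<And>s. s \<in> {0<..<L} \<Longrightarrow> cmod (h s) \<le> C" using C by auto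
  have i: "integrable (ivl L) (\<lambda>s. h s * w s)" if "L2_on 0 L w" for w
    by (intro L2_on_integrable L2_on_mult_bounded[OF that measurable_ivl[OF h] Cs])
  have "(\<lambda>N. C * sqrt (L * L2_sq L (\<lambda>s. u s - v N s))) \<longlonglongrightarrow> C * sqrt (L * 0)"
    by (intro tendsto_intros lim)
  then have "(\<lambda>N. C * sqrt (L * L2_sq L (\<lambda>s. u s - v N s))) \<longlonglongrightarrow> 0" by simp
  moreover have "\<forall>\<^sub>F N in sequentially. norm ((LINT s|ivl L. h s * v N s) - (LINT s|ivl L. h s * u s))
      \<le> C * sqrt (L * L2_sq L (\<lambda>s. u s - v N s))"
  proof (rule always_eventually, rule allI)
    fix N
    have "(LINT s|ivl L. h s * u s) - (LINT s|ivl L. h s * v N s) = (LINT s|ivl L. h s * (u s - v N s))"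
      using i[OF u(1)] i[OF u(2)] by (simp add: right_diff_distrib)
    then show "norm ((LINT s|ivl L. h s * v N s) - (LINT s|ivl L. h s * u s))
        \<le> C * sqrt (L * L2_sq L (\<lambda>s. u s - v N s))"
      using LINT_mult_bound[OF L2_on_diff[OF u(1) u(2)] L measurable_ivl[OF h] Cs C(1)]
      by (simp add: norm_minus_commute)
  qed
  ultimately show ?thesis
    by (rule LIM_zero_cancel[OF Lim_null_comparison[rotated]])
qed

text \<open>The transposition formula survives if the states converge in L2 uniformly in time and
  the traces at \<open>L\<close> converge uniformly to \<open>g\<close>; \<open>u\<close> itself is
  not assumed to have a trace there.\<close>

lemma transposition_limit:
  assumes L: "0 < L" and t: "0 \<le> t" "t \<le> T"
    and test: "test_function B L T \<phi> \<phi>t \<phi>s \<phi>ss"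
    and v: "\<And>N. continuous_on ({0..T} \<times> {0..L}) (\<lambda>(t, s). v N t s)"
    and S: "finite S" and cl: "\<And>N. classical_heat B ({0<..<T} - S) {0..L} (v N)"
    and u: "\<And>r. r \<in> {0..T} \<Longrightarrow> L2_on 0 L (u r)"
    and err: "\<And>N r. r \<in> {0..T} \<Longrightarrow> L2_sq L (\<lambda>s. u r s - v N r s) \<le> \<epsilon> N" and \<epsilon>: "\<epsilon> \<longlonglongrightarrow> 0"
    and g: "\<And>N r. r \<in> {0<..<T} \<Longrightarrow> cmod (v N r L - g r) \<le> \<delta> N" and \<delta>: "\<delta> \<longlonglongrightarrow> 0"
  shows "(LINT s|ivl L. of_real (\<phi> t s) * u t s) - (LINT s|ivl L. of_real (\<phi> 0 s) * u 0 s)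
     = (LINT r|ivl t. LINT s|ivl L. of_real (\<phi>t r s + \<phi>ss r s) * u r s)
       - (LINT r|ivl t. of_real (\<phi>s r L) * g r)"
proof -
  have ct: "continuous_on ({0..T} \<times> {0..L}) (\<lambda>(t, s). complex_of_real (\<psi> t s))" if "\<psi> \<in> {\<phi>, \<phi>t, \<phi>s, \<phi>ss}" for \<psi>
  proof -
    have "continuous_on ({0..T} \<times> {0..L}) (\<lambda>(t, s). \<psi> t s)"
      using test that unfolding test_function_def by blast
    from continuous_on_of_real[OF this, where 'a = complex] show ?thesis by (simp add: case_prod_beta')
  qed
  have cts: "continuous_on {0..L} (\<lambda>s. complex_of_real (\<psi> r s))" if "\<psi> \<in> {\<phi>, \<phi>t, \<phi>s, \<phi>ss}" "r \<in> {0..T}" for \<psi> r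
    using continuous_on_Times_section[OF ct[OF that(1)] that(2)] .
  have vL2: "L2_on 0 L (v N r)" if "r \<in> {0..T}" for N r
    by (rule L2_on_continuous[OF continuous_on_Times_section[OF v that]])
  have e0: "0 \<le> \<epsilon> N" for N using order_trans[OF L2_sq_nonneg err[of 0 N]] t by simp
  have lim0: "(\<lambda>N. L2_sq L (\<lambda>s. u r s - v N r s)) \<longlonglongrightarrow> 0" if "r \<in> {0..T}" for r
    by (rule tendsto_sandwich[OF _ _ tendsto_const \<epsilon>]) (use err[OF that] in auto)
  have lim1: "(\<lambda>N. LINT s|ivl L. of_real (\<phi> r s) * v N r s) \<longlonglongrightarrow> (LINT s|ivl L. of_real (\<phi> r s) * u r s)"
    if "r \<in> {0..T}" for r
    by (rule LINT_mult_limit[OF L cts[OF _ that] u[OF that] vL2[OF that] lim0[OF that]]) simp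
  define F where "F N r = (LINT s|ivl L. of_real (\<phi>t r s + \<phi>ss r s) * v N r s)" for N r
  define F0 where "F0 r = (LINT s|ivl L. of_real (\<phi>t r s + \<phi>ss r s) * u r s)" for r
  have cadd: "continuous_on ({0..T} \<times> {0..L}) (\<lambda>(t, s). complex_of_real (\<phi>t t s + \<phi>ss t s))"
    using ct[of \<phi>t] ct[of \<phi>ss] by (auto intro!: continuous_intros simp: case_prod_beta')
  have "bounded ((\<lambda>(t, s). complex_of_real (\<phi>t t s + \<phi>ss t s)) ` ({0..T} \<times> {0..L}))"
    by (intro compact_imp_bounded compact_continuous_image cadd compact_Times) auto
  then obtain C where C: "\<And>x. x \<in> {0..T} \<times> {0..L} \<Longrightarrow> cmod ((\<lambda>(t, s). complex_of_real (\<phi>t t s + \<phi>ss t s)) x) \<le> C"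
    unfolding bounded_iff by blast
  have C0: "0 \<le> C" using order_trans[OF norm_ge_zero C[of "(0, 0)"]] t L by simp
  have cadds: "continuous_on {0..L} (\<lambda>s. complex_of_real (\<phi>t r s + \<phi>ss r s))" if "r \<in> {0..T}" for r
    by (rule continuous_on_Times_section[OF cadd that])
  have FN: "F N r = integral {0..L} (\<lambda>s. of_real (\<phi>t r s + \<phi>ss r s) * v N r s)" if "r \<in> {0..T}" for N r
    unfolding F_def using cadds[OF that] continuous_on_Times_section[OF v that]
    by (intro LINT_ivl_eq_integral integrable_ivl continuous_on_mult)
  have "continuous_on {0..T} (\<lambda>r. integral (cbox 0 L) (\<lambda>s. of_real (\<phi>t r s + \<phi>ss r s) * v N r s))" for N
    using continuous_on_mult[OF cadd v, of N]
    by (intro integral_continuous_on_param) (simp add: case_prod_beta')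
  then have Fc: "continuous_on {0..t} (F N)" for N
    using t by (intro continuous_on_eq[OF continuous_on_subset[of "{0..T}" _ "{0..t}"]]) (auto simp: FN)
  have Fi: "integrable (ivl t) (F N)" for N by (rule integrable_ivl[OF Fc])
  have Fdiff: "cmod (F N r - F0 r) \<le> C * sqrt (L * \<epsilon> N)" if "r \<in> {0<..<t}" for N r
  proof -
    have r: "r \<in> {0..T}" using that t by auto
    have Cs: "\<And>s. s \<in> {0<..<L} \<Longrightarrow> cmod (complex_of_real (\<phi>t r s + \<phi>ss r s)) \<le> C"
      using C[of "(r, _)"] r by auto
    have i: "integrable (ivl L) (\<lambda>s. of_real (\<phi>t r s + \<phi>ss r s) * w s)" if "L2_on 0 L w" for w
      by (intro L2_on_integrable L2_on_mult_bounded[OF that measurable_ivl[OF cadds[OF r]] Cs])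
    have "F0 r - F N r = (LINT s|ivl L. of_real (\<phi>t r s + \<phi>ss r s) * (u r s - v N r s))"
      unfolding F0_def F_def using i[OF u[OF r]] i[OF vL2[OF r]] by (simp add: right_diff_distrib)
    then have "cmod (F0 r - F N r) \<le> C * sqrt (L * L2_sq L (\<lambda>s. u r s - v N r s))"
      using LINT_mult_bound[OF L2_on_diff[OF u[OF r] vL2[OF r]] L measurable_ivl[OF cadds[OF r]] Cs C0] by simp
    also have "\<dots> \<le> C * sqrt (L * \<epsilon> N)"
      using C0 L err[OF r] by (intro mult_left_mono real_sqrt_le_mono) auto
    finally show ?thesis by (simp add: norm_minus_commute)
  qed
  have "(\<lambda>N. C * sqrt (L * \<epsilon> N)) \<longlonglongrightarrow> C * sqrt (L * 0)" by (intro tendsto_intros \<epsilon>)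
  then have limF: "(\<lambda>N. LINT r|ivl t. F N r) \<longlonglongrightarrow> (LINT r|ivl t. F0 r)"
    by (intro LINT_uniform_limit[OF t(1) Fi Fdiff]) auto
  have csL: "continuous_on {0..T} (\<lambda>r. complex_of_real (\<phi>s r L))"
    by (rule continuous_on_Times_section'[OF ct]) (use L in auto)
  obtain D where D: "0 \<le> D" "\<And>r. r \<in> {0..T} \<Longrightarrow> cmod (of_real (\<phi>s r L)) \<le> D"
    using continuous_on_ivl_bounded[OF csL] by blast
  define G where "G N r = of_real (\<phi>s r L) * v N r L" for N r
  have "continuous_on {0..T} (\<lambda>r. v N r L)" for N
    by (rule continuous_on_Times_section'[OF v]) (use L in auto)
  from continuous_on_mult[OF csL this]
  have Gc: "continuous_on {0..t} (G N)" for N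
    unfolding G_def by (rule continuous_on_subset) (use t in auto)
  have Gi: "integrable (ivl t) (G N)" for N by (rule integrable_ivl[OF Gc])
  have Gdiff: "cmod (G N r - of_real (\<phi>s r L) * g r) \<le> D * \<delta> N" if "r \<in> {0<..<t}" for N r
    unfolding G_def right_diff_distrib[symmetric] norm_mult
    using that t D g[of r N] order_trans[OF norm_ge_zero g[of r N]] by (intro mult_mono) auto
  have limG: "(\<lambda>N. LINT r|ivl t. G N r) \<longlonglongrightarrow> (LINT r|ivl t. of_real (\<phi>s r L) * g r)"
    using tendsto_mult_left[OF \<delta>, of D] by (intro LINT_uniform_limit[OF t(1) Gi Gdiff]) auto
  have id: "(LINT s|ivl L. of_real (\<phi> t s) * v N t s) - (LINT s|ivl L. of_real (\<phi> 0 s) * v N 0 s)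
      = (LINT r|ivl t. F N r) - (LINT r|ivl t. G N r)" for N
  proof -
    have I: "(LINT s|ivl L. of_real (\<phi> r s) * v N r s) = integral {0..L} (\<lambda>s. of_real (\<phi> r s) * v N r s)"
      if "r \<in> {0..T}" for r
      using cts[OF _ that, of \<phi>] continuous_on_Times_section[OF v that, of N]
      by (intro LINT_ivl_eq_integral integrable_ivl continuous_on_mult) auto
    have tI: "t \<in> {0..T}" and zI: "0 \<in> {0..T}" using t by auto
    have "((\<lambda>r. F N r - G N r) has_integral ((LINT s|ivl L. of_real (\<phi> t s) * v N t s)
        - (LINT s|ivl L. of_real (\<phi> 0 s) * v N 0 s))) {0..t}"
      unfolding I[OF tI] I[OF zI]
      by (rule has_integral_eq[OF _ classical_heat_transposition[OF test v S cl L t, of N]])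
         (use t in \<open>auto simp: FN G_def\<close>)
    then have "integral {0..t} (\<lambda>r. F N r - G N r) = (LINT s|ivl L. of_real (\<phi> t s) * v N t s)
        - (LINT s|ivl L. of_real (\<phi> 0 s) * v N 0 s)" by (rule integral_unique)
    moreover have "(LINT r|ivl t. F N r - G N r) = integral {0..t} (\<lambda>r. F N r - G N r)"
      using Fi Gi by (intro LINT_ivl_eq_integral) auto
    ultimately show ?thesis using Fi Gi by simp
  qed
  have "(\<lambda>N. (LINT s|ivl L. of_real (\<phi> t s) * v N t s) - (LINT s|ivl L. of_real (\<phi> 0 s) * v N 0 s))
      \<longlonglongrightarrow> (LINT s|ivl L. of_real (\<phi> t s) * u t s) - (LINT s|ivl L. of_real (\<phi> 0 s) * u 0 s)"
    using t by (intro tendsto_diff lim1) auto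
  moreover have "(\<lambda>N. (LINT r|ivl t. F N r) - (LINT r|ivl t. G N r)) \<longlonglongrightarrow>
      (LINT r|ivl t. F0 r) - (LINT r|ivl t. of_real (\<phi>s r L) * g r)"
    by (intro tendsto_diff limF limG)
  ultimately show ?thesis unfolding id F0_def by (rule LIMSEQ_unique)
qed

lemma L2_continuous_of_uniform_limit:
  fixes T t :: real
  assumes L: "0 < L"
    and v: "\<And>N. continuous_on ({0..T} \<times> {0..L}) (\<lambda>(t, s). v N t s)"
    and u: "\<And>r. r \<in> {0..T} \<Longrightarrow> L2_on 0 L (u r)"
    and err: "\<And>N r. r \<in> {0..T} \<Longrightarrow> L2_sq L (\<lambda>s. u r s - v N r s) \<le> \<epsilon> N" and \<epsilon>: "\<epsilon> \<longlonglongrightarrow> 0"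
    and t: "t \<in> {0..T}" and e: "0 < e"
  obtains d where "0 < d" "\<And>r. r \<in> {0..T} \<Longrightarrow> \<bar>r - t\<bar> < d \<Longrightarrow> L2_sq L (\<lambda>s. u r s - u t s) < e"
proof -
  have vL2: "L2_on 0 L (v N r)" if "r \<in> {0..T}" for N r
    by (rule L2_on_continuous[OF continuous_on_Times_section[OF v that]])
  have "\<forall>\<^sub>F N in sequentially. \<epsilon> N < e / 16" using e \<epsilon> by (intro order_tendstoD(2)) auto
  \<comment> \<open>Two applications of \<open>L2_sq_diff_le\<close> weigh the three errors by 2, 4
    and 4, so a sixteenth of \<open>e\<close> for each is small enough.\<close>
  then obtain N where N: "\<epsilon> N < e / 16" by (auto simp: eventually_sequentially)
  have vt: "continuous_on ({0..T} \<times> {0..L}) (\<lambda>x. v N t (snd x))"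
    by (rule continuous_on_compose2[OF continuous_on_Times_section[OF v t]]) (auto intro!: continuous_intros)
  have "continuous_on ({0..T} \<times> {0..L}) (\<lambda>x. (cmod ((\<lambda>(r, s). v N r s) x - v N t (snd x)))\<^sup>2)"
    by (intro continuous_intros v vt)
  then have c: "continuous_on {0..T} (\<lambda>r. integral (cbox 0 L) (\<lambda>s. (cmod (v N r s - v N t s))\<^sup>2))"
    by (intro integral_continuous_on_param) (simp add: case_prod_beta')
  have eq: "L2_sq L (\<lambda>s. v N r s - v N t s) = integral (cbox 0 L) (\<lambda>s. (cmod (v N r s - v N t s))\<^sup>2)"
    if "r \<in> {0..T}" for r
    unfolding L2_sq_def
    by (subst LINT_ivl_eq_integral) (auto intro!: integrable_ivl continuous_intros continuous_on_Times_section[OF v] that t)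
  obtain d where d: "0 < d" "\<And>r. r \<in> {0..T} \<Longrightarrow> dist r t < d \<Longrightarrow>
      dist (integral (cbox 0 L) (\<lambda>s. (cmod (v N r s - v N t s))\<^sup>2))
        (integral (cbox 0 L) (\<lambda>s. (cmod (v N t s - v N t s))\<^sup>2)) < e / 16"
    using c[unfolded continuous_on_iff, rule_format, OF t, of "e / 16"] e by auto
  show ?thesis
  proof (rule that[OF d(1)])
    fix r assume r: "r \<in> {0..T}" "\<bar>r - t\<bar> < d"
    have "L2_sq L (\<lambda>s. v N r s - v N t s) < e / 16"
      using d(2)[OF r(1)] r(2) unfolding eq[OF r(1)] by (simp add: dist_real_def)
    moreover have "L2_sq L (\<lambda>s. v N t s - u t s) < e / 16"
      using err[OF t, of N] N by (simp add: L2_sq_diff_commute[of L "v N t"])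
    moreover have "L2_sq L (\<lambda>s. u r s - v N r s) < e / 16"
      using err[OF r(1), of N] N by simp
    moreover have "L2_sq L (\<lambda>s. u r s - u t s)
        \<le> 2 * L2_sq L (\<lambda>s. u r s - v N r s) + 2 * L2_sq L (\<lambda>s. v N r s - u t s)"
      by (rule L2_sq_diff_le[OF u[OF r(1)] vL2[OF r(1)] u[OF t]])
    moreover have "L2_sq L (\<lambda>s. v N r s - u t s)
        \<le> 2 * L2_sq L (\<lambda>s. v N r s - v N t s) + 2 * L2_sq L (\<lambda>s. v N t s - u t s)"
      by (rule L2_sq_diff_le[OF vL2[OF r(1)] vL2[OF t] u[OF t]])
    ultimately show "L2_sq L (\<lambda>s. u r s - u t s) < e" using e by linarith
  qed
qed

text \<open>These functions solve the backward equation, \<phi>t + \<phi>ss = 0, so the interior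
  integral in the transposition formula disappears.\<close>

lemma eig_test_function:
  fixes B :: boundary_op and n :: nat
  assumes L: "0 < L"
  defines "\<mu> \<equiv> freq B L n"
  obtains \<phi>s where "test_function B L T (\<lambda>t s. exp (\<mu>\<^sup>2 * t) * eig B \<mu> s)
    (\<lambda>t s. \<mu>\<^sup>2 * (exp (\<mu>\<^sup>2 * t) * eig B \<mu> s)) \<phi>s (\<lambda>t s. - \<mu>\<^sup>2 * (exp (\<mu>\<^sup>2 * t) * eig B \<mu> s))"
proof -
  define e' where "e' s = (case B of Dirichlet \<Rightarrow> \<mu> * cos (\<mu> * s) | Neumann \<Rightarrow> - \<mu> * sin (\<mu> * s))" for s
  have d1: "(eig B \<mu> has_real_derivative e' s) (at s within A)" for s A
    by (cases B) (auto simp: eig_def[abs_def] e'_def intro!: derivative_eq_intros)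
  have d2: "(e' has_real_derivative - \<mu>\<^sup>2 * eig B \<mu> s) (at s within A)" for s A
    by (cases B) (auto simp: eig_def e'_def[abs_def] power2_eq_square intro!: derivative_eq_intros)
  have c: "continuous_on A (\<lambda>x::real \<times> real. eig B \<mu> (snd x))" "continuous_on A (\<lambda>x::real \<times> real. e' (snd x))" for A
    using continuous_on_compose2[OF DERIV_continuous_on[of UNIV, OF d1], of A snd]
      continuous_on_compose2[OF DERIV_continuous_on[of UNIV, OF d2], of A snd]
      continuous_on_snd[OF continuous_on_id, of A] by auto
  show ?thesis
  proof (rule that[of "\<lambda>t s. exp (\<mu>\<^sup>2 * t) * e' s"], unfold test_function_def, intro conjI ballI)
    fix \<psi> assume "\<psi> \<in> {\<lambda>t s. exp (\<mu>\<^sup>2 * t) * eig B \<mu> s, \<lambda>t s. \<mu>\<^sup>2 * (exp (\<mu>\<^sup>2 * t) * eig B \<mu> s),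
        \<lambda>t s. exp (\<mu>\<^sup>2 * t) * e' s, \<lambda>t s. - \<mu>\<^sup>2 * (exp (\<mu>\<^sup>2 * t) * eig B \<mu> s)}"
    then show "continuous_on ({0..T} \<times> {0..L}) (\<lambda>(t, s). \<psi> t s)"
      by (auto simp: case_prod_beta' intro!: continuous_intros c)
  next
    fix t s
    show "((\<lambda>r. exp (\<mu>\<^sup>2 * r) * eig B \<mu> s) has_real_derivative \<mu>\<^sup>2 * (exp (\<mu>\<^sup>2 * t) * eig B \<mu> s)) (at t within {0..T})"
      by (auto intro!: derivative_eq_intros)
    show "((\<lambda>x. exp (\<mu>\<^sup>2 * t) * eig B \<mu> x) has_real_derivative exp (\<mu>\<^sup>2 * t) * e' s) (at s within {0..L})"
      by (intro DERIV_cmult d1)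
    show "((\<lambda>x. exp (\<mu>\<^sup>2 * t) * e' x) has_real_derivative - \<mu>\<^sup>2 * (exp (\<mu>\<^sup>2 * t) * eig B \<mu> s)) (at s within {0..L})"
      using DERIV_cmult[OF d2, of "exp (\<mu>\<^sup>2 * t)" s "{0..L}"] by (simp add: mult_ac)
  next
    fix t
    show "apply_boundary_op B (exp (\<mu>\<^sup>2 * t) * eig B \<mu> 0) (exp (\<mu>\<^sup>2 * t) * e' 0) = 0"
      by (cases B) (auto simp: eig_def e'_def)
    show "exp (\<mu>\<^sup>2 * t) * eig B \<mu> L = 0"
      using eigf_at_end[OF L, of B n] by (simp add: \<mu>_def)
  qed
qed

text \<open>Testing with \<open>eig_test_function\<close> expresses each Fourier coefficient of the
  state at \<open>T\<close> through \<open>u0\<close> and \<open>g\<close> alone. All coefficients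
  of \<open>u T\<close> therefore equal those of \<open>v T\<close>, and completeness
  concludes.\<close>

lemma heat_solution_final_unique:
  assumes L: "0 < L" and T: "0 < T" and u: "heat_solution B L T g u0 u" and v: "heat_solution B L T g u0 v"
    and vT: "\<And>s. v T s = 0"
  shows "AE s in ivl L. u T s = 0"
proof (rule AE_eq_0_of_coeff[OF L])
  show uL2: "L2_on 0 L (u T)" using u T by (simp add: heat_solution_def C0_L2_def)
  fix n
  obtain \<phi>s where test: "test_function B L T (\<lambda>t s. exp ((freq B L n)\<^sup>2 * t) * eigf B L n s)
    (\<lambda>t s. (freq B L n)\<^sup>2 * (exp ((freq B L n)\<^sup>2 * t) * eigf B L n s)) \<phi>s
    (\<lambda>t s. - (freq B L n)\<^sup>2 * (exp ((freq B L n)\<^sup>2 * t) * eigf B L n s))"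
    using eig_test_function[OF L] by blast
  have T': "T \<in> {0..T}" using T by simp
  have *: "(LINT s|ivl L. of_real (exp ((freq B L n)\<^sup>2 * T) * eigf B L n s) * w T s) =
      (LINT s|ivl L. of_real (exp ((freq B L n)\<^sup>2 * 0) * eigf B L n s) * u0 s)
      - (LINT r|ivl T. of_real (\<phi>s r L) * g r)" if "heat_solution B L T g u0 w" for w
    using heat_solutionD[OF that test T'] by (simp add: algebra_simps)
  have "(LINT s|ivl L. of_real (exp ((freq B L n)\<^sup>2 * T)) * (of_real (eigf B L n s) * u T s)) = 0"
    using *[OF u] *[OF v] by (simp add: vT mult.assoc)
  then show "coeff B L (u T) n = 0" by (simp add: coeff_def)
qed

section \<open>Null-controllability\<close>

lemma classical_heat_lincomb:
  assumes "classical_heat B U I v" "classical_heat B U I w"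
  shows "classical_heat B U I (\<lambda>t s. v t s + c * w t s)"
proof -
  obtain vs vt where v: "continuous_on (U \<times> I) (\<lambda>(t, s). vt t s)"
    "\<And>t s. t \<in> U \<Longrightarrow> s \<in> I \<Longrightarrow> ((\<lambda>r. v r s) has_vector_derivative vt t s) (at t)"
    "\<And>t s. t \<in> U \<Longrightarrow> s \<in> I \<Longrightarrow> (v t has_vector_derivative vs t s) (at s within I)"
    "\<And>t s. t \<in> U \<Longrightarrow> s \<in> I \<Longrightarrow> (vs t has_vector_derivative vt t s) (at s within I)"
    "\<And>t. t \<in> U \<Longrightarrow> case B of Dirichlet \<Rightarrow> v t 0 = 0 | Neumann \<Rightarrow> vs t 0 = 0"
    using assms(1) unfolding classical_heat_def by blast
  obtain ws wt where w: "continuous_on (U \<times> I) (\<lambda>(t, s). wt t s)"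
    "\<And>t s. t \<in> U \<Longrightarrow> s \<in> I \<Longrightarrow> ((\<lambda>r. w r s) has_vector_derivative wt t s) (at t)"
    "\<And>t s. t \<in> U \<Longrightarrow> s \<in> I \<Longrightarrow> (w t has_vector_derivative ws t s) (at s within I)"
    "\<And>t s. t \<in> U \<Longrightarrow> s \<in> I \<Longrightarrow> (ws t has_vector_derivative wt t s) (at s within I)"
    "\<And>t. t \<in> U \<Longrightarrow> case B of Dirichlet \<Rightarrow> w t 0 = 0 | Neumann \<Rightarrow> ws t 0 = 0"
    using assms(2) unfolding classical_heat_def by blast
  note lin = has_vector_derivative_add[OF _ has_vector_derivative_mult_right[of _ _ _ c]]
  show ?thesis
    unfolding classical_heat_def
  proof (rule exI[of _ "\<lambda>t s. vs t s + c * ws t s"], rule exI[of _ "\<lambda>t s. vt t s + c * wt t s"],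
      intro conjI ballI)
    show "continuous_on (U \<times> I) (\<lambda>(t, s). vt t s + c * wt t s)"
      using v(1) w(1) unfolding case_prod_beta' by (intro continuous_intros)
    fix t assume t: "t \<in> U"
    show "case B of Dirichlet \<Rightarrow> v t 0 + c * w t 0 = 0 | Neumann \<Rightarrow> vs t 0 + c * ws t 0 = 0"
      using v(5)[OF t] w(5)[OF t] by (cases B) auto
    fix s assume s: "s \<in> I"
    show "((\<lambda>r. v r s + c * w r s) has_vector_derivative vt t s + c * wt t s) (at t)"
      by (rule lin[OF v(2)[OF t s] w(2)[OF t s]])
    show "((\<lambda>s. v t s + c * w t s) has_vector_derivative vs t s + c * ws t s) (at s within I)"
      by (rule lin[OF v(3)[OF t s] w(3)[OF t s]])
    show "((\<lambda>s. vs t s + c * ws t s) has_vector_derivative vt t s + c * wt t s) (at s within I)"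
      by (rule lin[OF v(4)[OF t s] w(4)[OF t s]])
  qed
qed

lemma classical_heat_0: "classical_heat B U I (\<lambda>t s. 0)"
  unfolding classical_heat_def
  by (rule exI[of _ "\<lambda>t s. 0"], rule exI[of _ "\<lambda>t s. 0"]) (cases B; simp)

lemma classical_heat_sum:
  fixes N :: nat
  assumes "\<And>n. classical_heat B U I (w n)"
  shows "classical_heat B U I (\<lambda>t s. \<Sum>n<N. a n * w n t s)"
proof (induction N)
  case (Suc N)
  from classical_heat_lincomb[OF this assms] show ?case by simp
qed (simp add: classical_heat_0)

text \<open>A fourth power is obtained so that summability survives the factor of order n + 1 in the
  Dirichlet case. The price is the square of L^2/t, which becomes the polynomial factor in the
  control cost.\<close>

lemma exp_freq_le:
  assumes L: "0 < L" and t: "0 < t"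
  shows "exp (- ((freq B L n)\<^sup>2 * t)) \<le> L ^ 4 / (2 * t\<^sup>2) * (1 / (real n + 1) ^ 4)"
proof -
  define m where "m = real n + 1"
  have m: "1 \<le> m" by (simp add: m_def)
  \<comment> \<open>A lower bound for \<open>(freq B L n)\<^sup>2 * t\<close>, since the frequency
    is at least m\<pi>/(2L) and \<pi>^2 is at least 8.\<close>
  define y where "y = 2 * m\<^sup>2 * t / L\<^sup>2"
  have y: "0 < y" using m t L by (simp add: y_def)
  have "m * pi / (2 * L) \<le> freq B L n"
    using L by (cases B) (auto simp: freq_def m_def field_simps)
  then have "(m * pi / (2 * L))\<^sup>2 \<le> (freq B L n)\<^sup>2"
    using m L by (intro power_mono) auto
  moreover have "2 * m\<^sup>2 / L\<^sup>2 \<le> (m * pi / (2 * L))\<^sup>2"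
  proof -
    have "3\<^sup>2 \<le> pi\<^sup>2" using pi_gt3 by (intro power_mono) auto
    then have "m\<^sup>2 * 8 \<le> m\<^sup>2 * pi\<^sup>2" by (intro mult_left_mono) auto
    then show ?thesis using L by (simp add: power_mult_distrib power_divide field_simps)
  qed
  ultimately have "2 * m\<^sup>2 / L\<^sup>2 * t \<le> (freq B L n)\<^sup>2 * t"
    using t by (intro mult_right_mono) auto
  then have "exp (- ((freq B L n)\<^sup>2 * t)) \<le> exp (- y)" by (simp add: y_def)
  also have "\<dots> \<le> 2 / y\<^sup>2"
  proof -
    have "y\<^sup>2 / 2 \<le> exp y" using exp_lower_Taylor_quadratic[of y] y by simp
    then have "1 / exp y \<le> 1 / (y\<^sup>2 / 2)" using y by (intro divide_left_mono) auto
    then show ?thesis by (simp add: exp_minus field_simps)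
  qed
  also have "2 / y\<^sup>2 = L ^ 4 / (2 * t\<^sup>2) * (1 / m ^ 4)"
    by (simp add: y_def power_mult_distrib power_divide power2_eq_square power4_eq_xxxx mult.assoc)
  finally show ?thesis by (simp add: m_def)
qed

section \<open>Summation over the modes and tails of series\<close>

lemma summable_inverse_square: "summable (\<lambda>n. 1 / (real n + 1)\<^sup>2)"
  using summable_Suc_iff[of "\<lambda>n. inverse (real n ^ 2)"] inverse_power_summable[of 2]
  by (simp add: inverse_eq_divide add.commute)

definition inverse_square_sum :: real where
  "inverse_square_sum = (\<Sum>n. 1 / (real n + 1)\<^sup>2)"

lemma tail_suminf_tendsto_0:
  fixes f :: "nat \<Rightarrow> real"
  assumes "summable f"
  shows "(\<lambda>N. \<Sum>n. f (n + N)) \<longlonglongrightarrow> 0"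
proof -
  have "(\<lambda>N. suminf f - (\<Sum>n<N. f n)) \<longlonglongrightarrow> suminf f - suminf f"
    by (intro tendsto_intros summable_LIMSEQ assms)
  then show ?thesis by (simp add: suminf_minus_initial_segment[OF assms])
qed

lemma suminf_tail_bound:
  fixes f :: "nat \<Rightarrow> complex"
  assumes "\<And>n. cmod (f n) \<le> c n" "summable c"
  shows "cmod (suminf f - (\<Sum>n<N. f n)) \<le> (\<Sum>n. c (n + N))"
proof -
  have f: "summable f"
    by (rule summable_comparison_test'[OF assms(2), of 0]) (use assms(1) in auto)
  show ?thesis
    unfolding suminf_minus_initial_segment[OF f, symmetric]
    using assms by (intro norm_suminf_le) (auto simp: summable_iff_shift)
qed

text \<open>The controlled modes are superposed with the Fourier coefficients of \<open>u0\<close>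
  as weights. In the prefactor, sqrt T comes from estimating the norm of \<open>g\<close> by its
  supremum, and sqrt(2/L) from bounding each coefficient by Bessel's inequality.\<close>

lemma null_control:
  assumes L: "0 < L" and T: "0 < T" and u0: "L2_on 0 L u0"
  obtains g u where "L2_on 0 T g" "heat_solution B L T g u0 u" "\<And>s. u T s = 0"
    "L2_norm_on 0 T g \<le> sqrt (2 * T / L) * (10500 * pi * inverse_square_sum * (L\<^sup>2 / T)\<^sup>2
      * exp (301 / 162 * (L\<^sup>2 / T))) * L2_norm_on 0 L u0"
proof -
  define a where "a = coeff B L u0"
  define X where "X = L\<^sup>2 / T"
  define E where "E n = exp (- ((freq B L n)\<^sup>2 * T / 10))" for n
  define Q where "Q n = 210 * exp (301 / 162 * X) * (case B of Dirichlet \<Rightarrow> freq B L n * L | Neumann \<Rightarrow> 1) * E n" for n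
  define b where "b n = E n + Q n" for n
  define A where "A = sqrt (2 / L) * L2_norm_on 0 L u0"
  \<comment> \<open>10500 = 210 * 50, with 210 from \<open>Q\<close> and 50 = 10^2 / 2 from
    \<open>exp_freq_le\<close> at time \<open>T / 10\<close>; \<open>pi\<close> comes from
    \<open>freq B L n * L\<close> in the Dirichlet case.\<close>
  define K where "K = 10500 * pi * X\<^sup>2 * exp (301 / 162 * X)"
  have X: "0 < X" using L T by (simp add: X_def)
  have freq0: "0 \<le> freq B L n" for n using L by (cases B) (auto simp: freq_def)
  define I where "I = {0..L}"
  have "\<exists>W. continuous_on ({0..T} \<times> I) (\<lambda>(t, s). W t s) \<and>
    (\<forall>t s. t \<le> T / 10 \<longrightarrow> W t s = of_real (exp (- ((freq B L n)\<^sup>2 * t)) * eigf B L n s)) \<and>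
    (\<forall>s. W T s = 0) \<and>
    (\<forall>t s. T / 10 \<le> t \<longrightarrow> t \<le> T \<longrightarrow> 0 \<le> s \<longrightarrow> s \<le> L \<longrightarrow> cmod (W t s) \<le> b n) \<and>
    (\<forall>t. t \<le> T \<longrightarrow> cmod (W t L) \<le> Q n) \<and>
    classical_heat B ({0<..<T} - {T / 10}) I W" for n
  proof -
    obtain W where "continuous_on ({0..T} \<times> I) (\<lambda>(t, s). W t s)"
      "\<And>t s. t \<le> T / 10 \<Longrightarrow> W t s = of_real (exp (- ((freq B L n)\<^sup>2 * t)) * eigf B L n s)"
      "\<And>s. W T s = 0"
      "\<And>t s. \<lbrakk>T / 10 \<le> t; t \<le> T; 0 \<le> s; s \<le> L\<rbrakk> \<Longrightarrow> cmod (W t s) \<le> b n"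
      "\<And>t. \<lbrakk>eigf B L n L = 0; t \<le> T\<rbrakk> \<Longrightarrow> cmod (W t L) \<le> Q n"
      "classical_heat B ({0<..<T} - {T / 10}) I W"
      using controlled_mode[OF L T freq0[of n], where B = B]
      unfolding b_def Q_def E_def X_def I_def by metis
    then show ?thesis using eigf_at_end[OF L, of B n] by (intro exI[of _ W]) auto
  qed
  then obtain W where W: "\<And>n. continuous_on ({0..T} \<times> I) (\<lambda>(t, s). W n t s)"
    "\<And>n t s. t \<le> T / 10 \<Longrightarrow> W n t s = of_real (exp (- ((freq B L n)\<^sup>2 * t)) * eigf B L n s)"
    "\<And>n s. W n T s = 0"
    "\<And>n t s. T / 10 \<le> t \<Longrightarrow> t \<le> T \<Longrightarrow> 0 \<le> s \<Longrightarrow> s \<le> L \<Longrightarrow> cmod (W n t s) \<le> b n"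
    "\<And>n t. t \<le> T \<Longrightarrow> cmod (W n t L) \<le> Q n"
    "\<And>n. classical_heat B ({0<..<T} - {T / 10}) I (W n)"
    by metis
  have A0: "0 \<le> A" using L by (simp add: A_def L2_norm_on_eq)
  have aA: "cmod (a n) \<le> A" for n
  proof -
    have "L / 2 * (cmod (a n))\<^sup>2 \<le> L / 2 * (\<Sum>k<Suc n. (cmod (a k))\<^sup>2)"
      using L by (intro mult_left_mono) (auto intro: sum_nonneg)
    also have "\<dots> \<le> L2_sq L u0" unfolding a_def by (rule bessel[OF L u0])
    finally have "(cmod (a n))\<^sup>2 \<le> A\<^sup>2"
      using L by (simp add: A_def L2_norm_on_eq power_mult_distrib field_simps)
    then show ?thesis using A0 by (rule power2_le_imp_le)
  qed
  have E4: "E n \<le> 50 * X\<^sup>2 * (1 / (real n + 1) ^ 4)" for n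
    using exp_freq_le[OF L, of "T / 10" B n] T
    by (simp add: E_def X_def power_divide power2_eq_square power4_eq_xxxx mult_ac)
  have pw: "1 / (real n + 1) ^ 4 * (real n + 1) \<le> 1 / (real n + 1)\<^sup>2" "1 / (real n + 1) ^ 4 \<le> 1 / (real n + 1)\<^sup>2" for n
  proof -
    have "1 / m ^ 4 * m = 1 / m ^ 3" "1 / m ^ 3 \<le> 1 / m\<^sup>2" "1 / m ^ 4 \<le> 1 / m\<^sup>2" if "1 \<le> m" for m :: real
      using that one_le_power[OF that, of 2]
      by (auto simp: power_numeral_reduce intro!: divide_left_mono)
    from this[of "real n + 1"] show "1 / (real n + 1) ^ 4 * (real n + 1) \<le> 1 / (real n + 1)\<^sup>2"
      "1 / (real n + 1) ^ 4 \<le> 1 / (real n + 1)\<^sup>2" by simp_all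
  qed
  have EX: "E n \<le> 50 * X\<^sup>2 * (1 / (real n + 1)\<^sup>2)" for n
    by (rule order_trans[OF E4]) (intro mult_left_mono pw, simp)
  have QK: "Q n \<le> K * (1 / (real n + 1)\<^sup>2)" for n
  proof -
    define c where "c = (case B of Dirichlet \<Rightarrow> freq B L n * L | Neumann \<Rightarrow> 1)"
    have c: "0 \<le> c" "c \<le> (real n + 1) * pi"
      using L mult_mono[of 1 "real n + 1" 1 pi] pi_gt3 by (cases B; simp add: c_def freq_def)+
    have "Q n = 210 * exp (301 / 162 * X) * (c * E n)" by (simp add: Q_def c_def)
    also have "c * E n \<le> ((real n + 1) * pi) * (50 * X\<^sup>2 * (1 / (real n + 1) ^ 4))"
      using c by (intro mult_mono E4) (auto simp: E_def)
    also have "\<dots> = 50 * pi * X\<^sup>2 * (1 / (real n + 1) ^ 4 * (real n + 1))" by (simp only: mult_ac)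
    also have "\<dots> \<le> 50 * pi * X\<^sup>2 * (1 / (real n + 1)\<^sup>2)"
      by (intro mult_left_mono pw) auto
    finally show ?thesis by (simp add: K_def mult_ac)
  qed
  have Q0: "0 \<le> Q n" for n using freq0[of n] L by (cases B) (auto simp: Q_def E_def)
  have E0: "0 \<le> E n" for n by (simp add: E_def)
  have sE: "summable E"
    by (rule summable_comparison_test'[OF summable_mult[OF summable_inverse_square, of "50 * X\<^sup>2"], of 0])
       (use EX E0 in auto)
  have sQ: "summable Q"
    by (rule summable_comparison_test'[OF summable_mult[OF summable_inverse_square, of K], of 0])
       (use QK Q0 in auto)
  have sb: "summable b" unfolding b_def by (intro summable_add sE sQ)
  have sumQ: "suminf Q \<le> K * inverse_square_sum"
    unfolding inverse_square_sum_def suminf_mult[OF summable_inverse_square, symmetric]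
    by (intro suminf_le QK sQ summable_mult summable_inverse_square)
  \<comment> \<open>A majorant for the modes at time \<open>t\<close>. It is summable for every
    positive \<open>t\<close>, but not uniformly as \<open>t\<close> tends to 0.\<close>
  define c where "c t n = (if t \<le> T / 10 then exp (- ((freq B L n)\<^sup>2 * t)) else b n)" for t n
  have sc: "summable (c t)" if t: "0 < t" for t
  proof (cases "t \<le> T / 10")
    case True
    have "exp (- ((freq B L n)\<^sup>2 * t)) \<le> L ^ 4 / (2 * t\<^sup>2) * (1 / (real n + 1)\<^sup>2)" for n
      by (rule order_trans[OF exp_freq_le[OF L t]]) (intro mult_left_mono pw, simp)
    then have "summable (\<lambda>n. exp (- ((freq B L n)\<^sup>2 * t)))"
      by (intro summable_comparison_test'[OF summable_mult[OF summable_inverse_square, of "L ^ 4 / (2 * t\<^sup>2)"], of 0]) auto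
    then show ?thesis using True by (simp add: c_def[abs_def])
  qed (use sb in \<open>simp add: c_def[abs_def]\<close>)
  have Wc: "cmod (a n * W n t s) \<le> A * c t n" if "0 < t" "t \<le> T" "0 \<le> s" "s \<le> L" for n t s
  proof -
    have "cmod (W n t s) \<le> c t n"
    proof (cases "t \<le> T / 10")
      case True
      then show ?thesis using abs_eig_le_1[of B "freq B L n" s]
        unfolding W(2)[OF True] norm_of_real abs_mult by (simp add: c_def mult_left_le)
    qed (use W(4)[of t s n] that in \<open>simp add: c_def\<close>)
    then show ?thesis unfolding norm_mult using aA A0 by (intro mult_mono) auto
  qed
  define v where "v N t s = (\<Sum>n<N. a n * W n t s)" for N t s
  \<comment> \<open>At time 0 the series is the expansion of \<open>u0\<close>, known to converge in
    L2 only, so the value is prescribed. After \<open>T\<close> the clamp freezes the final state 0,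
    which provides continuity on the whole half-line.\<close>
  define u where "u t s = (if t \<le> 0 then u0 s else \<Sum>n. a n * W n (min t T) s)" for t s
  define g where "g r = (\<Sum>n. a n * W n r L)" for r
  have vc: "continuous_on ({0..T} \<times> {0..L}) (\<lambda>(t, s). v N t s)" for N
    using W(1) unfolding v_def case_prod_beta' I_def by (intro continuous_intros)
  have vcl: "classical_heat B ({0<..<T} - {T / 10}) {0..L} (v N)" for N
    unfolding v_def using W(6) unfolding I_def by (intro classical_heat_sum)
  have vL2: "L2_on 0 L (v N r)" if "r \<in> {0..T}" for N r
    by (rule L2_on_continuous[OF continuous_on_Times_section[OF vc that]])
  have tail: "cmod (u t s - v N t s) \<le> (\<Sum>n. A * c t (n + N))" if "0 < t" "t \<le> T" "0 \<le> s" "s \<le> L" for N t s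
    using suminf_tail_bound[OF Wc[OF that] summable_mult[OF sc[OF that(1)]], of N] that
    by (simp add: u_def v_def)
  have um: "u t \<in> borel_measurable (ivl L)" if "0 < t" "t \<le> T" for t
  proof -
    have "W n t \<in> borel_measurable (ivl L)" for n
      using that by (intro measurable_ivl continuous_on_Times_section[OF W(1)[unfolded I_def]]) auto
    then have "(\<lambda>s. \<Sum>n. a n * W n t s) \<in> borel_measurable (ivl L)" by measurable
    then show ?thesis using that by (simp add: u_def[abs_def])
  qed
  have uL2: "L2_on 0 L (u t)" if "t \<in> {0..T}" for t
  proof (cases "0 < t")
    case True
    then show ?thesis
      using tail[of t _ 0] that by (intro L2_on_bounded[OF um, of _ "\<Sum>n. A * c t n"]) (auto simp: v_def)
  qed (use that u0 in \<open>simp add: u_def[abs_def]\<close>)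
  have mdiff: "(\<lambda>s. u t s - v N t s) \<in> borel_measurable (ivl L)" if "t \<in> {0..T}" for t N
    using L2_on_diff[OF uL2[OF that] vL2[OF that]] by (simp add: L2_on_def)
  define R where "R N = L2_sq L (\<lambda>s. u0 s - (\<Sum>n<N. a n * of_real (eigf B L n s)))" for N
  have R: "R N = L2_sq L u0 - L / 2 * (\<Sum>n<N. (cmod (a n))\<^sup>2)" for N
    unfolding R_def a_def L2_sq_diff_eigf_sum[OF u0 L] by (simp add: sum_negf)
  have Rlim: "R \<longlonglongrightarrow> 0" unfolding R_def a_def by (rule eigf_expansion[OF L u0])
  have R0: "0 \<le> R N" for N by (simp add: R_def)
  define tb where "tb N = (\<Sum>n. A * b (n + N))" for N
  have tb: "tb \<longlonglongrightarrow> 0" unfolding tb_def by (rule tail_suminf_tendsto_0[OF summable_mult[OF sb]])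
  \<comment> \<open>The first summand covers the times up to \<open>T / 10\<close>, the second the
    later ones; together they form one null sequence that is independent of time.\<close>
  define \<epsilon> where "\<epsilon> N = 2 * R N + L * (tb N)\<^sup>2" for N
  have "\<epsilon> \<longlonglongrightarrow> 2 * 0 + L * 0\<^sup>2" unfolding \<epsilon>_def by (intro tendsto_intros Rlim tb)
  then have \<epsilon>: "\<epsilon> \<longlonglongrightarrow> 0" by simp
  \<comment> \<open>By orthogonality, the error of the free evolution never exceeds the initial one.\<close>
  have free_diff: "L2_sq L (\<lambda>s. v M t s - v N t s) \<le> R N" if t: "0 \<le> t" "t \<le> T / 10" and MN: "N \<le> M" for t M N
  proof -
    \<comment> \<open>The difference is put in the form 0 minus a combination, so that
      \<open>L2_sq_diff_eigf_sum\<close> with \<open>f = 0\<close> evaluates its norm.\<close>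
    define d where "d n = (if n < N then 0 else - (a n * of_real (exp (- ((freq B L n)\<^sup>2 * t)))))" for n
    have split: "{..<M} = {..<N} \<union> {N..<M}" using MN by auto
    have "v M t s - v N t s = 0 - (\<Sum>n<M. d n * of_real (eigf B L n s))" for s
      unfolding v_def split
      by (subst (1 2) sum.union_disjoint) (auto simp: d_def W(2)[OF t(2)] sum_negf mult.assoc)
    then have "L2_sq L (\<lambda>s. v M t s - v N t s) = L2_sq L (\<lambda>s. 0 - (\<Sum>n<M. d n * of_real (eigf B L n s)))"
      by simp
    also have "\<dots> = L / 2 * (\<Sum>n<M. (cmod (d n))\<^sup>2)"
      by (subst L2_sq_diff_eigf_sum[OF L2_on_continuous L]) (auto simp: L2_sq_def coeff_def)
    also have "(\<Sum>n<M. (cmod (d n))\<^sup>2) = (\<Sum>n\<in>{N..<M}. (cmod (d n))\<^sup>2)"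
      unfolding split by (subst sum.union_disjoint) (auto simp: d_def)
    also have "L / 2 * (\<Sum>n\<in>{N..<M}. (cmod (d n))\<^sup>2) \<le> L / 2 * (\<Sum>n\<in>{N..<M}. (cmod (a n))\<^sup>2)"
    proof (intro mult_left_mono sum_mono power_mono)
      fix n assume "n \<in> {N..<M}"
      have "0 \<le> (freq B L n)\<^sup>2 * t" using t by simp
      then have "cmod (a n) * exp (- ((freq B L n)\<^sup>2 * t)) \<le> cmod (a n) * 1"
        by (intro mult_left_mono) auto
      then show "cmod (d n) \<le> cmod (a n)" by (simp add: d_def norm_mult)
    qed (use L in auto)
    also have "\<dots> = R N - R M"
      unfolding R split by (subst sum.union_disjoint) (auto simp: algebra_simps)
    finally show ?thesis using R0[of M] by simp
  qed
  have err: "L2_sq L (\<lambda>s. u t s - v N t s) \<le> \<epsilon> N" if t: "t \<in> {0..T}" for N t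
  proof -
    consider "t = 0" | "0 < t" "t \<le> T / 10" | "T / 10 < t" using t by fastforce
    then show ?thesis
    proof cases
      case 1
      then have "L2_sq L (\<lambda>s. u t s - v N t s) = R N"
        using T by (simp add: R_def u_def v_def W(2))
      then show ?thesis using R0[of N] L by (simp add: \<epsilon>_def add_increasing2)
    next
      case 2
      \<comment> \<open>For this fixed \<open>t\<close> the sup-norm tail beyond \<open>M\<close>
        vanishes as \<open>M\<close> grows, while the part between \<open>N\<close> and
        \<open>M\<close> is bounded by \<open>R N\<close> independently of \<open>t\<close> and
        \<open>M\<close>.\<close>
      have tM: "(\<lambda>M. \<Sum>n. A * c t (n + M)) \<longlonglongrightarrow> 0"
        by (rule tail_suminf_tendsto_0[OF summable_mult[OF sc[OF 2(1)]]])
      have "(\<lambda>M. 2 * (L * (\<Sum>n. A * c t (n + M))\<^sup>2) + 2 * R N) \<longlonglongrightarrow> 2 * (L * 0\<^sup>2) + 2 * R N"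
        by (intro tendsto_intros tM)
      moreover have "L2_sq L (\<lambda>s. u t s - v N t s) \<le> 2 * (L * (\<Sum>n. A * c t (n + M))\<^sup>2) + 2 * R N" if "N \<le> M" for M
      proof -
        have "L2_sq L (\<lambda>s. u t s - v M t s) \<le> L * (\<Sum>n. A * c t (n + M))\<^sup>2"
          using L t 2 by (intro L2_sq_sup_bound mdiff tail) auto
        moreover have "L2_sq L (\<lambda>s. v M t s - v N t s) \<le> R N"
          using 2 that by (intro free_diff) auto
        ultimately show ?thesis
          using L2_sq_diff_le[OF uL2[OF t] vL2[OF t, of M] vL2[OF t, of N]] by linarith
      qed
      ultimately have "L2_sq L (\<lambda>s. u t s - v N t s) \<le> 2 * (L * 0\<^sup>2) + 2 * R N"
        by (intro LIMSEQ_le_const) auto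
      then show ?thesis using L by (simp add: \<epsilon>_def add_increasing2)
    next
      case 3
      have "L2_sq L (\<lambda>s. u t s - v N t s) \<le> L * (tb N)\<^sup>2"
        using tail[of t _ N] 3 t T L by (intro L2_sq_sup_bound mdiff) (auto simp: tb_def c_def)
      then show ?thesis using R0[of N] by (simp add: \<epsilon>_def)
    qed
  qed
  have gQ: "cmod (a n * W n r L) \<le> A * Q n" if "r \<le> T" for n r
    unfolding norm_mult using aA A0 W(5)[OF that] by (intro mult_mono) auto
  define \<delta> where "\<delta> N = (\<Sum>n. A * Q (n + N))" for N
  have \<delta>: "\<delta> \<longlonglongrightarrow> 0" unfolding \<delta>_def by (rule tail_suminf_tendsto_0[OF summable_mult[OF sQ]])
  have gtail: "cmod (v N r L - g r) \<le> \<delta> N" if "r \<le> T" for N r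
    using suminf_tail_bound[OF gQ[OF that] summable_mult[OF sQ], of N]
    by (simp add: g_def v_def \<delta>_def norm_minus_commute)
  have gm: "g \<in> borel_measurable (ivl T)"
  proof -
    have "(\<lambda>r. W n r L) \<in> borel_measurable (ivl T)" for n
      using L by (intro measurable_ivl continuous_on_Times_section'[OF W(1)[unfolded I_def]]) auto
    then show ?thesis unfolding g_def[abs_def] by measurable
  qed
  have gb: "cmod (g r) \<le> A * suminf Q" if "r \<in> {0<..<T}" for r
    using gtail[of r 0] that by (simp add: v_def \<delta>_def suminf_mult[OF sQ])
  have gL2: "L2_on 0 T g" by (rule L2_on_bounded[OF gm gb])
  have ucont: "\<exists>d>0. \<forall>r\<ge>0. \<bar>r - t\<bar> < d \<longrightarrow> L2_sq L (\<lambda>s. u r s - u t s) < e" if t0: "0 \<le> t" and e: "0 < e" for t e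
  proof -
    have clamp: "u r = u (min r T)" if "0 \<le> r" for r
      using that T by (auto simp: u_def min_def fun_eq_iff)
    have "min t T \<in> {0..T}" using t0 T by auto
    then obtain d where d: "0 < d" "\<And>r. r \<in> {0..T} \<Longrightarrow> \<bar>r - min t T\<bar> < d \<Longrightarrow>
        L2_sq L (\<lambda>s. u r s - u (min t T) s) < e"
      using L2_continuous_of_uniform_limit[OF L vc uL2 err \<epsilon> _ e] by metis
    show ?thesis
    proof (intro exI[of _ d] conjI allI impI d(1))
      fix r assume r: "0 \<le> r" "\<bar>r - t\<bar> < d"
      have "\<bar>min r T - min t T\<bar> < d" using r by (auto simp: min_def)
      then show "L2_sq L (\<lambda>s. u r s - u t s) < e"
        using d(2)[of "min r T"] r T clamp[OF r(1)] clamp[OF t0] by simp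
    qed
  qed
  have uT: "u T s = 0" for s using T by (simp add: u_def W(3))
  have "C0_L2 L u"
    unfolding C0_L2_def
  proof (intro conjI allI impI)
    fix t :: real assume t: "0 \<le> t"
    have "u t = u (min t T)" using t T by (auto simp: u_def min_def fun_eq_iff)
    then show "L2_on 0 L (u t)" using uL2[of "min t T"] t T by simp
    have "((\<lambda>r. L2_sq L (\<lambda>s. u r s - u t s)) \<longlongrightarrow> 0) (at t within {0..})"
      unfolding tendsto_iff eventually_at
    proof (intro allI impI)
      fix e :: real assume "0 < e"
      then obtain d where "d > 0" "\<forall>r\<ge>0. \<bar>r - t\<bar> < d \<longrightarrow> L2_sq L (\<lambda>s. u r s - u t s) < e"
        using ucont[OF t] by blast
      then show "\<exists>d>0. \<forall>r\<in>{0..}. r \<noteq> t \<and> dist r t < d \<longrightarrow> dist (L2_sq L (\<lambda>s. u r s - u t s)) 0 < e"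
        by (intro exI[of _ d]) (auto simp: dist_real_def)
    qed
    from tendsto_real_sqrt[OF this]
    show "((\<lambda>r. L2_norm_on 0 L (\<lambda>s. u r s - u t s)) \<longlongrightarrow> 0) (at t within {0..})"
      by (simp add: L2_norm_on_eq)
  qed
  moreover have "u 0 s = u0 s" for s by (simp add: u_def)
  ultimately have sol: "heat_solution B L T g u0 u"
    unfolding heat_solution_def
  proof (intro conjI allI impI ballI)
    fix \<phi> \<phi>t \<phi>s \<phi>ss t
    assume test: "test_function B L T \<phi> \<phi>t \<phi>s \<phi>ss" and t: "t \<in> {0..T}"
    have u_0: "u 0 = u0" by (simp add: u_def fun_eq_iff)
    have gt: "cmod (v N r L - g r) \<le> \<delta> N" if "r \<in> {0<..<T}" for N r
      using gtail[of r N] that by simp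
    show "(LINT s|ivl L. of_real (\<phi> t s) * u t s) - (LINT s|ivl L. of_real (\<phi> 0 s) * u0 s)
     = (LINT r|ivl t. LINT s|ivl L. of_real (\<phi>t r s + \<phi>ss r s) * u r s)
       - (LINT r|ivl t. of_real (\<phi>s r L) * g r)"
      by (rule transposition_limit[OF L _ _ test vc _ vcl uL2 err \<epsilon> gt \<delta>, unfolded u_0])
         (use t in auto)
  qed auto
  have "L2_sq T g \<le> T * (A * suminf Q)\<^sup>2"
    using T by (intro L2_sq_sup_bound gm gb) auto
  then have "L2_norm_on 0 T g \<le> sqrt (T * (A * suminf Q)\<^sup>2)" by (simp add: L2_norm_on_eq)
  also have "\<dots> = sqrt T * (A * suminf Q)"
    using A0 suminf_nonneg[OF sQ Q0] by (simp add: real_sqrt_mult)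
  also have "\<dots> \<le> sqrt T * (A * (K * inverse_square_sum))"
    using A0 T sumQ by (intro mult_left_mono) auto
  also have "\<dots> = sqrt (2 * T / L) * (10500 * pi * inverse_square_sum * X\<^sup>2 * exp (301 / 162 * X)) * L2_norm_on 0 L u0"
    using T L by (simp add: A_def K_def real_sqrt_mult real_sqrt_divide)
  finally show ?thesis using that[OF gL2 sol uT] by (simp add: X_def)
qed

theorem theorem2p2:
  fixes \<alpha> :: real
  assumes "\<alpha> > 2 * (36 / 37)\<^sup>2"
  shows "\<exists>C::real. C > 0 \<and>
    (\<forall>(B::boundary_op) (L::real) (T::real) (u0::real \<Rightarrow> complex).
       L > 0 \<longrightarrow> 0 < T \<longrightarrow> T \<le> (min pi L)\<^sup>2 \<longrightarrow> L2_on 0 L u0 \<longrightarrow>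
       (\<exists>g::real \<Rightarrow> complex.
          L2_on 0 T g \<and>
          (\<exists>u. heat_solution B L T g u0 u) \<and>
          (\<forall>u. heat_solution B L T g u0 u \<longrightarrow> (AE s in lebesgue_on {0<..<L}. u T s = 0)) \<and>
          L2_norm_on 0 T g \<le> C * exp (\<alpha> * L\<^sup>2 / T) * L2_norm_on 0 L u0))"
proof -
  define K where "K = 10500 * pi * inverse_square_sum"
  \<comment> \<open>The 20000 is from X^2 <= 20000 exp(X/100), the quadratic Taylor bound at X/100;
    the final 1 makes \<open>C\<close> visibly positive.\<close>
  define C where "C = sqrt (2 * pi) * (K * 20000) + 1"
  have K: "0 \<le> K"
    using suminf_nonneg[OF summable_inverse_square] by (simp add: K_def inverse_square_sum_def)
  show ?thesis
  proof (intro exI[of _ C] conjI allI impI)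
    show "C > 0" using K by (simp add: C_def add_nonneg_pos)
    fix B L T and u0 :: "real \<Rightarrow> complex"
    assume L: "0 < L" and T: "0 < T" and TL: "T \<le> (min pi L)\<^sup>2" and u0: "L2_on 0 L u0"
    obtain g u where g: "L2_on 0 T g" "heat_solution B L T g u0 u" "\<And>s. u T s = 0"
      "L2_norm_on 0 T g \<le> sqrt (2 * T / L) * (K * (L\<^sup>2 / T)\<^sup>2 * exp (301 / 162 * (L\<^sup>2 / T))) * L2_norm_on 0 L u0"
      using null_control[OF L T u0, of B thesis] unfolding K_def by blast
    \<comment> \<open>Here the restriction on \<open>T\<close> enters: it turns the prefactor
      sqrt(2T/L) into an absolute constant.\<close>
    have "(min pi L)\<^sup>2 \<le> pi * L"
      using L by (auto simp: power2_eq_square min_def intro!: mult_mono)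
    then have "2 * T / L \<le> 2 * pi" using TL L by (simp add: field_simps)
    then have 1: "sqrt (2 * T / L) \<le> sqrt (2 * pi)" by simp
    define X where "X = L\<^sup>2 / T"
    have X: "0 < X" using L T by (simp add: X_def)
    have "(X / 100)\<^sup>2 / 2 \<le> exp (X / 100)"
      using exp_lower_Taylor_quadratic[of "X / 100"] X by simp
    then have "X\<^sup>2 \<le> 20000 * exp (X / 100)" by (simp add: power_divide)
    then have "X\<^sup>2 * exp (301 / 162 * X) \<le> 20000 * exp (X / 100) * exp (301 / 162 * X)"
      by (intro mult_right_mono) auto
    also have "\<dots> = 20000 * exp ((1 / 100 + 301 / 162) * X)"
      unfolding mult.assoc exp_add[symmetric] by (simp add: algebra_simps)
    also have "\<dots> \<le> 20000 * exp (\<alpha> * X)"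
    proof -
      \<comment> \<open>Numerically 1.868... against 2(36/37)^2 = 1.893...; the gap above 301/162
        leaves room for the polynomial factor.\<close>
      have "1 / 100 + 301 / 162 \<le> \<alpha>" using assms by (simp add: power2_eq_square)
      then show ?thesis using X by (simp add: mult_right_mono)
    qed
    finally have 2: "K * (X\<^sup>2 * exp (301 / 162 * X)) \<le> K * (20000 * exp (\<alpha> * X))"
      using K by (rule mult_left_mono)
    have "L2_norm_on 0 T g \<le> sqrt (2 * T / L) * (K * (X\<^sup>2 * exp (301 / 162 * X))) * L2_norm_on 0 L u0"
      using g(4) by (simp add: X_def mult.assoc)
    also have "\<dots> \<le> sqrt (2 * pi) * (K * (20000 * exp (\<alpha> * X))) * L2_norm_on 0 L u0"
      using K by (intro mult_right_mono mult_mono 1 2) (auto simp: L2_norm_on_eq)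
    also have "\<dots> \<le> C * exp (\<alpha> * X) * L2_norm_on 0 L u0"
      by (intro mult_right_mono) (auto simp: C_def algebra_simps L2_norm_on_eq)
    finally have "L2_norm_on 0 T g \<le> C * exp (\<alpha> * L\<^sup>2 / T) * L2_norm_on 0 L u0"
      by (simp add: X_def)
    then show "\<exists>g. L2_on 0 T g \<and> (\<exists>u. heat_solution B L T g u0 u) \<and>
        (\<forall>u. heat_solution B L T g u0 u \<longrightarrow> (AE s in lebesgue_on {0<..<L}. u T s = 0)) \<and>
        L2_norm_on 0 T g \<le> C * exp (\<alpha> * L\<^sup>2 / T) * L2_norm_on 0 L u0"
      using g(1,2) heat_solution_final_unique[OF L T _ g(2,3)] by blast
  qed
qed

end
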